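(* Let $m=1$, $n=3$, $\eta=O_2$ (no squeezing), $N=0$ and $0<\alpha<1$. For $\theta\in\mathbb C$ write $\beta_{\mathrm{inv}}(\theta)=\mathrm{Tr}[(|\theta\rangle\langle\theta|)^{\otimes3}\hat\Pi^{\mathrm{inv}}_0]$ and $\beta_{\mathrm{HH}}(\theta)=\mathrm{Tr}[(|\theta\rangle\langle\theta|)^{\otimes3}\hat\Pi^{\mathrm{HH}}_0]$. (i) There exists $s>0$ such that $\beta_{\mathrm{inv}}(\theta)<\beta_{\mathrm{HH}}(\theta)$ whenever $0<|\theta|<s$. (ii) There exists $t>0$ such that $\beta_{\mathrm{inv}}(\theta)>\beta_{\mathrm{HH}}(\theta)$ whenever $|\theta|>t$.
   Context: $\mathcal H=L^2(\mathbb R)$ and $\hat a=(\hat q+i\hat p)/\sqrt2$, with $(\hat qf)(x)=xf(x)$ and $(\hat pf)(x)=-if'(x)$. The coherent vector is $|\theta\rangle(x)=\pi^{-1/4}e^{-|\theta|^2/2}\exp(-x^2/2+\sqrt2\theta x-\theta^2/2)$. On $\mathcal H^{\otimes3}$, $\hat a_j$ is $\hat a$ on factor $j$. Invariant test: $\hat v_{j,k}=\hat a_k^*\hat a_j-\hat a_j^*\hat a_k$, $\hat R_k=\exp(\arctan(\sqrt k)\hat v_{k,k+1})$ for $k=1,2$, $\hat R=\hat R_2\hat R_1$, and $\hat T_{\mathrm{inv}}=\sum_{k=1}^{2}\hat R^*\hat v_{k,3}\hat v_{k,3}^*\hat R$. Let $\hat K_0$ be the orthogonal projection onto $\{f: f^*\hat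 T_{\mathrm{inv}}f\le0\}$. The level-$\alpha$ squeezing-invariant test for $N=0$ is given by $\hat\Pi^{\mathrm{inv}}_0=(1-\alpha)\hat K_0$. Heterodyne–Hotelling test: for $z=(z_1,z_2,z_3)\in\mathbb C^{1\times 3}$ let $|z\rangle=|z_1\rangle\otimes|z_2\rangle\otimes|z_3\rangle$ and $\vec X_j=(\mathrm{Re}z_j,\mathrm{Im}z_j)^t\in\mathbb R^2$. Put $\bar X=\frac13\sum_j\vec X_j$, $\bar\Sigma=\frac12\sum_j(\vec X_j-\bar X)\,{}^t(\vec X_j-\bar X)$, $T^2=3\,{}^t\bar X\bar\Sigma^{-1}\bar X$ and $F_{\mathrm{HH}}=\frac12\cdot\frac12T^2$ (that is, $(n-1)^{-1}(\nu/\mu)T^2$ with $\mu=2$, $\nu=1$). Let $c$ solve $\int_c^\infty p_0(f)\,df=\alpha$, where $p_0$ is the density of the central $F$-distribution with $2$ and $1$ degrees of freedom. Then \[\hat\Pi^{\mathrm{HH}}_0=\pi^{-3}\int_{F_{\mathrm{HH}}(z)\le c}|z\rangle\langle z|\prod_{j}d(\mathrm{Re}z_j)\,d(\mathrm{Im}z_j).\] *)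

theory Defs
  imports "HOL-Analysis.Analysis"
begin

text \<open>Wave functions on the three-mode space: L2(R)^{tensor 3} is identified with L2(R^3),
  factor j being the coordinate x$j.\<close>
type_synonym wf = "real^3 \<Rightarrow> complex"

definition coh :: "complex \<Rightarrow> real \<Rightarrow> complex" where
  "coh \<theta> x = complex_of_real (pi powr (-1/4) * exp (- (cmod \<theta>)\<^sup>2 / 2)) *
     exp (- (complex_of_real x)\<^sup>2 / 2 + complex_of_real (sqrt 2) * \<theta> * complex_of_real x - \<theta>\<^sup>2 / 2)"

definition prodcoh :: "complex^3 \<Rightarrow> wf" where
  "prodcoh z x = coh (z$1) (x$1) * coh (z$2) (x$2) * coh (z$3) (x$3)"

definition psi :: "complex \<Rightarrow> wf" where
  "psi \<theta> = prodcoh (\<chi> j. \<theta>)"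

definition l2inner :: "wf \<Rightarrow> wf \<Rightarrow> complex" where
  "l2inner f g = (\<integral>x. cnj (f x) * g x \<partial>lborel)"

definition sqint :: "wf \<Rightarrow> bool" where
  "sqint f \<longleftrightarrow> f \<in> borel_measurable lborel \<and> integrable lborel (\<lambda>x. (cmod (f x))\<^sup>2)"

definition L2norm :: "wf \<Rightarrow> real" where
  "L2norm f = sqrt (\<integral>x. (cmod (f x))\<^sup>2 \<partial>lborel)"

definition dpart :: "3 \<Rightarrow> wf \<Rightarrow> wf" where
  "dpart j f x = vector_derivative (\<lambda>t::real. f (x + t *\<^sub>R axis j 1)) (at 0)"

fun dparts :: "3 list \<Rightarrow> wf \<Rightarrow> wf" where
  "dparts [] f = f"
| "dparts (j # js) f = dpart j (dparts js f)"

definition smooth3 :: "wf \<Rightarrow> bool" where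
  "smooth3 f \<longleftrightarrow> (\<forall>js x. dparts js f differentiable (at x))"

definition qop :: "3 \<Rightarrow> wf \<Rightarrow> wf" where
  "qop j f x = complex_of_real (x$j) * f x"

definition pop :: "3 \<Rightarrow> wf \<Rightarrow> wf" where
  "pop j f x = - \<i> * dpart j f x"

definition aop :: "3 \<Rightarrow> wf \<Rightarrow> wf" where
  "aop j f x = (qop j f x + \<i> * pop j f x) / complex_of_real (sqrt 2)"

definition adag :: "3 \<Rightarrow> wf \<Rightarrow> wf" where
  "adag j f x = (qop j f x - \<i> * pop j f x) / complex_of_real (sqrt 2)"

definition vop :: "3 \<Rightarrow> 3 \<Rightarrow> wf \<Rightarrow> wf" where
  "vop j k f x = adag k (aop j f) x - adag j (aop k f) x"

definition vstar :: "3 \<Rightarrow> 3 \<Rightarrow> wf \<Rightarrow> wf" where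
  "vstar j k f x = adag j (aop k f) x - adag k (aop j f) x"

text \<open>exp(t G) f for a (differential) generator G: the value at time t of the
  unique smooth solution u of d/ds u(s) = G u(s), u(0) = f.\<close>
definition opexp :: "(wf \<Rightarrow> wf) \<Rightarrow> real \<Rightarrow> wf \<Rightarrow> wf" where
  "opexp G t f = (THE g. \<exists>u :: real \<Rightarrow> wf. u 0 = f \<and> (\<forall>s. smooth3 (u s)) \<and>
      (\<forall>s x. ((\<lambda>r. u r x) has_vector_derivative G (u s) x) (at s)) \<and> g = u t)"

definition phi :: "real \<Rightarrow> real" where
  "phi k = arctan (sqrt k)"

definition Rop :: "wf \<Rightarrow> wf" where
  "Rop f = opexp (vop 2 3) (phi 2) (opexp (vop 1 2) (phi 1) f)"

definition Rstar :: "wf \<Rightarrow> wf" where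
  "Rstar f = opexp (vstar 1 2) (phi 1) (opexp (vstar 2 3) (phi 2) f)"

definition Tinv :: "wf \<Rightarrow> wf" where
  "Tinv f x = Rstar (vop 1 3 (vstar 1 3 (Rop f))) x + Rstar (vop 2 3 (vstar 2 3 (Rop f))) x"

definition qform :: "wf \<Rightarrow> complex" where
  "qform f = l2inner f (Tinv f)"

definition domT :: "wf \<Rightarrow> bool" where
  "domT f \<longleftrightarrow> smooth3 f \<and> sqint f \<and> integrable lborel (\<lambda>x. cnj (f x) * Tinv f x)"

definition S0 :: "wf set" where
  "S0 = {f. domT f \<and> Re (qform f) \<le> 0 \<and> Im (qform f) = 0}"

definition is_proj :: "wf set \<Rightarrow> wf \<Rightarrow> wf \<Rightarrow> bool" where
  "is_proj S \<psi> g \<longleftrightarrow> sqint g \<and> (\<forall>\<epsilon>>0. \<exists>h\<in>S. L2norm (g - h) < \<epsilon>) \<and>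
     (\<forall>h\<in>S. l2inner h (\<psi> - g) = 0)"

text \<open>beta_inv(theta) = Tr[(|theta><theta|)^{(x)3} (1-alpha) K_0] = (1-alpha) <psi, K_0 psi>.\<close>
definition beta_inv :: "real \<Rightarrow> complex \<Rightarrow> real" where
  "beta_inv \<alpha> \<theta> = (1 - \<alpha>) * Re (l2inner (psi \<theta>) (SOME g. is_proj S0 (psi \<theta>) g))"

definition Xv :: "complex^3 \<Rightarrow> 3 \<Rightarrow> real^2" where
  "Xv z j = vector [Re (z$j), Im (z$j)]"

definition Xbar :: "complex^3 \<Rightarrow> real^2" where
  "Xbar z = (1/3) *\<^sub>R (\<Sum>j\<in>UNIV. Xv z j)"

definition outer :: "real^2 \<Rightarrow> real^2 \<Rightarrow> real^2^2" where
  "outer u w = (\<chi> a b. u$a * w$b)"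

definition Sigmabar :: "complex^3 \<Rightarrow> real^2^2" where
  "Sigmabar z = (1/2) *\<^sub>R (\<Sum>j\<in>UNIV. outer (Xv z j - Xbar z) (Xv z j - Xbar z))"

definition T2 :: "complex^3 \<Rightarrow> real" where
  "T2 z = 3 * (Xbar z \<bullet> (matrix_inv (Sigmabar z) *v Xbar z))"

definition FHH :: "complex^3 \<Rightarrow> real" where
  "FHH z = (1/2) * (1/2) * T2 z"

definition Fdens :: "real \<Rightarrow> real \<Rightarrow> real \<Rightarrow> real" where
  "Fdens d1 d2 x = (if x > 0 then (1 / Beta (d1/2) (d2/2)) * (d1/d2) powr (d1/2) *
      x powr (d1/2 - 1) * (1 + d1 * x / d2) powr (- (d1 + d2) / 2) else 0)"

definition beta_HH :: "real \<Rightarrow> complex \<Rightarrow> real" where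
  "beta_HH c \<theta> = (1 / pi^3) *
     (\<integral>z\<in>{z::complex^3. FHH z \<le> c}. (cmod (l2inner (prodcoh z) (psi \<theta>)))\<^sup>2 \<partial>lborel)"

end

theory Submission
  imports Defs "HOL-Probability.Probability" "HOL-Complex_Analysis.Complex_Analysis" "HOL-Real_Asymp.Real_Asymp"
begin

text \<open>
  The generator $\hat v_{j,k}$ is the angular momentum operator $x_k \partial_j - x_j \partial_k$, so its
  exponentials are rotations of the argument and $\hat K_0$ is the projection onto the radial
  functions. The radial part of a product of equal coherent states is explicit, and with $y = 3|\theta|^2$
  its norm gives $\beta_{\mathrm{inv}}(\theta) = (1 - \alpha)(1 - e^{-2y})/(2y)$.

  Writing $z = a + ib$ and $n = a \times b$, the event $F_{\mathrm{HH}} \le c$ says that the angle between $n$ and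
  $u = (1,1,1)$ satisfies $|\cos| \ge \alpha = (1 + 2c)^{-1/2}$. For $\theta = 0$ its probability is $1 - \alpha$, and
  the sign symmetries of $a$ and $b$ give $\beta_{\mathrm{HH}}(\theta) \ge e^{-y}(1 - \alpha + m|\theta|^2)$ with $m > 0$, while
  $(1 - \alpha)(1 - e^{-2y})/(2y) = (1 - \alpha)(1 - y + O(y^2))$: this is (i). Since $n$ is orthogonal to $a$ and $b$,
  every $z$ in the event has distance at least $\alpha\sqrt{y}$ from $(\theta,\theta,\theta)$, so $\beta_{\mathrm{HH}}$ decays
  exponentially in $y$ whereas $\beta_{\mathrm{inv}}$ decays like $1/y$: this is (ii).
\<close>

text \<open>\<open>opexp\<close> is a definite description, so an exponential is known only once its
  evolution equation has exactly one solution. The admissible families \<open>u\<close> are smooth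
  in space at each time but only differentiable in time at each point, and the usual chain rule
  along orbits needs joint regularity. Uniqueness for this weak notion is the main analytic
  obstacle. A second one is that \<open>S0\<close> is cut out by a sign condition on an integral
  over all of space, without integrability of the angular derivatives of its members. Integration by
  parts is therefore done on centred balls, where rotations create no boundary term, and the radius
  tends to infinity afterwards. \<open>beta_inv\<close> selects its projection by choice and is
  evaluated through inner products with an explicit candidate, the average of the state over
  spheres. Archimedes' hat-box theorem, saying that axis coordinate and squared norm have constant
  joint density, supplies both this average and the factor 1 - \<alpha>. Both powers tend to 1 -
  \<alpha> as \<theta> tends to 0, so (i) is decided by the terms linear in |\<theta>|^2; the gain m
  comes from second moments of a . u and b . u over an event of positive measure.\<close>

no_notation fps_nth (infixl "$" 75)

section \<open>Smooth wave functions\<close>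

lemma dpart_eqI:
  assumes "(f has_derivative D) (at x)"
  shows "dpart j f x = D (axis j 1)"
proof -
  have "((\<lambda>t::real. x + t *\<^sub>R axis j 1) has_derivative (\<lambda>t. t *\<^sub>R axis j 1)) (at 0)"
    by (auto intro!: derivative_eq_intros)
  from diff_chain_at[OF this, of f D] assms
  have "((\<lambda>t. f (x + t *\<^sub>R axis j 1)) has_derivative (\<lambda>t. D (t *\<^sub>R axis j 1))) (at 0)"
    by (simp add: o_def)
  then have "((\<lambda>t. f (x + t *\<^sub>R axis j 1)) has_vector_derivative D (axis j 1)) (at 0)"
    using has_derivative_linear[OF assms] by (simp add: has_vector_derivative_def linear_cmul)
  then show ?thesis unfolding dpart_def by (rule vector_derivative_at)
qed

lemma has_derivative_dpart:
  assumes "f differentiable (at x)"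
  shows "(f has_derivative (\<lambda>h. \<Sum>j\<in>UNIV. h$j *\<^sub>R dpart j f x)) (at x)"
proof -
  obtain D where D: "(f has_derivative D) (at x)" using assms by (auto simp: differentiable_def)
  have "D h = (\<Sum>j\<in>UNIV. h$j *\<^sub>R dpart j f x)" for h
  proof -
    have lin: "linear D" using D by (rule has_derivative_linear)
    have "h = (\<Sum>j\<in>UNIV. h$j *\<^sub>R axis j 1)"
      by (simp add: basis_expansion flip: scalar_mult_eq_scaleR)
    then have "D h = D (\<Sum>j\<in>UNIV. h$j *\<^sub>R axis j 1)" by simp
    also have "\<dots> = (\<Sum>j\<in>UNIV. h$j *\<^sub>R D (axis j 1))"
      using lin by (simp add: linear_sum linear_cmul)
    finally show ?thesis by (simp add: dpart_eqI[OF D])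
  qed
  then show ?thesis using D by (metis (no_types, lifting) ext)
qed

lemma sum_axis_scaleR: "(\<Sum>i\<in>UNIV. axis j (1::real) $ i *\<^sub>R g i) = (g j :: complex)"
proof -
  have "(\<Sum>i\<in>UNIV. axis j (1::real) $ i *\<^sub>R g i) = (\<Sum>i\<in>UNIV. if i = j then g i else 0)"
    by (intro sum.cong) (auto simp: axis_def)
  then show ?thesis by simp
qed

text \<open>\<open>dparts\<close> applies the head of its list last, so a derivative taken before
  all others sits at the end of the list; this is how smoothness passes to
  \<open>dpart j f\<close>.\<close>

lemma dparts_snoc: "dparts (js @ [j]) f = dparts js (dpart j f)"
  by (induction js) auto

lemma smooth3_dpart: "smooth3 f \<Longrightarrow> smooth3 (dpart j f)"
  unfolding smooth3_def by (metis dparts_snoc)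

lemma smooth3_differentiable: "smooth3 f \<Longrightarrow> f differentiable (at x)"
  unfolding smooth3_def by (metis dparts.simps(1))

lemmas smooth3_has_derivative = has_derivative_dpart[OF smooth3_differentiable]

lemma smooth3_continuous: "smooth3 f \<Longrightarrow> continuous_on S f"
  by (meson continuous_at_imp_continuous_on differentiable_imp_continuous_within smooth3_differentiable)

text \<open>Smoothness is a greatest fixed point: iterated derivatives never leave a class that is
  closed under each \<open>dpart\<close>. The basic closure results below exhibit such a class
  instead of computing derivatives of all orders.\<close>

lemma smooth3_coinduct:
  assumes "f \<in> C" and "\<And>g x. g \<in> C \<Longrightarrow> g differentiable (at x)" and "\<And>g j. g \<in> C \<Longrightarrow> dpart j g \<in> C"
  shows "smooth3 f"
proof -
  have "dparts js f \<in> C" for js by (induction js) (auto simp: assms)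
  then show ?thesis unfolding smooth3_def using assms by blast
qed

lemma dpart_add:
  assumes "f differentiable (at x)" "g differentiable (at x)"
  shows "dpart j (\<lambda>x. f x + g x) x = dpart j f x + dpart j g x"
proof -
  note d = has_derivative_add[OF assms[THEN has_derivative_dpart]]
  show ?thesis by (subst dpart_eqI[OF d]) (simp add: sum_axis_scaleR)
qed

lemma dpart_mult:
  assumes "f differentiable (at x)" "g differentiable (at x)"
  shows "dpart j (\<lambda>x. f x * g x) x = f x * dpart j g x + dpart j f x * g x"
proof -
  note d = has_derivative_mult[OF assms[THEN has_derivative_dpart]]
  show ?thesis by (subst dpart_eqI[OF d]) (simp add: sum_axis_scaleR)
qed

lemma smooth3_add:
  assumes "smooth3 f" "smooth3 g" shows "smooth3 (\<lambda>x. f x + g x)"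
proof (rule smooth3_coinduct[where C = "{(\<lambda>x. f x + g x) |f g. smooth3 f \<and> smooth3 g}"])
  fix h j assume "h \<in> {(\<lambda>x. f x + g x) |f g. smooth3 f \<and> smooth3 g}"
  then obtain f g where h: "h = (\<lambda>x. f x + g x)" "smooth3 f" "smooth3 g" by auto
  then show "h differentiable (at x)" for x by (simp add: differentiable_add smooth3_differentiable)
  have "dpart j h = (\<lambda>x. dpart j f x + dpart j g x)"
    unfolding h(1) using h(2,3) by (intro ext dpart_add smooth3_differentiable)
  then show "dpart j h \<in> {(\<lambda>x. f x + g x) |f g. smooth3 f \<and> smooth3 g}"
    using h smooth3_dpart by blast
qed (use assms in auto)

text \<open>The Leibniz rule turns one product into a sum of two, so products alone are not
  invariant under \<open>dpart\<close>, while finite sums of products are.\<close>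

inductive_set smooth_products :: "wf set" where
  base: "smooth3 f \<Longrightarrow> smooth3 g \<Longrightarrow> (\<lambda>x. f x * g x) \<in> smooth_products"
| add: "f \<in> smooth_products \<Longrightarrow> g \<in> smooth_products \<Longrightarrow> (\<lambda>x. f x + g x) \<in> smooth_products"

lemma smooth_products_step:
  "h \<in> smooth_products \<Longrightarrow> (\<forall>x. h differentiable (at x)) \<and> dpart j h \<in> smooth_products"
proof (induction rule: smooth_products.induct)
  case (base f g)
  have "dpart j (\<lambda>x. f x * g x) = (\<lambda>x. f x * dpart j g x + dpart j f x * g x)"
    using base by (auto simp: fun_eq_iff intro!: dpart_mult smooth3_differentiable)
  moreover have "(\<lambda>x. f x * g x) differentiable (at x)" for x
    using base by (intro differentiable_mult smooth3_differentiable)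
  ultimately show ?case using base by (auto intro!: smooth_products.intros smooth3_dpart)
next
  case (add f g)
  then have "dpart j (\<lambda>x. f x + g x) = (\<lambda>x. dpart j f x + dpart j g x)"
    by (auto simp: fun_eq_iff intro!: dpart_add)
  then show ?case using add by (auto intro: smooth_products.intros)
qed

lemma smooth3_mult: "smooth3 f \<Longrightarrow> smooth3 g \<Longrightarrow> smooth3 (\<lambda>x. f x * g x)"
  by (rule smooth3_coinduct[where C = smooth_products])
     (auto simp: smooth_products_step smooth_products.base)

lemma dpart_const: "dpart j (\<lambda>x. c) = (\<lambda>x. 0)"
  by (rule ext) (simp add: dpart_def)

lemma has_derivative_coord [derivative_intros]:
  "((\<lambda>x::real^3. complex_of_real (x$i)) has_derivative (\<lambda>h. complex_of_real (h$i))) (at x within S)"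
  by (intro bounded_linear_imp_has_derivative bounded_linear_compose[OF bounded_linear_of_real] bounded_linear_vec_nth)

lemma dpart_coord: "dpart j (\<lambda>x. complex_of_real (x$i)) x = (if i = j then 1 else 0)"
  by (subst dpart_eqI[OF has_derivative_coord]) (auto simp: axis_def)

lemma smooth3_const [simp]: "smooth3 (\<lambda>x. c)"
  by (rule smooth3_coinduct[where C = "range (\<lambda>c x. c)"]) (auto simp: dpart_const)

lemma smooth3_coord [simp]: "smooth3 (\<lambda>x. complex_of_real (x$i))"
proof (rule smooth3_coinduct[where C = "insert (\<lambda>x. complex_of_real (x$i)) (range (\<lambda>c x. c))"])
  fix g j assume "g \<in> insert (\<lambda>x. complex_of_real (x$i)) (range (\<lambda>c x. c))"
  then show "dpart j g \<in> insert (\<lambda>x. complex_of_real (x$i)) (range (\<lambda>c x. c))"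
    by (cases "i = j") (auto simp: dpart_const dpart_coord[abs_def])
  show "g differentiable (at x)" for x
    using \<open>g \<in> _\<close> has_derivative_coord by (auto simp: differentiable_def intro: has_derivative_const)
qed auto

text \<open>The module over the smooth functions generated by \<open>B\<close>. A chain rule sends a
  generator to a combination of generators with smooth coefficients, which lies in this module but
  seldom in \<open>B\<close> itself.\<close>

inductive_set smooth_span :: "wf set \<Rightarrow> wf set" for B where
  base: "smooth3 p \<Longrightarrow> b \<in> B \<Longrightarrow> (\<lambda>x. p x * b x) \<in> smooth_span B"
| add: "f \<in> smooth_span B \<Longrightarrow> g \<in> smooth_span B \<Longrightarrow> (\<lambda>x. f x + g x) \<in> smooth_span B"

lemma smooth_span_mult: "f \<in> smooth_span B \<Longrightarrow> smooth3 q \<Longrightarrow> (\<lambda>x. q x * f x) \<in> smooth_span B"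
proof (induction rule: smooth_span.induct)
  case (base p b)
  then show ?case using smooth_span.base[of "\<lambda>x. q x * p x" b B] by (simp add: smooth3_mult mult.assoc)
next
  case (add f g)
  then show ?case using smooth_span.add by (simp add: distrib_left)
qed

lemma smooth_span_step:
  assumes B: "\<And>b x. b \<in> B \<Longrightarrow> b differentiable (at x)" "\<And>b. b \<in> B \<Longrightarrow> dpart j b \<in> smooth_span B"
  shows "h \<in> smooth_span B \<Longrightarrow> (\<forall>x. h differentiable (at x)) \<and> dpart j h \<in> smooth_span B"
proof (induction rule: smooth_span.induct)
  case (base p b)
  have "dpart j (\<lambda>x. p x * b x) = (\<lambda>x. p x * dpart j b x + dpart j p x * b x)"
    using base B by (intro ext dpart_mult) (auto intro: smooth3_differentiable)
  moreover have "(\<lambda>x. p x * b x) differentiable (at x)" for x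
    using base B by (intro differentiable_mult) (auto intro: smooth3_differentiable)
  moreover have "(\<lambda>x. p x * dpart j b x + dpart j p x * b x) \<in> smooth_span B"
    using base B by (intro smooth_span.add smooth_span_mult smooth_span.base smooth3_dpart)
  ultimately show ?case by simp
next
  case (add f g)
  then have "dpart j (\<lambda>x. f x + g x) = (\<lambda>x. dpart j f x + dpart j g x)"
    by (auto simp: fun_eq_iff intro!: dpart_add)
  then show ?case using add by (auto intro: smooth_span.intros)
qed

text \<open>By the Leibniz rule the module is invariant under \<open>dpart\<close> as soon as the
  generators are differentiable and differentiate into it, so only generators have to be
  examined.\<close>

lemma smooth3_span:
  assumes B: "\<And>b x. b \<in> B \<Longrightarrow> b differentiable (at x)" "\<And>b j. b \<in> B \<Longrightarrow> dpart j b \<in> smooth_span B"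
    and "b \<in> B"
  shows "smooth3 b"
proof (rule smooth3_coinduct[where C = "smooth_span B"])
  show "b \<in> smooth_span B" using smooth_span.base[of "\<lambda>x. 1" b B] assms by simp
qed (use smooth_span_step[of B] B in blast)+

lemma dpart_linear_compose:
  assumes A: "linear A" and f: "f differentiable (at (A x))"
  shows "dpart j (\<lambda>x. f (A x)) x = (\<Sum>i\<in>UNIV. complex_of_real (A (axis j 1) $ i) * dpart i f (A x))"
    and "(\<lambda>x. f (A x)) differentiable (at x)"
proof -
  have "(A has_derivative A) (at x)" using A by (simp add: bounded_linear_imp_has_derivative linear_linear)
  from diff_chain_at[OF this has_derivative_dpart[OF f]]
  have d: "((\<lambda>x. f (A x)) has_derivative (\<lambda>h. \<Sum>j\<in>UNIV. A h$j *\<^sub>R dpart j f (A x))) (at x)"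
    by (simp add: o_def)
  show "dpart j (\<lambda>x. f (A x)) x = (\<Sum>i\<in>UNIV. complex_of_real (A (axis j 1) $ i) * dpart i f (A x))"
    by (subst dpart_eqI[OF d]) (simp add: scaleR_conv_of_real)
  show "(\<lambda>x. f (A x)) differentiable (at x)" using d by (auto simp: differentiable_def)
qed

lemma smooth3_linear_compose:
  assumes A: "linear A" and f: "smooth3 f"
  shows "smooth3 (\<lambda>x. f (A x))"
proof (rule smooth3_span[where B = "{(\<lambda>x. f (A x)) |f. smooth3 f}"])
  let ?B = "{(\<lambda>x. f (A x)) |f. smooth3 f}"
  fix b j assume "b \<in> ?B"
  then obtain f where f: "b = (\<lambda>x. f (A x))" "smooth3 f" by auto
  show "b differentiable (at x)" for x using f dpart_linear_compose(2)[OF A] smooth3_differentiable by auto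
  have *: "(\<lambda>x. complex_of_real (A (axis j 1) $ i) * dpart i f (A x)) \<in> smooth_span ?B" for i
    by (rule smooth_span.base) (use f smooth3_dpart in auto)
  have "dpart j b = (\<lambda>x. (complex_of_real (A (axis j 1) $ 1) * dpart 1 f (A x)
        + complex_of_real (A (axis j 1) $ 2) * dpart 2 f (A x)) + complex_of_real (A (axis j 1) $ 3) * dpart 3 f (A x))"
    unfolding f(1) by (rule ext, subst dpart_linear_compose(1)[OF A smooth3_differentiable[OF f(2)]]) (simp add: sum_3)
  then show "dpart j b \<in> smooth_span ?B"
    using smooth_span.add[OF smooth_span.add[OF *[of 1] *[of 2]] *[of 3]] by simp
qed (use assms in auto)

text \<open>Differentiating gives \<open>2 * x$j\<close> times the pullback of G', which is again
  entire, so pullbacks of entire functions span an invariant module. Writing a radial function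
  through the squared norm avoids the singularity of the norm at the origin.\<close>

lemma smooth3_radial:
  assumes "G holomorphic_on UNIV"
  shows "smooth3 (\<lambda>x. G (complex_of_real (x \<bullet> x)))"
proof (rule smooth3_span[where B = "{(\<lambda>x. G (complex_of_real (x \<bullet> x))) |G. G holomorphic_on UNIV}"])
  let ?B = "{(\<lambda>x. G (complex_of_real (x \<bullet> x))) |G. G holomorphic_on UNIV} :: wf set"
  fix b j assume "b \<in> ?B"
  then obtain G where G: "b = (\<lambda>x. G (complex_of_real (x \<bullet> x)))" "G holomorphic_on UNIV" by auto
  have d: "(b has_derivative (\<lambda>h. deriv G (complex_of_real (x \<bullet> x)) * complex_of_real (x \<bullet> h + h \<bullet> x))) (at x)" for x
  proof -
    have "(G has_derivative (*) (deriv G (complex_of_real (x \<bullet> x)))) (at (complex_of_real (x \<bullet> x)))"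
      using holomorphic_derivI[OF G(2)] by (simp add: has_field_derivative_def)
    moreover have "((\<lambda>x. complex_of_real (x \<bullet> x)) has_derivative (\<lambda>h. complex_of_real (x \<bullet> h + h \<bullet> x))) (at x)"
      by (auto intro!: derivative_eq_intros)
    ultimately show ?thesis unfolding G(1) by (auto dest: diff_chain_at simp: o_def)
  qed
  then show "b differentiable (at x)" for x by (auto simp: differentiable_def)
  have "dpart j b x = 2 * complex_of_real (x$j) * deriv G (complex_of_real (x \<bullet> x))" for x
    by (subst dpart_eqI[OF d]) (simp add: inner_axis inner_commute[of "axis j 1"])
  then have "dpart j b = (\<lambda>x. (2 * complex_of_real (x$j)) * deriv G (complex_of_real (x \<bullet> x)))" by auto
  also have "\<dots> \<in> smooth_span ?B"
    by (rule smooth_span.base) (use G in \<open>auto intro!: smooth3_mult holomorphic_deriv\<close>)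
  finally show "dpart j b \<in> smooth_span ?B" .
qed (use assms in auto)

text \<open>The second difference over a square of side h is an increment in t of f(x + t e_j + h
  e_k) - f(x + t e_j). Its t-derivative is a difference of two values of \<open>dpart j f\<close>
  near x, controlled up to o(h) by the differentiability of that function at x; the mean value
  inequality then gives o(h^2).\<close>

lemma mixed_difference:
  assumes f: "smooth3 f" and e: "e > 0"
  shows "\<exists>d>0. \<forall>h. 0 < h \<and> h < d \<longrightarrow> norm (f (x + h *\<^sub>R axis j 1 + h *\<^sub>R axis k 1) - f (x + h *\<^sub>R axis j 1)
     - f (x + h *\<^sub>R axis k 1) + f x - h\<^sup>2 *\<^sub>R dpart k (dpart j f) x) \<le> e * h\<^sup>2"
proof -
  let ?g = "dpart j f" and ?ej = "axis j 1 :: real^3" and ?ek = "axis k 1 :: real^3"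
  define D where "D h = (\<Sum>j\<in>UNIV. h$j *\<^sub>R dpart j ?g x)" for h
  have g: "(?g has_derivative D) (at x)" unfolding D_def using f by (intro smooth3_has_derivative smooth3_dpart)
  have linD: "linear D" using g by (rule has_derivative_linear)
  have Dk: "D ?ek = dpart k ?g x" using dpart_eqI[OF g] by simp
  \<comment> \<open>A third of e suffices because the two displacements used below have lengths at
    most 2h and h. The same factor 2 is the reason for halving d.\<close>
  obtain d where d: "d > 0" and gd: "\<And>y. norm (y - x) < d \<Longrightarrow> norm (?g y - ?g x - D (y - x)) \<le> e / 3 * norm (y - x)"
    using g e unfolding has_derivative_at_alt by (metis divide_pos_pos zero_less_numeral)
  have "norm (f (x + h *\<^sub>R ?ej + h *\<^sub>R ?ek) - f (x + h *\<^sub>R ?ej) - f (x + h *\<^sub>R ?ek) + f x - h\<^sup>2 *\<^sub>R dpart k ?g x) \<le> e * h\<^sup>2"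
    if h: "0 < h" "h < d / 2" for h
  proof -
    \<comment> \<open>Subtracting the linear term makes the increment of \<open>P\<close> over [0,h]
      equal to the quantity to be bounded.\<close>
    define P where "P t = f (x + t *\<^sub>R ?ej + h *\<^sub>R ?ek) - f (x + t *\<^sub>R ?ej) - (t * h) *\<^sub>R D ?ek" for t
    define P' where "P' t = ?g (x + t *\<^sub>R ?ej + h *\<^sub>R ?ek) - ?g (x + t *\<^sub>R ?ej) - h *\<^sub>R D ?ek" for t
    have line: "((\<lambda>t. f (y + t *\<^sub>R ?ej)) has_vector_derivative ?g (y + t *\<^sub>R ?ej)) (at t within S)" for y t S
    proof -
      have "((\<lambda>t::real. y + t *\<^sub>R ?ej) has_derivative (\<lambda>t. t *\<^sub>R ?ej)) (at t)"
        by (auto intro!: derivative_eq_intros)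
      from diff_chain_at[OF this smooth3_has_derivative[OF f]]
      have "((\<lambda>t. f (y + t *\<^sub>R ?ej)) has_vector_derivative ?g (y + t *\<^sub>R ?ej)) (at t)"
        by (simp add: o_def has_vector_derivative_def sum_axis_scaleR flip: scaleR_scaleR scaleR_sum_right)
      then show ?thesis by (rule has_vector_derivative_at_within)
    qed
    have P: "(P has_vector_derivative P' t) (at t within {0..h})" for t
    proof -
      have "((\<lambda>t. f ((x + h *\<^sub>R ?ek) + t *\<^sub>R ?ej)) has_vector_derivative ?g ((x + h *\<^sub>R ?ek) + t *\<^sub>R ?ej)) (at t within {0..h})"
        by (rule line)
      then have "((\<lambda>t. f (x + t *\<^sub>R ?ej + h *\<^sub>R ?ek)) has_vector_derivative ?g (x + t *\<^sub>R ?ej + h *\<^sub>R ?ek)) (at t within {0..h})"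
        by (simp add: add_ac)
      moreover have "((\<lambda>t. (t * h) *\<^sub>R D ?ek) has_vector_derivative h *\<^sub>R D ?ek) (at t within {0..h})"
        by (auto intro!: derivative_eq_intros)
      ultimately show ?thesis unfolding P_def P'_def by (intro has_vector_derivative_diff line)
    qed
    have P'le: "norm (P' t) \<le> e * h" if t: "t \<in> {0..h}" for t
    proof -
      have n1: "norm (t *\<^sub>R ?ej + h *\<^sub>R ?ek) \<le> 2 * h" using t h norm_triangle_ineq[of "t *\<^sub>R ?ej" "h *\<^sub>R ?ek"] by simp
      have n2: "norm (t *\<^sub>R ?ej) \<le> h" using t h by simp
      have a: "norm (?g (x + t *\<^sub>R ?ej + h *\<^sub>R ?ek) - ?g x - D (t *\<^sub>R ?ej + h *\<^sub>R ?ek)) \<le> e/3 * (2 * h)"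
        using gd[of "x + t *\<^sub>R ?ej + h *\<^sub>R ?ek"] n1 h e by (auto simp: add.assoc intro!: order_trans[OF _ mult_left_mono[OF n1]])
      have b: "norm (?g (x + t *\<^sub>R ?ej) - ?g x - D (t *\<^sub>R ?ej)) \<le> e/3 * h"
        using gd[of "x + t *\<^sub>R ?ej"] n2 h e by (auto intro!: order_trans[OF _ mult_left_mono[OF n2]])
      have "P' t = (?g (x + t *\<^sub>R ?ej + h *\<^sub>R ?ek) - ?g x - D (t *\<^sub>R ?ej + h *\<^sub>R ?ek)) - (?g (x + t *\<^sub>R ?ej) - ?g x - D (t *\<^sub>R ?ej))"
        unfolding P'_def using linD by (simp add: linear_add linear_cmul)
      then have "norm (P' t) \<le> e/3 * (2 * h) + e/3 * h" using order_trans[OF norm_triangle_ineq4 add_mono[OF a b]] by (simp only:)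
      then show ?thesis by (simp add: field_simps)
    qed
    have "norm (P h - P 0) \<le> e * h * norm (h - 0)"
      by (rule differentiable_bound[where S = "{0..h}" and f' = "\<lambda>t s. s *\<^sub>R P' t"])
         (use P P'le h in \<open>auto simp: has_vector_derivative_def onorm_scaleR_left onorm_id\<close>)
    then show ?thesis unfolding P_def Dk[symmetric] using h
      by (simp add: power2_eq_square algebra_simps)
  qed
  then show ?thesis using d by (intro exI[of _ "d/2"]) auto
qed

text \<open>The second difference is symmetric in j and k, so after division by h^2 it approximates
  both mixed derivatives. With e a quarter of their distance, the two errors together cover only
  half of it.\<close>

lemma dpart_commute:
  assumes f: "smooth3 f"
  shows "dpart j (dpart k f) x = dpart k (dpart j f) x"
proof (rule ccontr)
  let ?A = "dpart k (dpart j f) x" and ?B = "dpart j (dpart k f) x"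
  assume "?B \<noteq> ?A"
  define e where "e = norm (?A - ?B) / 4"
  have e: "e > 0" using \<open>?B \<noteq> ?A\<close> by (simp add: e_def)
  obtain d1 where d1: "d1 > 0" "\<And>h. 0 < h \<Longrightarrow> h < d1 \<Longrightarrow> norm (f (x + h *\<^sub>R axis j 1 + h *\<^sub>R axis k 1) - f (x + h *\<^sub>R axis j 1)
     - f (x + h *\<^sub>R axis k 1) + f x - h\<^sup>2 *\<^sub>R ?A) \<le> e * h\<^sup>2"
    using mixed_difference[OF f e] by blast
  obtain d2 where d2: "d2 > 0" "\<And>h. 0 < h \<Longrightarrow> h < d2 \<Longrightarrow> norm (f (x + h *\<^sub>R axis k 1 + h *\<^sub>R axis j 1) - f (x + h *\<^sub>R axis k 1)
     - f (x + h *\<^sub>R axis j 1) + f x - h\<^sup>2 *\<^sub>R ?B) \<le> e * h\<^sup>2"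
    using mixed_difference[OF f e] by blast
  define h where "h = min d1 d2 / 2"
  have h: "0 < h" "h < d1" "h < d2" using d1(1) d2(1) by (auto simp: h_def)
  let ?d = "f (x + h *\<^sub>R axis j 1 + h *\<^sub>R axis k 1) - f (x + h *\<^sub>R axis j 1) - f (x + h *\<^sub>R axis k 1) + f x"
  have "norm (?d - h\<^sup>2 *\<^sub>R ?A) \<le> e * h\<^sup>2" using d1(2) h by blast
  moreover have "norm (?d - h\<^sup>2 *\<^sub>R ?B) \<le> e * h\<^sup>2"
  proof -
    have sw: "x + h *\<^sub>R axis k 1 + h *\<^sub>R axis j 1 = x + h *\<^sub>R axis j 1 + h *\<^sub>R axis k 1" by (simp add: add_ac)
    have eq: "f (x + h *\<^sub>R axis k 1 + h *\<^sub>R axis j 1) - f (x + h *\<^sub>R axis k 1) - f (x + h *\<^sub>R axis j 1) + f x = ?d"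
      unfolding sw by simp
    show ?thesis using d2(2)[OF h(1) h(3)] unfolding eq .
  qed
  ultimately have "norm ((?d - h\<^sup>2 *\<^sub>R ?B) - (?d - h\<^sup>2 *\<^sub>R ?A)) \<le> e * h\<^sup>2 + e * h\<^sup>2"
    using order_trans[OF norm_triangle_ineq4 add_mono] by blast
  also have "(?d - h\<^sup>2 *\<^sub>R ?B) - (?d - h\<^sup>2 *\<^sub>R ?A) = h\<^sup>2 *\<^sub>R (?A - ?B)" by (simp add: algebra_simps)
  finally have "h\<^sup>2 * (4 * e) \<le> h\<^sup>2 * (2 * e)" by (simp add: e_def)
  then show False using h e by simp
qed

text \<open>Up to the factor 1/2, a creation operator times an annihilation operator is (x_k -
  d_k)(x_j + d_j). Antisymmetrisation cancels x_j x_k and, because mixed partials commute, also d_j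
  d_k; as j and k differ, no commutator of a coordinate with its own derivative arises. A first
  order operator remains, that is, a vector field.\<close>

lemma vop_eq:
  assumes f: "smooth3 f" and jk: "j \<noteq> k"
  shows "vop j k f = (\<lambda>x. complex_of_real (x$k) * dpart j f x - complex_of_real (x$j) * dpart k f x)"
proof
  fix x
  have a: "aop j f = (\<lambda>x. (1 / complex_of_real (sqrt 2)) * (complex_of_real (x$j) * f x + dpart j f x))" for j
    by (simp add: aop_def qop_def pop_def fun_eq_iff field_simps)
  have s: "smooth3 (\<lambda>x. complex_of_real (x$j) * f x)" "smooth3 (dpart j f)" for j
    using f by (auto intro!: smooth3_mult smooth3_dpart)
  have d: "dpart k (aop j f) x = (1 / complex_of_real (sqrt 2)) * (complex_of_real (x$j) * dpart k f x + dpart k (dpart j f) x)"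
    if "j \<noteq> k" for j k
    unfolding a using that f s
    by (subst dpart_mult) (simp_all add: dpart_mult smooth3_differentiable dpart_add smooth3_add smooth3_mult dpart_const dpart_coord)
  have s2: "complex_of_real (sqrt 2) * complex_of_real (sqrt 2) = 2"
    by (metis of_real_mult of_real_numeral real_sqrt_mult_self abs_numeral)
  show "vop j k f x = complex_of_real (x$k) * dpart j f x - complex_of_real (x$j) * dpart k f x"
    unfolding vop_def adag_def qop_def pop_def
    using d[OF jk] d[OF jk[symmetric]] dpart_commute[OF f, of j k x] s2
    by (simp add: a field_simps)
qed

lemma vstar_eq_vop: "vstar j k = vop k j"
  by (simp add: vstar_def vop_def fun_eq_iff)

lemma smooth3_diff: "smooth3 f \<Longrightarrow> smooth3 g \<Longrightarrow> smooth3 (\<lambda>x. f x - g x)"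
  using smooth3_add[of f "\<lambda>x. (-1) * g x"] smooth3_mult[of "\<lambda>x. -1" g] by simp

lemma smooth3_vop: "smooth3 f \<Longrightarrow> j \<noteq> k \<Longrightarrow> smooth3 (vop j k f)"
  by (simp add: vop_eq smooth3_diff smooth3_mult smooth3_dpart)

section \<open>Uniqueness for the transport equation\<close>

lemma has_vector_derivative_iff_quotient:
  fixes f :: "real \<Rightarrow> 'a::real_normed_vector"
  shows "(f has_vector_derivative D) (at x) \<longleftrightarrow> ((\<lambda>h. (f (x + h) - f x) /\<^sub>R h) \<longlongrightarrow> D) (at 0)"
proof -
  have "(f has_vector_derivative D) (at x) \<longleftrightarrow> ((\<lambda>h. norm (f (x + h) - f x - h *\<^sub>R D) / norm h) \<longlongrightarrow> 0) (at 0)"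
    by (simp add: has_vector_derivative_def has_derivative_at bounded_linear_scaleR_left)
  also have "\<dots> \<longleftrightarrow> ((\<lambda>h. norm ((f (x + h) - f x) /\<^sub>R h - D)) \<longlongrightarrow> 0) (at 0)"
  proof (rule tendsto_cong)
    have "norm (f (x + h) - f x - h *\<^sub>R D) / norm h = norm ((f (x + h) - f x) /\<^sub>R h - D)" if "h \<noteq> 0" for h
    proof -
      have "(f (x + h) - f x) /\<^sub>R h - D = (f (x + h) - f x - h *\<^sub>R D) /\<^sub>R h"
        using that by (simp add: scaleR_diff_right)
      then show ?thesis by (simp add: divide_inverse_commute)
    qed
    then show "\<forall>\<^sub>F h in at 0. norm (f (x + h) - f x - h *\<^sub>R D) / norm h = norm ((f (x + h) - f x) /\<^sub>R h - D)"
      by (auto simp: eventually_at_filter)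
  qed
  also have "\<dots> \<longleftrightarrow> ((\<lambda>h. (f (x + h) - f x) /\<^sub>R h) \<longlongrightarrow> D) (at 0)"
    by (simp add: tendsto_norm_zero_iff LIM_zero_iff)
  finally show ?thesis .
qed

text \<open>For differentiable \<open>v\<close>, letting l tend to 0 shows that the quotient with
  step k is within n|k| of the derivative. No derivative occurs in the condition itself, so it
  survives pointwise limits in a parameter, as an application of Baire's theorem requires.\<close>

definition quasi_smooth :: "nat \<Rightarrow> (real \<Rightarrow> complex) \<Rightarrow> bool" where
  "quasi_smooth n v \<longleftrightarrow> (\<forall>p k l. k \<noteq> 0 \<longrightarrow> l \<noteq> 0 \<longrightarrow>
     norm ((v (p + k) - v p) /\<^sub>R k - (v (p + l) - v p) /\<^sub>R l) \<le> real n * (\<bar>k\<bar> + \<bar>l\<bar>))"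

lemma quasi_smoothD:
  "quasi_smooth n v \<Longrightarrow> k \<noteq> 0 \<Longrightarrow> l \<noteq> 0 \<Longrightarrow>
     norm ((v (p + k) - v p) /\<^sub>R k - (v (p + l) - v p) /\<^sub>R l) \<le> real n * (\<bar>k\<bar> + \<bar>l\<bar>)"
  by (simp add: quasi_smooth_def)

text \<open>A Lipschitz derivative keeps the quotient with step k within C|k| of the derivative, by
  the mean value inequality, and the triangle inequality compares two steps. C is rounded up to a
  natural number to obtain a countable cover later.\<close>

lemma quasi_smooth_ex:
  assumes d: "\<And>p. (v has_vector_derivative v' p) (at p)"
    and C: "\<And>p q. norm (v' p - v' q) \<le> C * \<bar>p - q\<bar>"
  shows "\<exists>n. quasi_smooth n v"
proof -
  have C0: "C \<ge> 0" using C[of 0 1] by simp (meson norm_ge_zero order_trans)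
  have q: "norm ((v (p + k) - v p) /\<^sub>R k - v' p) \<le> C * \<bar>k\<bar>" if k: "k \<noteq> 0" for p k
  proof -
    define w where "w t = v (p + t) - t *\<^sub>R v' p" for t
    have "((\<lambda>t. v (p + t)) has_vector_derivative v' (p + t)) (at t)" for t
      using vector_diff_chain_at[of "\<lambda>t. p + t" 1 t v "v' (p + t)"] d
      by (simp add: o_def has_vector_derivative_add_const add.commute[of p] has_vector_derivative_id)
    moreover have "((\<lambda>t. t *\<^sub>R v' p) has_vector_derivative v' p) (at t)" for t
      unfolding has_vector_derivative_def by (intro bounded_linear_imp_has_derivative bounded_linear_scaleR_left)
    ultimately have w: "(w has_vector_derivative v' (p + t) - v' p) (at t within S)" for t S
      unfolding w_def by (rule has_vector_derivative_at_within[OF has_vector_derivative_diff])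
    have "norm (w k - w 0) \<le> (C * \<bar>k\<bar>) * norm (k - 0)"
    proof (rule differentiable_bound[where S = "closed_segment 0 k" and f' = "\<lambda>t s. s *\<^sub>R (v' (p + t) - v' p)"])
      fix t assume t: "t \<in> closed_segment 0 k"
      then have "\<bar>t\<bar> \<le> \<bar>k\<bar>" by (auto simp: closed_segment_eq_real_ivl split: if_splits)
      then have "norm (v' (p + t) - v' p) \<le> C * \<bar>k\<bar>"
        using C[of "p + t" p] mult_left_mono[of "\<bar>t\<bar>" "\<bar>k\<bar>" C] C0 by simp
      then show "onorm (\<lambda>s. s *\<^sub>R (v' (p + t) - v' p)) \<le> C * \<bar>k\<bar>"
        by (simp add: onorm_scaleR_left onorm_id)
      show "(w has_derivative (\<lambda>s. s *\<^sub>R (v' (p + t) - v' p))) (at t within closed_segment 0 k)"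
        using w by (simp add: has_vector_derivative_def)
    qed auto
    moreover
    have "(v (p + k) - v p) /\<^sub>R k - v' p = (w k - w 0) /\<^sub>R k"
      using k by (simp add: w_def scaleR_diff_right)
    then have "norm ((v (p + k) - v p) /\<^sub>R k - v' p) = norm (w k - w 0) / \<bar>k\<bar>"
      by (simp add: divide_inverse_commute)
    ultimately show ?thesis using k by (simp add: divide_le_eq)
  qed
  obtain n :: nat where n: "C \<le> real n" using real_arch_simple by blast
  have "norm ((v (p + k) - v p) /\<^sub>R k - (v (p + l) - v p) /\<^sub>R l) \<le> real n * (\<bar>k\<bar> + \<bar>l\<bar>)"
    if "k \<noteq> 0" "l \<noteq> 0" for p k l
  proof -
    have "norm ((v (p + k) - v p) /\<^sub>R k - (v (p + l) - v p) /\<^sub>R l) \<le> C * \<bar>k\<bar> + C * \<bar>l\<bar>"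
      using norm_diff_triangle_ineq[of "(v (p + k) - v p) /\<^sub>R k" "- v' p" "(v (p + l) - v p) /\<^sub>R l" "- v' p"] q[of k p] q[of l p] that
        norm_triangle_ineq4[of "(v (p + k) - v p) /\<^sub>R k - v' p" "(v (p + l) - v p) /\<^sub>R l - v' p"] by simp
    also have "\<dots> \<le> real n * \<bar>k\<bar> + real n * \<bar>l\<bar>" using n by (intro add_mono mult_right_mono) auto
    finally show ?thesis by (simp add: distrib_left)
  qed
  then show ?thesis unfolding quasi_smooth_def by blast
qed

lemma quasi_smooth_translate:
  assumes "quasi_smooth n v"
  shows "quasi_smooth n (\<lambda>p. v (p + c))"
proof -
  have "norm ((v (p + k + c) - v (p + c)) /\<^sub>R k - (v (p + l + c) - v (p + c)) /\<^sub>R l) \<le> real n * (\<bar>k\<bar> + \<bar>l\<bar>)"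
    if "k \<noteq> 0" "l \<noteq> 0" for p k l
  proof -
    have eq: "p + k + c = (p + c) + k" "p + l + c = (p + c) + l" by simp_all
    show ?thesis unfolding eq by (rule quasi_smoothD[OF assms that])
  qed
  then show ?thesis unfolding quasi_smooth_def by simp
qed

text \<open>For fixed p, k, l the inequality involves just three values of \<open>u s\<close>, so
  continuity in s at each point is enough; the set is an intersection of closed sets.\<close>

lemma closed_quasi_smooth:
  assumes "\<And>p. continuous_on UNIV (\<lambda>s. u s p)"
  shows "closed {s::real. quasi_smooth n (u s)}"
proof -
  have "closed {s. norm ((u s (p + k) - u s p) /\<^sub>R k - (u s (p + l) - u s p) /\<^sub>R l) \<le> real n * (\<bar>k\<bar> + \<bar>l\<bar>)}" for p k l
    by (intro closed_Collect_le continuous_intros assms)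
  then show ?thesis unfolding quasi_smooth_def
    by (intro closed_Collect_all closed_Collect_imp) auto
qed

lemma norm_diff3_le:
  fixes a b c d :: "'a::real_normed_vector"
  shows "norm (a - b - c - d) \<le> norm a + norm b + norm c + norm d"
  using norm_triangle_ineq4[of "a - b - c" d] norm_triangle_ineq4[of "a - b" c] norm_triangle_ineq4[of a b]
  by linarith

text \<open>The increment along the characteristic splits into a time quotient at q = p - s and a
  space quotient of \<open>u (s + h)\<close> with step -h. The latter varies with h in both slots;
  the bound n, common to all times in I, allows its step to be replaced by a fixed small l, and then
  continuity in time at the two points q and q + l suffices.\<close>

lemma transport_derivative_zero:
  fixes u :: "real \<Rightarrow> real \<Rightarrow> complex"
  assumes ds: "\<And>s p. ((\<lambda>r. u r p) has_vector_derivative d s p) (at s)"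
    and dp: "\<And>s p. (u s has_vector_derivative d s p) (at p)"
    and I: "open I" "s \<in> I" "\<And>r. r \<in> I \<Longrightarrow> quasi_smooth n (u r)"
  shows "((\<lambda>r. u r (p - r)) has_vector_derivative 0) (at s)"
  unfolding has_vector_derivative_iff_quotient
proof (rule tendstoI)
  fix e :: real assume e: "e > 0"
  define q where "q = p - s"
  \<comment> \<open>The denominator makes n l at most e/8, also for n = 0. Together with n|h| < e/8
    the four error terms below are bounded by e/4, e/4, e/4 and e/8.\<close>
  define l where "l = e / (8 * (real n + 1))"
  have l: "l > 0" "real n * l \<le> e / 8" using e by (auto simp: l_def field_simps)
  have cont: "((\<lambda>h. u (s + h) y) \<longlongrightarrow> u s y) (at 0)" for y
  proof -
    have "isCont (\<lambda>r. u r y) s" by (rule has_vector_derivative_continuous[OF ds])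
    then show ?thesis by (simp add: isCont_iff)
  qed
  let ?Q = "\<lambda>h. (u (s + h) (q + l) - u (s + h) q) /\<^sub>R l"
  have near: "norm ((u s (q + l) - u s q) /\<^sub>R l - d s q) \<le> real n * l"
  proof (rule tendsto_le)
    show "((\<lambda>k. real n * (l + \<bar>k\<bar>)) \<longlongrightarrow> real n * l) (at 0)" by (auto intro!: tendsto_eq_intros)
    show "((\<lambda>k. norm ((u s (q + l) - u s q) /\<^sub>R l - (u s (q + k) - u s q) /\<^sub>R k))
        \<longlongrightarrow> norm ((u s (q + l) - u s q) /\<^sub>R l - d s q)) (at 0)"
      using dp[of s q, unfolded has_vector_derivative_iff_quotient] by (intro tendsto_intros)
    show "\<forall>\<^sub>F k in at 0. norm ((u s (q + l) - u s q) /\<^sub>R l - (u s (q + k) - u s q) /\<^sub>R k) \<le> real n * (l + \<bar>k\<bar>)"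
      using quasi_smoothD[OF I(3)[OF I(2)], of l _ q] l by (auto simp: eventually_at_filter)
  qed simp
  have a: "\<forall>\<^sub>F h in at 0. norm ((u (s + h) q - u s q) /\<^sub>R h - d s q) < e / 4"
    using tendstoD[OF ds[of q s, unfolded has_vector_derivative_iff_quotient], of "e/4"] e by (simp add: dist_norm)
  have b: "\<forall>\<^sub>F h in at 0. norm (?Q h - (u s (q + l) - u s q) /\<^sub>R l) < e / 4"
  proof -
    have "(?Q \<longlongrightarrow> (u s (q + l) - u s q) /\<^sub>R l) (at 0)" by (intro tendsto_intros cont)
    from tendstoD[OF this, of "e/4"] e show ?thesis by (simp add: dist_norm)
  qed
  have c: "\<forall>\<^sub>F h in at 0. s + h \<in> I"
  proof -
    have "((\<lambda>h. s + h) \<longlongrightarrow> s) (at 0)" by (auto intro!: tendsto_eq_intros)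
    then show ?thesis using I by (auto dest: topological_tendstoD)
  qed
  have g: "\<forall>\<^sub>F h in at 0. real n * \<bar>h\<bar> < e / 8"
    by (rule order_tendstoD(2)[of _ 0]) (use e in \<open>auto intro!: tendsto_eq_intros\<close>)
  have nz: "\<forall>\<^sub>F h in at (0::real). h \<noteq> 0" by (simp add: eventually_at_filter)
  show "\<forall>\<^sub>F h in at 0. dist ((u (s + h) (p - (s + h)) - u s (p - s)) /\<^sub>R h) 0 < e"
    using a b c g nz
  proof eventually_elim
    case (elim h)
    let ?R = "(u (s + h) (q + (- h)) - u (s + h) q) /\<^sub>R (- h)"
    have "norm (?R - ?Q h) \<le> real n * (\<bar>- h\<bar> + \<bar>l\<bar>)"
      using I(3)[OF elim(3)] elim(5) l by (intro quasi_smoothD) auto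
    then have R: "norm (?R - ?Q h) \<le> e / 4" using elim(4) l by (simp add: distrib_left)
    \<comment> \<open>The step is -h, so the space quotient enters with a minus sign and the two
      copies of \<open>d s q\<close> cancel.\<close>
    have "(u (s + h) (q + (- h)) - u s q) /\<^sub>R h = (u (s + h) q - u s q) /\<^sub>R h - ?R"
      by (simp add: scaleR_diff_right)
    then have eq: "(u (s + h) (p - (s + h)) - u s (p - s)) /\<^sub>R h
      = ((u (s + h) q - u s q) /\<^sub>R h - d s q) - (?R - ?Q h) - (?Q h - (u s (q + l) - u s q) /\<^sub>R l)
        - ((u s (q + l) - u s q) /\<^sub>R l - d s q)"
      by (simp add: q_def diff_diff_eq)
    have "norm ((u (s + h) (p - (s + h)) - u s (p - s)) /\<^sub>R h)
        \<le> norm ((u (s + h) q - u s q) /\<^sub>R h - d s q) + norm (?R - ?Q h)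
        + norm (?Q h - (u s (q + l) - u s q) /\<^sub>R l) + norm ((u s (q + l) - u s q) /\<^sub>R l - d s q)"
      unfolding eq by (rule norm_diff3_le)
    then have "norm ((u (s + h) (p - (s + h)) - u s (p - s)) /\<^sub>R h) < e"
      using elim(1,2) R near l e by linarith
    then show ?case by (simp only: dist_norm diff_zero)
  qed
qed

text \<open>The unknown is not assumed to be jointly continuous. The times at which it satisfies a fixed
  second order bound form closed sets that cover the line, so by Baire's theorem one of them contains
  a relatively open part of the set of times near which the solution is not constant along
  characteristics; on that part the chain rule applies.\<close>

lemma transport_unique:
  fixes u :: "real \<Rightarrow> real \<Rightarrow> complex"
  assumes ds: "\<And>s p. ((\<lambda>r. u r p) has_vector_derivative d s p) (at s)"
    and dp: "\<And>s p. (u s has_vector_derivative d s p) (at p)"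
    and lip: "\<And>s. \<exists>C. \<forall>p q. norm (d s p - d s q) \<le> C * \<bar>p - q\<bar>"
  shows "u s p = u 0 (p + s)"
proof -
  \<comment> \<open>\<open>Z\<close> holds the times at which the derivative along every
    characteristic vanishes. On intervals inside \<open>Z\<close> the solution is transported.
    \<open>E\<close>, the complement of the interior of \<open>Z\<close>, is closed; the aim is that
    it is empty.\<close>
  define Z where "Z = {s. \<forall>p. ((\<lambda>r. u r (p - r)) has_vector_derivative 0) (at s)}"
  define E where "E = - interior Z"
  define P where "P n = {s. quasi_smooth n (u s)}" for n
  have contp: "continuous_on UNIV (u s)" for s
    by (intro continuous_at_imp_continuous_on ballI has_vector_derivative_continuous[OF dp])
  have conts: "continuous_on UNIV (\<lambda>r. u r p)" for p
    by (intro continuous_at_imp_continuous_on ballI has_vector_derivative_continuous[OF ds])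
  have closedP: "closed (P n)" for n unfolding P_def by (rule closed_quasi_smooth[OF conts])
  have coverP: "\<exists>n. s \<in> P n" for s
  proof -
    obtain C where "\<And>p q. norm (d s p - d s q) \<le> C * \<bar>p - q\<bar>" using lip[of s] by blast
    from quasi_smooth_ex[OF dp this] show ?thesis by (simp add: P_def)
  qed
  have Zconst: "u r (p - r) = u r' (p - r')" if J: "convex J" "J \<subseteq> Z" "r \<in> J" "r' \<in> J" for J r r' p
  proof -
    have "((\<lambda>r. u r (p - r)) has_vector_derivative 0) (at x within J)" if "x \<in> J" for x
      by (rule has_vector_derivative_at_within) (use J that in \<open>auto simp: Z_def\<close>)
    then have "\<exists>c. \<forall>x\<in>J. u x (p - x) = c"
      by (intro has_derivative_zero_constant[OF J(1)]) (simp add: has_vector_derivative_def)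
    then show ?thesis using J by auto
  qed
  have "E = {}"
  proof (rule ccontr)
    assume "E \<noteq> {}"
    have cE: "closed E" by (simp add: E_def closed_Compl)
    \<comment> \<open>If every \<open>E - P n\<close> were dense in E, these relatively open sets
      would have dense intersection by Baire's theorem, whereas the cover by the \<open>P n\<close>
      makes the intersection empty.\<close>
    have "\<exists>n. \<not> E \<subseteq> closure (E - P n)"
    proof (rule ccontr)
      assume "\<not> ?thesis"
      then have dense: "E \<subseteq> closure (E - P n)" for n by blast
      have "E \<subseteq> closure (\<Inter>(range (\<lambda>n. E - P n)))"
      proof (rule Baire[OF cE])
        fix T assume "T \<in> range (\<lambda>n. E - P n)"
        then obtain n where T: "T = E - P n" by auto
        have "openin (top_of_set E) (E \<inter> - P n)" using closedP by (intro openin_open_Int) auto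
        then show "openin (top_of_set E) T \<and> E \<subseteq> closure T" using T dense by (simp add: Diff_eq)
      qed auto
      moreover have "\<Inter>(range (\<lambda>n. E - P n)) = {}" using coverP by blast
      ultimately show False using \<open>E \<noteq> {}\<close> by (simp only: closure_empty) blast
    qed
    then obtain n x where x: "x \<in> E" "x \<notin> closure (E - P n)" by blast
    from x(2) obtain e where e: "e > 0" "\<forall>y\<in>E - P n. \<not> dist y x < e"
      unfolding closure_approachable by blast
    then have eP: "y \<in> P n" if "y \<in> ball x e" "y \<in> E" for y
      using that by (auto simp: dist_commute)
    \<comment> \<open>Near x the bound n is so far known only at times in \<open>E\<close>. At any
      other time the solution is a translate of the solution at the nearest time of \<open>E\<close>
      towards x, and translation preserves the bound.\<close>
    have all: "quasi_smooth n (u s)" if s: "s \<in> ball x e" for s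
    proof (cases "s \<in> E")
      case True then show ?thesis using eP[OF s] by (simp add: P_def)
    next
      case False
      \<comment> \<open>Walk from s towards x to the first exceptional time.\<close>
      obtain b where b: "b \<in> E" "b \<in> ball x e" and J: "\<And>r. r \<in> closed_segment s b \<Longrightarrow> r \<noteq> b \<Longrightarrow> r \<notin> E"
      proof (cases "s \<le> x")
        case True
        let ?A = "E \<inter> {s..x}"
        have A: "compact ?A" "?A \<noteq> {}" using cE x True by (auto simp: closed_Int_compact)
        obtain b where b: "b \<in> ?A" "\<And>r. r \<in> ?A \<Longrightarrow> b \<le> r" using compact_attains_inf[OF A] by blast
        show ?thesis
        proof (rule that[of b])
          show "b \<in> ball x e" using b(1) s by (simp add: dist_real_def)
          fix r assume "r \<in> closed_segment s b" "r \<noteq> b"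
          then have "s \<le> r" "r < b" "b \<le> x" using b(1) by (auto simp: closed_segment_eq_real_ivl)
          then show "r \<notin> E" using b(2)[of r] by auto
        qed (use b(1) in blast)
      next
        case False
        let ?A = "E \<inter> {x..s}"
        have A: "compact ?A" "?A \<noteq> {}" using cE x False by (auto simp: closed_Int_compact)
        obtain b where b: "b \<in> ?A" "\<And>r. r \<in> ?A \<Longrightarrow> r \<le> b" using compact_attains_sup[OF A] by blast
        show ?thesis
        proof (rule that[of b])
          show "b \<in> ball x e" using b(1) s by (simp add: dist_real_def)
          fix r assume "r \<in> closed_segment s b" "r \<noteq> b"
          then have "r \<le> s" "b < r" "x \<le> b" using b(1) by (auto simp: closed_segment_eq_real_ivl split: if_splits)
          then show "r \<notin> E" using b(2)[of r] by auto
        qed (use b(1) in blast)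
      qed
      have sb: "s \<noteq> b" using b False by auto
      \<comment> \<open>The endpoint b lies in \<open>E\<close> and has to be left out; the value
        there is recovered by continuity in time at a fixed point.\<close>
      let ?J = "closed_segment s b - {b}"
      have "convex ?J"
      proof (cases "s < b")
        case True
        then have "?J = {s..<b}" by (auto simp: closed_segment_eq_real_ivl)
        then show ?thesis by simp
      next
        case False
        then have "?J = {b<..s}" using sb by (auto simp: closed_segment_eq_real_ivl)
        then show ?thesis by simp
      qed
      moreover have "?J \<subseteq> Z"
      proof
        fix r assume "r \<in> ?J"
        then have "r \<notin> E" using J by simp
        then show "r \<in> Z" unfolding E_def using interior_subset[of Z] by blast
      qed
      ultimately have cst: "u r (p - r) = u s (p - s)" if "r \<in> ?J" for r p
        using Zconst[of ?J r s p] that sb by auto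
      have "u b p = u s (p + (b - s))" for p
      proof -
        have nb: "at b within ?J \<noteq> bot"
        proof -
          have "b islimpt closed_segment s b"
            using sb by (intro connected_imp_perfect) (auto, metis ends_in_segment(1,2) singletonD)
          then show ?thesis by (simp add: trivial_limit_within islimpt_punctured[symmetric])
        qed
        have lim1: "((\<lambda>r. u r p) \<longlongrightarrow> u b p) (at b within ?J)"
          using conts[of p] by - (rule Lim_at_imp_Lim_at_within, simp add: continuous_on_eq_continuous_at isCont_def)
        have lim2: "((\<lambda>r. u s (p + r - s)) \<longlongrightarrow> u s (p + b - s)) (at b within ?J)"
        proof -
          have "continuous_on UNIV (\<lambda>r. u s (p + r - s))"
            by (intro continuous_on_compose2[OF contp] continuous_intros) auto
          then show ?thesis by - (rule Lim_at_imp_Lim_at_within, simp add: continuous_on_eq_continuous_at isCont_def)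
        qed
        have "u r p = u s (p + r - s)" if "r \<in> ?J" for r
          using cst[OF that, of "p + r"] by simp
        then have "\<forall>\<^sub>F r in at b within ?J. u s (p + r - s) = u r p" by (auto simp: eventually_at_filter)
        from tendsto_unique[OF nb lim1 Lim_transform_eventually[OF lim2 this]]
        have "u b p = u s (p + b - s)" .
        then show ?thesis by (simp add: add_diff_eq)
      qed
      then have "(\<lambda>p. u b (p + (s - b))) = u s" by auto
      moreover have "quasi_smooth n (u b)" using eP b by (simp add: P_def)
      ultimately show ?thesis using quasi_smooth_translate[of n "u b" "s - b"] by simp
    qed
    \<comment> \<open>With one bound valid on the whole ball the chain rule applies there, which
      places x in the interior of \<open>Z\<close>.\<close>
    have "ball x e \<subseteq> Z"
      unfolding Z_def by (intro subsetI CollectI allI transport_derivative_zero[OF ds dp open_ball _ all])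
    then have "x \<in> interior Z" by (rule interiorI[OF open_ball, rotated]) (use e(1) in simp)
    then show False using x(1) by (simp add: E_def)
  qed
  then have "Z = UNIV" unfolding E_def using interior_subset by auto
  then show ?thesis using Zconst[of UNIV s 0 "p + s"] by simp
qed

section \<open>Exponentials of the generators are rotations\<close>

text \<open>The flow of the vector field with component x_k in direction j and -x_j in direction k,
  which is the field of \<open>vop_eq\<close>; the orientation of the angle is dictated by
  it.\<close>

definition rot :: "3 \<Rightarrow> 3 \<Rightarrow> real \<Rightarrow> real^3 \<Rightarrow> real^3" where
  "rot j k s x = (\<chi> i. if i = j then x$j * cos s + x$k * sin s
     else if i = k then x$k * cos s - x$j * sin s else x$i)"

lemma linear_rot: "linear (rot j k s)"
  by (rule linearI) (auto simp: rot_def vec_eq_iff algebra_simps)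

lemma rot_0 [simp]: "rot j k 0 x = x"
  by (simp add: rot_def vec_eq_iff)

lemma rot_add: "j \<noteq> k \<Longrightarrow> rot j k s (rot j k t x) = rot j k (s + t) x"
  by (auto simp: rot_def vec_eq_iff sin_add cos_add algebra_simps)

lemma rot_swap: "j \<noteq> k \<Longrightarrow> rot k j s = rot j k (- s)"
  by (auto simp: rot_def vec_eq_iff fun_eq_iff)

lemma rot_inner:
  assumes "j \<noteq> k"
  shows "rot j k s x \<bullet> rot j k s y = x \<bullet> y"
proof -
  have split: "(\<Sum>i\<in>UNIV. F i) = F j + (F k + (\<Sum>i\<in>UNIV - {j} - {k}. F i))" for F :: "3 \<Rightarrow> real"
    using sum.remove[of UNIV j F] sum.remove[of "UNIV - {j}" k F] assms by simp
  have rest: "(\<Sum>i\<in>UNIV - {j} - {k}. rot j k s x $ i * rot j k s y $ i) = (\<Sum>i\<in>UNIV - {j} - {k}. x$i * y$i)"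
    by (rule sum.cong) (auto simp: rot_def)
  have id: "(a*c + b*d) * (a'*c + b'*d) + (b*c - a*d) * (b'*c - a'*d) = (a*a' + b*b') * (c\<^sup>2 + d\<^sup>2)"
    for a b a' b' c d :: real by (simp add: power2_eq_square algebra_simps)
  have "rot j k s x $ j * rot j k s y $ j + rot j k s x $ k * rot j k s y $ k
      = (x$j * y$j + x$k * y$k) * ((cos s)\<^sup>2 + (sin s)\<^sup>2)"
    using assms id[of "x$j" "cos s" "x$k" "sin s" "y$j" "y$k"] by (simp add: rot_def)
  then show ?thesis
    using rest by (simp add: inner_vec_def split[of "\<lambda>i. x$i * y$i"] split[of "\<lambda>i. rot j k s x $ i * rot j k s y $ i"])
qed

lemma norm_rot [simp]: "j \<noteq> k \<Longrightarrow> norm (rot j k s x) = norm x"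
  by (simp add: norm_eq_sqrt_inner rot_inner)

lemma orthogonal_rot: "j \<noteq> k \<Longrightarrow> orthogonal_transformation (rot j k s)"
  by (simp add: orthogonal_transformation linear_rot)

text \<open>Differentiating along a flow is applying its vector field at the moving point.\<close>

lemma has_vector_derivative_rot:
  assumes f: "smooth3 f" and jk: "j \<noteq> k"
  shows "((\<lambda>r. f (rot j k r x)) has_vector_derivative vop j k f (rot j k s x)) (at s)"
proof -
  let ?D = "\<lambda>i. if i = j then rot j k s x $ k else if i = k then - rot j k s x $ j else 0"
  have comp: "((\<lambda>r. rot j k r x $ i) has_vector_derivative ?D i) (at s)" for i
    using jk by (auto simp: rot_def intro!: derivative_eq_intros simp flip: has_real_derivative_iff_has_vector_derivative)
  have rd: "((\<lambda>r. rot j k r x) has_derivative (\<lambda>h. h *\<^sub>R (\<chi> i. ?D i))) (at s)"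
  proof (subst has_derivative_componentwise_within, intro ballI)
    fix b :: "real^3" assume "b \<in> Basis"
    then obtain i where b: "b = axis i 1" by (auto simp: Basis_vec_def)
    show "((\<lambda>r. rot j k r x \<bullet> b) has_derivative (\<lambda>h. (h *\<^sub>R (\<chi> i. ?D i)) \<bullet> b)) (at s)"
      using comp[of i] by (simp add: b inner_axis has_vector_derivative_def)
  qed
  from diff_chain_at[OF rd smooth3_has_derivative[OF f]]
  have "((\<lambda>r. f (rot j k r x)) has_derivative
      (\<lambda>h. \<Sum>i\<in>UNIV. (h *\<^sub>R (\<chi> i. ?D i)) $ i *\<^sub>R dpart i f (rot j k s x))) (at s)"
    by (simp only: o_def)
  moreover have "(\<Sum>i\<in>UNIV. (h *\<^sub>R (\<chi> i. ?D i)) $ i *\<^sub>R dpart i f (rot j k s x)) = h *\<^sub>R vop j k f (rot j k s x)" for h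
  proof -
    have "(\<Sum>i\<in>UNIV. (h *\<^sub>R (\<chi> i. ?D i)) $ i *\<^sub>R dpart i f (rot j k s x))
        = (\<Sum>i\<in>{j,k}. (h *\<^sub>R (\<chi> i. ?D i)) $ i *\<^sub>R dpart i f (rot j k s x))"
      by (rule sum.mono_neutral_right) auto
    then show ?thesis using jk by (simp add: vop_eq[OF f jk] scaleR_conv_of_real[where 'a = complex] algebra_simps)
  qed
  ultimately show ?thesis by (simp add: has_vector_derivative_def)
qed

text \<open>A vector field commutes with its own flow: rotations in one plane commute, and the curve
  r -> f(rot s (rot r x)) is differentiated at 0 in two ways.\<close>

lemma vop_rot:
  assumes f: "smooth3 f" and jk: "j \<noteq> k"
  shows "vop j k (\<lambda>x. f (rot j k s x)) x = vop j k f (rot j k s x)"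
proof -
  have sm: "smooth3 (\<lambda>x. f (rot j k s x))" using f linear_rot by (rule smooth3_linear_compose[rotated])
  have "((\<lambda>r. f (rot j k s (rot j k r x))) has_vector_derivative vop j k (\<lambda>x. f (rot j k s x)) x) (at 0)"
    using has_vector_derivative_rot[OF sm jk, of x 0] by simp
  moreover have "((\<lambda>r. f (rot j k s (rot j k r x))) has_vector_derivative vop j k f (rot j k s x)) (at 0)"
  proof -
    have "(\<lambda>r. f (rot j k s (rot j k r x))) = (\<lambda>r. f (rot j k r (rot j k s x)))"
      using jk by (simp add: rot_add add.commute)
    then show ?thesis using has_vector_derivative_rot[OF f jk, of "rot j k s x" 0] by simp
  qed
  ultimately show ?thesis by (rule vector_derivative_unique_at)
qed

text \<open>Existence is the flow itself. For uniqueness a competitor is restricted to one orbit,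
  parametrised by the angle p; there the generator becomes d/dp, so time and angle derivatives
  coincide and transport carries the initial value along.\<close>

lemma opexp_vop:
  assumes f: "smooth3 f" and jk: "j \<noteq> k"
  shows "opexp (vop j k) t f = (\<lambda>x. f (rot j k t x))"
  unfolding opexp_def
proof (rule the_equality)
  show "\<exists>u. u 0 = f \<and> (\<forall>s. smooth3 (u s)) \<and>
      (\<forall>s x. ((\<lambda>r. u r x) has_vector_derivative vop j k (u s) x) (at s)) \<and> (\<lambda>x. f (rot j k t x)) = u t"
    by (rule exI[of _ "\<lambda>s x. f (rot j k s x)"])
       (simp add: smooth3_linear_compose[OF linear_rot f] vop_rot[OF f jk] has_vector_derivative_rot[OF f jk])
next
  fix g assume "\<exists>u. u 0 = f \<and> (\<forall>s. smooth3 (u s)) \<and>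
      (\<forall>s x. ((\<lambda>r. u r x) has_vector_derivative vop j k (u s) x) (at s)) \<and> g = u t"
  then obtain u where u: "u 0 = f" "\<And>s. smooth3 (u s)"
    "\<And>s x. ((\<lambda>r. u r x) has_vector_derivative vop j k (u s) x) (at s)" "g = u t" by blast
  have "u t (rot j k 0 x) = u 0 (rot j k (0 + t) x)" for x
  proof (rule transport_unique[where u = "\<lambda>s p. u s (rot j k p x)" and d = "\<lambda>s p. vop j k (u s) (rot j k p x)"])
    show "((\<lambda>r. u r (rot j k p x)) has_vector_derivative vop j k (u s) (rot j k p x)) (at s)" for s p
      by (rule u(3))
    show "((\<lambda>p. u s (rot j k p x)) has_vector_derivative vop j k (u s) (rot j k p x)) (at p)" for s p
      by (rule has_vector_derivative_rot[OF u(2) jk])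
    fix s
    define w where "w = vop j k (u s)"
    have w: "smooth3 w" unfolding w_def using u(2) jk by (rule smooth3_vop)
    \<comment> \<open>The orbit of x stays in the closed ball of radius |x|, on which the second
      angular derivative of \<open>u s\<close> is bounded; this bound is the Lipschitz
      constant.\<close>
    have "compact (vop j k w ` cball 0 (norm x))"
      using smooth3_vop[OF w jk] by (intro compact_continuous_image smooth3_continuous) auto
    then obtain C where C: "\<And>y. y \<in> cball 0 (norm x) \<Longrightarrow> norm (vop j k w y) \<le> C"
      by (meson bounded_iff compact_imp_bounded imageI)
    have "norm (w (rot j k p x) - w (rot j k q x)) \<le> C * norm (p - q)" for p q
    proof (rule differentiable_bound[where S = UNIV and f' = "\<lambda>t s. s *\<^sub>R vop j k w (rot j k t x)"])
      show "((\<lambda>p. w (rot j k p x)) has_derivative (\<lambda>s. s *\<^sub>R vop j k w (rot j k t x))) (at t within UNIV)" for t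
        using has_vector_derivative_rot[OF w jk] by (simp add: has_vector_derivative_def)
      show "onorm (\<lambda>s. s *\<^sub>R vop j k w (rot j k t x)) \<le> C" for t
        using C[of "rot j k t x"] jk by (simp add: onorm_scaleR_left onorm_id)
    qed auto
    then show "\<exists>C. \<forall>p q. norm (vop j k (u s) (rot j k p x) - vop j k (u s) (rot j k q x)) \<le> C * \<bar>p - q\<bar>"
      by (auto simp: w_def)
  qed
  then show "g = (\<lambda>x. f (rot j k t x))" by (auto simp: u(1,4))
qed

text \<open>Operators act by pullback, so the order of the rotations is opposite to that of the
  exponentials in \<open>Rop\<close>.\<close>

definition Rmap :: "real^3 \<Rightarrow> real^3" where
  "Rmap x = rot 1 2 (phi 1) (rot 2 3 (phi 2) x)"

definition Rmap_inv :: "real^3 \<Rightarrow> real^3" where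
  "Rmap_inv x = rot 3 2 (phi 2) (rot 2 1 (phi 1) x)"

lemma three_neq [simp]: "(1::3) \<noteq> 2" "(2::3) \<noteq> 1" "(1::3) \<noteq> 3" "(3::3) \<noteq> 1" "(2::3) \<noteq> 3" "(3::3) \<noteq> 2"
  by auto

lemma Rmap_inverse [simp]: "Rmap (Rmap_inv x) = x" "Rmap_inv (Rmap x) = x"
  by (simp_all add: Rmap_def Rmap_inv_def rot_swap[of 2 3] rot_swap[of 1 2] rot_add)

lemma orthogonal_Rmap: "orthogonal_transformation Rmap" "orthogonal_transformation Rmap_inv"
proof -
  have eq: "Rmap = rot 1 2 (phi 1) \<circ> rot 2 3 (phi 2)" "Rmap_inv = rot 3 2 (phi 2) \<circ> rot 2 1 (phi 1)"
    by (auto simp: Rmap_def Rmap_inv_def)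
  show "orthogonal_transformation Rmap" "orthogonal_transformation Rmap_inv"
    unfolding eq by (auto intro!: orthogonal_transformation_compose orthogonal_rot)
qed

lemma Rop_eq: assumes f: "smooth3 f" shows "Rop f = (\<lambda>x. f (Rmap x))"
  using smooth3_linear_compose[OF linear_rot f, of 1 2 "phi 1"]
  by (simp add: Rop_def opexp_vop f Rmap_def)

lemma Rstar_eq: assumes f: "smooth3 f" shows "Rstar f = (\<lambda>x. f (Rmap_inv x))"
  using smooth3_linear_compose[OF linear_rot f, of 3 2 "phi 2"]
  by (simp add: Rstar_def vstar_eq_vop opexp_vop f Rmap_inv_def)

lemma smooth3_uminus: "smooth3 f \<Longrightarrow> smooth3 (\<lambda>x. - f x)"
  using smooth3_mult[of "\<lambda>x. -1" f] by simp

lemma dpart_uminus: "smooth3 f \<Longrightarrow> dpart j (\<lambda>x. - f x) x = - dpart j f x"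
  using dpart_mult[of "\<lambda>x. -1" x f j] by (simp add: smooth3_differentiable dpart_const)

lemma vop_swap: "smooth3 f \<Longrightarrow> j \<noteq> k \<Longrightarrow> vop k j f = (\<lambda>x. - vop j k f x)"
  by (simp add: vop_eq)

lemma vop_uminus: "smooth3 f \<Longrightarrow> j \<noteq> k \<Longrightarrow> vop j k (\<lambda>x. - f x) = (\<lambda>x. - vop j k f x)"
  by (simp add: vop_eq smooth3_uminus dpart_uminus algebra_simps)

text \<open>The adjoint of each generator is its negative, so v v^* becomes -v^2, and conjugation by
  the exponentials is an orthogonal change of variables.\<close>

lemma Tinv_eq:
  assumes f: "smooth3 f"
  defines "w \<equiv> (\<lambda>x. f (Rmap x))"
  shows "Tinv f x = - (vop 1 3 (vop 1 3 w) (Rmap_inv x) + vop 2 3 (vop 2 3 w) (Rmap_inv x))"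
proof -
  have w: "smooth3 w" unfolding w_def
    by (rule smooth3_linear_compose[OF _ f]) (rule orthogonal_transformation_linear[OF orthogonal_Rmap(1)])
  have "vop k 3 (vstar k 3 (Rop f)) = (\<lambda>x. - vop k 3 (vop k 3 w) x)" if "k \<noteq> 3" for k
    using w that by (simp add: Rop_eq[OF f] vstar_eq_vop vop_swap[of w k 3] vop_uminus smooth3_vop flip: w_def)
  then show ?thesis
    using w by (simp add: Tinv_def Rstar_eq smooth3_uminus smooth3_vop)
qed

section \<open>The kernel of the invariant form consists of the radial functions\<close>

lemma distr_lborel_orthogonal:
  fixes A :: "real^3 \<Rightarrow> real^3"
  assumes A: "orthogonal_transformation A"
  shows "distr lborel borel A = lborel"
proof (rule lborel_eqI[symmetric])
  fix l u :: "real^3" assume lu: "\<And>b. b \<in> Basis \<Longrightarrow> l \<bullet> b \<le> u \<bullet> b"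
  have contA: "continuous_on UNIV A"
    using A by (simp add: linear_continuous_on linear_linear orthogonal_transformation_linear)
  then have Am: "A \<in> lborel \<rightarrow>\<^sub>M borel" by (simp add: borel_measurable_continuous_onI)
  have inv: "orthogonal_transformation (inv A)" "A -` box l u = inv A ` box l u"
    using A by (auto simp: orthogonal_transformation_inv bij_vimage_eq_inv_image orthogonal_transformation_bij)
  have bx: "box l u \<in> lmeasurable" by simp
  have "A -` box l u \<in> sets borel" using open_vimage[OF open_box contA] by (rule borel_open)
  then have "emeasure lborel (A -` box l u) = emeasure lebesgue (A -` box l u)" by simp
  also have "\<dots> = ennreal (measure lebesgue (inv A ` box l u))"
    unfolding inv(2) by (rule emeasure_eq_measure2[OF measurable_orthogonal_image[OF inv(1) bx]])
  also have "\<dots> = ennreal (measure lebesgue (box l u))"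
    by (simp only: measure_orthogonal_image[OF inv(1) bx])
  also have "\<dots> = emeasure lebesgue (box l u)" by (rule emeasure_eq_measure2[OF bx, symmetric])
  also have "\<dots> = emeasure lborel (box l u)" by simp
  also have "\<dots> = (\<Prod>b\<in>Basis. (u - l) \<bullet> b)" using lu by (rule emeasure_lborel_box)
  finally show "emeasure (distr lborel borel A) (box l u) = (\<Prod>b\<in>Basis. (u - l) \<bullet> b)"
    using Am by (simp add: emeasure_distr)
qed simp

lemma measurable_orthogonal:
  fixes A :: "real^3 \<Rightarrow> real^3"
  assumes "orthogonal_transformation A" shows "A \<in> borel \<rightarrow>\<^sub>M borel"
  using assms by (simp add: borel_measurable_continuous_onI linear_continuous_on linear_linear orthogonal_transformation_linear)

lemma integral_orthogonal:
  fixes A :: "real^3 \<Rightarrow> real^3" and f :: "_ \<Rightarrow> 'b::{banach, second_countable_topology}"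
  assumes A: "orthogonal_transformation A" and f: "f \<in> borel_measurable borel"
  shows "(\<integral>x. f (A x) \<partial>lborel) = (\<integral>x. f x \<partial>lborel)"
    and "integrable lborel (\<lambda>x. f (A x)) \<longleftrightarrow> integrable lborel f"
proof -
  have Am: "A \<in> lborel \<rightarrow>\<^sub>M borel" using measurable_orthogonal[OF A] by simp
  show "(\<integral>x. f (A x) \<partial>lborel) = (\<integral>x. f x \<partial>lborel)"
    using integral_distr[OF Am f] by (simp add: distr_lborel_orthogonal[OF A])
  show "integrable lborel (\<lambda>x. f (A x)) \<longleftrightarrow> integrable lborel f"
    using integrable_distr_eq[OF Am f] by (simp add: distr_lborel_orthogonal[OF A])
qed

lemma nn_integral_orthogonal:
  fixes A :: "real^3 \<Rightarrow> real^3"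
  assumes A: "orthogonal_transformation A" and f: "f \<in> borel_measurable borel"
  shows "(\<integral>\<^sup>+x. f (A x) \<partial>lborel) = (\<integral>\<^sup>+x. f x \<partial>lborel)"
  using nn_integral_distr[of A lborel borel f] measurable_orthogonal[OF A] f
  by (simp add: distr_lborel_orthogonal[OF A])

lemma smooth3_measurable: "smooth3 f \<Longrightarrow> f \<in> borel_measurable borel"
  by (intro borel_measurable_continuous_onI smooth3_continuous)

section \<open>Angular integration by parts on centred balls\<close>

lemma continuous_rot: "continuous_on S (\<lambda>p. rot j k (fst p) (snd p))"
proof -
  have "continuous_on S (\<lambda>p. if i = j then snd p $ j * cos (fst p) + snd p $ k * sin (fst p)
     else if i = k then snd p $ k * cos (fst p) - snd p $ j * sin (fst p) else snd p $ i)" for i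
    by (cases "i = j"; cases "i = k"; simp; intro continuous_intros)
  then show ?thesis unfolding rot_def by (intro continuous_on_vec_lambda)
qed

text \<open>The derivative along the flow is integrated over angles in [0,1] and over the ball, in
  both orders. Angle first gives the integral of h(rot 1 x) - h(x), which is zero because ball and
  Lebesgue measure are rotation invariant; ball first gives the desired integral for every
  angle.\<close>

lemma integral_vop_cball:
  assumes h: "smooth3 h" and jk: "j \<noteq> k"
  shows "(\<integral>x. indicator (cball 0 R) x *\<^sub>R vop j k h x \<partial>lborel) = 0"
proof -
  define g where "g = vop j k h"
  have g: "smooth3 g" unfolding g_def using h jk by (rule smooth3_vop)
  let ?B = "cball (0::real^3) R"
  have hB: "integrable lborel (\<lambda>x. indicator ?B x *\<^sub>R h (A x))" if "linear A" for A
    using smooth3_linear_compose[OF that h] by (intro borel_integrable_compact smooth3_continuous) auto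
  have "integrable lborel (\<lambda>p. indicator ({0..1::real} \<times> ?B) p *\<^sub>R g (rot j k (fst p) (snd p)))"
    by (intro borel_integrable_compact compact_Times continuous_on_compose2[OF smooth3_continuous[OF g, of UNIV] continuous_rot]) auto
  then have int: "integrable (lborel \<Otimes>\<^sub>M lborel) (case_prod (\<lambda>r x. indicator {0..1} r *\<^sub>R (indicator ?B x *\<^sub>R g (rot j k r x))))"
    by (simp add: lborel_prod split_beta' indicator_times mult.assoc)
  have "(\<integral>x. (\<integral>r. indicator {0..1} r *\<^sub>R (indicator ?B x *\<^sub>R g (rot j k r x)) \<partial>lborel) \<partial>lborel)
     = (\<integral>r. (\<integral>x. indicator {0..1} r *\<^sub>R (indicator ?B x *\<^sub>R g (rot j k r x)) \<partial>lborel) \<partial>lborel)"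
    by (rule lborel_pair.Fubini_integral[OF int])
  moreover have "(\<integral>r. indicator {0..1} r *\<^sub>R (indicator ?B x *\<^sub>R g (rot j k r x)) \<partial>lborel)
      = indicator ?B x *\<^sub>R h (rot j k 1 x) - indicator ?B x *\<^sub>R h x" for x
  proof -
    have "(\<integral>r. indicator {0..1} r *\<^sub>R g (rot j k r x) \<partial>lborel) = h (rot j k 1 x) - h (rot j k 0 x)"
    proof (rule integral_FTC_atLeastAtMost)
      show "((\<lambda>r. h (rot j k r x)) has_vector_derivative g (rot j k r x)) (at r within {0..1})" for r
        unfolding g_def by (rule has_vector_derivative_at_within[OF has_vector_derivative_rot[OF h jk]])
      have "continuous_on UNIV (\<lambda>r. g (rot j k r x))"
        by (intro continuous_at_imp_continuous_on ballI has_vector_derivative_continuous[OF has_vector_derivative_rot[OF g jk]])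
      then show "continuous_on {0..1} (\<lambda>r. g (rot j k r x))" by (rule continuous_on_subset) simp
    qed simp
    moreover have "(\<lambda>r. indicator {0..1} r *\<^sub>R (indicator ?B x *\<^sub>R g (rot j k r x)))
        = (\<lambda>r. (indicator ?B x :: real) *\<^sub>R (indicator {0..1} r *\<^sub>R g (rot j k r x)))"
      by (auto simp: fun_eq_iff indicator_def)
    ultimately show ?thesis by (simp del: scaleR_scaleR add: scaleR_diff_right)
  qed
  moreover have "(\<integral>x. indicator ?B x *\<^sub>R h (rot j k 1 x) - indicator ?B x *\<^sub>R h x \<partial>lborel) = 0"
  proof -
    have "(\<integral>x. indicator ?B x *\<^sub>R h (rot j k 1 x) \<partial>lborel) = (\<integral>x. indicator ?B (rot j k 1 x) *\<^sub>R h (rot j k 1 x) \<partial>lborel)"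
      using jk by (intro Bochner_Integration.integral_cong) (auto simp: indicator_def)
    also have "\<dots> = (\<integral>x. indicator ?B x *\<^sub>R h x \<partial>lborel)"
      using smooth3_measurable[OF h]
      by (intro integral_orthogonal(1)[OF orthogonal_rot[OF jk]] borel_measurable_scaleR borel_measurable_indicator) auto
    finally show ?thesis using hB[OF linear_rot[of j k 1]] hB[of "\<lambda>x. x"] by (simp add: linear_id[unfolded id_def])
  qed
  moreover have "(\<integral>x. indicator {0..1} r *\<^sub>R (indicator ?B x *\<^sub>R g (rot j k r x)) \<partial>lborel)
     = indicator {0..1} r *\<^sub>R (\<integral>x. indicator ?B x *\<^sub>R g x \<partial>lborel)" for r :: real
  proof -
    have "(\<integral>x. indicator ?B x *\<^sub>R g (rot j k r x) \<partial>lborel) = (\<integral>x. indicator ?B (rot j k r x) *\<^sub>R g (rot j k r x) \<partial>lborel)"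
      using jk by (intro Bochner_Integration.integral_cong) (auto simp: indicator_def)
    also have "\<dots> = (\<integral>x. indicator ?B x *\<^sub>R g x \<partial>lborel)"
      using smooth3_measurable[OF g]
      by (intro integral_orthogonal(1)[OF orthogonal_rot[OF jk]] borel_measurable_scaleR borel_measurable_indicator) auto
    finally show ?thesis by (simp del: scaleR_scaleR)
  qed
  ultimately have "0 = (\<integral>r. indicator {0..1::real} r *\<^sub>R (\<integral>x. indicator ?B x *\<^sub>R g x \<partial>lborel) \<partial>lborel)"
    by (simp only:)
  then show ?thesis by (simp add: g_def)
qed

lemma has_derivative_cnj_wf:
  assumes f: "smooth3 f"
  shows "((\<lambda>x. cnj (f x)) has_derivative (\<lambda>h. cnj (\<Sum>j\<in>UNIV. h$j *\<^sub>R dpart j f x))) (at x)"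
  by (rule bounded_linear.has_derivative[OF bounded_linear_cnj smooth3_has_derivative[OF f]])

lemma dpart_cnj:
  assumes f: "smooth3 f"
  shows "dpart j (\<lambda>x. cnj (f x)) x = cnj (dpart j f x)"
  by (simp only: dpart_eqI[OF has_derivative_cnj_wf[OF f]] sum_axis_scaleR)

lemma smooth3_cnj:
  assumes "smooth3 f" shows "smooth3 (\<lambda>x. cnj (f x))"
proof (rule smooth3_coinduct[where C = "{(\<lambda>x. cnj (f x)) |f. smooth3 f}"])
  fix h j assume "h \<in> {(\<lambda>x. cnj (f x)) |f. smooth3 f}"
  then obtain f where h: "h = (\<lambda>x. cnj (f x))" "smooth3 f" by auto
  have "dpart j h = (\<lambda>x. cnj (dpart j f x))" unfolding h(1) using dpart_cnj[OF h(2)] by (intro ext)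
  then show "dpart j h \<in> {(\<lambda>x. cnj (f x)) |f. smooth3 f}" using smooth3_dpart[OF h(2)] by blast
  show "h differentiable (at x)" for x
    unfolding h(1) differentiable_def
    by (rule exI, rule has_derivative_cnj_wf[OF h(2)])
qed (use assms in auto)

text \<open>The vanishing integral is applied to conj(w) v with v = \<open>vop j k w\<close>. The
  Leibniz rule splits it into |v|^2 and conj(w) times the generator applied to v, so the generator
  is skew on each ball without boundary term.\<close>

lemma integral_vop_vop_cball:
  assumes w: "smooth3 w" and jk: "j \<noteq> k"
  shows "(\<integral>x. indicator (cball 0 R) x *\<^sub>R (cnj (w x) * vop j k (vop j k w) x) \<partial>lborel)
      = - complex_of_real (\<integral>x. indicator (cball 0 R) x *\<^sub>R (cmod (vop j k w x))\<^sup>2 \<partial>lborel)"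
proof -
  define v where "v = vop j k w"
  have v: "smooth3 v" unfolding v_def using w jk by (rule smooth3_vop)
  have vv: "smooth3 (vop j k v)" using v jk by (rule smooth3_vop)
  have h: "smooth3 (\<lambda>x. cnj (w x) * v x)" using w v by (intro smooth3_mult smooth3_cnj)
  have eq: "vop j k (\<lambda>x. cnj (w x) * v x) x = complex_of_real ((cmod (v x))\<^sup>2) + cnj (w x) * vop j k v x" for x
  proof -
    have c: "cnj (v x) = complex_of_real (x $ k) * cnj (dpart j w x) - complex_of_real (x $ j) * cnj (dpart k w x)"
      unfolding v_def by (simp add: vop_eq[OF w jk])
    have sq: "complex_of_real ((cmod (v x))\<^sup>2) = cnj (v x) * v x" by (simp only: complex_norm_square mult.commute)
    have "vop j k (\<lambda>x. cnj (w x) * v x) x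
      = complex_of_real (x$k) * (cnj (w x) * dpart j v x + cnj (dpart j w x) * v x)
        - complex_of_real (x$j) * (cnj (w x) * dpart k v x + cnj (dpart k w x) * v x)"
      by (simp only: vop_eq[OF h jk] dpart_cnj[OF w]
          dpart_mult[OF smooth3_differentiable[OF smooth3_cnj[OF w]] smooth3_differentiable[OF v]])
    then show ?thesis unfolding sq c vop_eq[OF v jk] by (simp add: algebra_simps)
  qed
  let ?B = "cball (0::real^3) R"
  have i1: "integrable lborel (\<lambda>x. indicator ?B x *\<^sub>R complex_of_real ((cmod (v x))\<^sup>2))"
    using smooth3_continuous[OF v] by (intro borel_integrable_compact continuous_intros) auto
  have i2: "integrable lborel (\<lambda>x. indicator ?B x *\<^sub>R (cnj (w x) * vop j k v x))"
    using smooth3_continuous[OF vv] smooth3_continuous[OF w] by (intro borel_integrable_compact continuous_intros) auto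
  have "0 = (\<integral>x. indicator ?B x *\<^sub>R complex_of_real ((cmod (v x))\<^sup>2) + indicator ?B x *\<^sub>R (cnj (w x) * vop j k v x) \<partial>lborel)"
    using integral_vop_cball[OF h jk, of R] by (simp only: eq scaleR_add_right)
  also have "\<dots> = (\<integral>x. indicator ?B x *\<^sub>R complex_of_real ((cmod (v x))\<^sup>2) \<partial>lborel) + (\<integral>x. indicator ?B x *\<^sub>R (cnj (w x) * vop j k v x) \<partial>lborel)"
    using i1 i2 by (rule Bochner_Integration.integral_add)
  also have "(\<integral>x. indicator ?B x *\<^sub>R complex_of_real ((cmod (v x))\<^sup>2) \<partial>lborel)
      = complex_of_real (\<integral>x. indicator ?B x *\<^sub>R (cmod (v x))\<^sup>2 \<partial>lborel)"
    unfolding integral_complex_of_real[symmetric] by (intro Bochner_Integration.integral_cong) (auto simp: scaleR_conv_of_real)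
  finally show ?thesis unfolding v_def by (simp add: add_eq_0_iff)
qed

section \<open>From vanishing angular derivatives to radial functions\<close>

lemma rot_invariant_if_vop_zero:
  assumes w: "smooth3 w" and jk: "j \<noteq> k" and z: "\<And>x. vop j k w x = 0"
  shows "w (rot j k s x) = w x"
proof -
  have "\<exists>c. \<forall>r\<in>UNIV. w (rot j k r x) = c"
    by (rule has_derivative_zero_constant)
       (use has_vector_derivative_rot[OF w jk] z in \<open>auto simp: has_vector_derivative_def\<close>)
  then show ?thesis by (metis UNIV_I rot_0)
qed

lemma cos_sin_zero_ex: "\<exists>s. a * cos s + b * sin s = (0::real)"
proof (cases "b = 0")
  case True then show ?thesis by (intro exI[of _ "pi/2"]) simp
next
  case False
  let ?s = "arctan (- a / b)"
  have "sin ?s = (- a / b) * cos ?s"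
    using tan_arctan[of "- a / b"] cos_arctan_not_zero[of "- a / b"] by (simp add: tan_def field_simps)
  then show ?thesis using False by (intro exI[of _ ?s]) simp
qed

text \<open>A rotation in the 1-3 plane removes the first coordinate and one in the 2-3 plane the
  second, so every point is carried to the third axis at distance |x| from the origin.\<close>

lemma rot_invariant_imp_radial:
  assumes inv: "\<And>s x. w (rot 1 3 s x) = w x" "\<And>s x. w (rot 2 3 s x) = w x"
    and xy: "norm x = norm y"
  shows "w x = (w y :: 'a)"
proof -
  have "w x = w (norm x *\<^sub>R axis 3 1)" for x
  proof -
    obtain s where s: "x$1 * cos s + x$3 * sin s = 0" using cos_sin_zero_ex by blast
    define u where "u = rot 1 3 s x"
    obtain t where t: "u$2 * cos t + u$3 * sin t = 0" using cos_sin_zero_ex by blast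
    define z where "z = rot 2 3 t u"
    have "u$1 = 0" using s by (simp add: u_def rot_def)
    then have z: "z$1 = 0" "z$2 = 0" using t by (simp_all add: z_def rot_def)
    have nz: "norm z = norm x" by (simp add: z_def u_def)
    have wz: "w x = w z" by (simp add: z_def u_def inv)
    have abs: "\<bar>z$3\<bar> = norm x" using z nz by (simp add: norm_vec_def L2_set_def sum_3)
    show ?thesis
    proof (cases "z$3 \<ge> 0")
      case True
      then have "z = norm x *\<^sub>R axis 3 1" using z abs by (auto simp: vec_eq_iff forall_3 axis_def)
      then show ?thesis using wz by simp
    next
      case False
      \<comment> \<open>A half turn in the 2-3 plane exchanges the two ends of the third
        axis.\<close>
      then have "rot 2 3 pi z = norm x *\<^sub>R axis 3 1" using z abs by (auto simp: vec_eq_iff forall_3 axis_def rot_def)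
      then show ?thesis using wz inv(2)[of pi z] by simp
    qed
  qed
  from this[of x] this[of y] xy show ?thesis by simp
qed

text \<open>Only the integrability of conj(f) Tf is at hand, not square integrability of the angular
  derivatives, so the form is written as a limit over balls. On each ball it equals the integral of
  the energy \<open>e\<close>, which is nonnegative and grows with the radius. A limit that is at
  most 0 forces all these integrals to vanish, and continuity upgrades this to all points.\<close>

lemma S0_radial:
  assumes f: "f \<in> S0" and xy: "norm x = norm y"
  shows "f x = f y"
proof -
  have sm: "smooth3 f" and int: "integrable lborel (\<lambda>x. cnj (f x) * Tinv f x)" and q0: "Re (qform f) \<le> 0"
    using f by (auto simp: S0_def domT_def)
  define w where "w x = f (Rmap x)" for x
  have w: "smooth3 w" unfolding w_def[abs_def]
    by (rule smooth3_linear_compose[OF _ sm]) (rule orthogonal_transformation_linear[OF orthogonal_Rmap(1)])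
  define q where "q y = cnj (w y) * (- (vop 1 3 (vop 1 3 w) y + vop 2 3 (vop 2 3 w) y))" for y
  have sv: "smooth3 (vop k 3 w)" "smooth3 (vop k 3 (vop k 3 w))" if "k \<noteq> 3" for k
    using w that by (auto intro!: smooth3_vop)
  have smq: "smooth3 q" unfolding q_def[abs_def]
    using w by (intro smooth3_mult smooth3_cnj smooth3_uminus smooth3_add sv) auto
  have eq: "cnj (f x) * Tinv f x = q (Rmap_inv x)" for x
    by (simp add: Tinv_eq[OF sm] q_def w_def[abs_def])
  have iq: "integrable lborel q"
    using int integral_orthogonal(2)[OF orthogonal_Rmap(2) smooth3_measurable[OF smq]] by (simp add: eq)
  have qf: "qform f = (\<integral>y. q y \<partial>lborel)"
    unfolding qform_def l2inner_def eq by (rule integral_orthogonal(1)[OF orthogonal_Rmap(2) smooth3_measurable[OF smq]])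
  define e where "e y = (cmod (vop 1 3 w y))\<^sup>2 + (cmod (vop 2 3 w y))\<^sup>2" for y
  have ce: "continuous_on S e" for S
    unfolding e_def using smooth3_continuous[OF sv(1)[of 1]] smooth3_continuous[OF sv(1)[of 2]] by (intro continuous_intros) auto
  let ?B = "\<lambda>n::nat. cball (0::real^3) (real n)"
  have ie: "integrable lborel (\<lambda>y. indicator (?B n) y *\<^sub>R e y)" for n
    by (intro borel_integrable_compact ce) auto
  \<comment> \<open>The minus sign in \<open>q\<close> cancels the one from integration by parts, so
    the cut-off form is real and nonnegative.\<close>
  have ball: "(\<integral>y. indicator (?B n) y *\<^sub>R q y \<partial>lborel) = complex_of_real (\<integral>y. indicator (?B n) y *\<^sub>R e y \<partial>lborel)" for n
  proof -
    have i1: "integrable lborel (\<lambda>y. indicator (?B n) y *\<^sub>R (cnj (w y) * vop k 3 (vop k 3 w) y))" if "k \<noteq> 3" for k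
      using smooth3_continuous[OF sv(2)[OF that]] smooth3_continuous[OF w]
      by (intro borel_integrable_compact continuous_intros) auto
    have i2: "integrable lborel (\<lambda>y. indicator (?B n) y *\<^sub>R (cmod (vop k 3 w y))\<^sup>2)" if "k \<noteq> 3" for k
      using smooth3_continuous[OF sv(1)[OF that]] by (intro borel_integrable_compact continuous_intros) auto
    have "(\<integral>y. indicator (?B n) y *\<^sub>R q y \<partial>lborel)
      = (\<integral>y. - (indicator (?B n) y *\<^sub>R (cnj (w y) * vop 1 3 (vop 1 3 w) y)) - indicator (?B n) y *\<^sub>R (cnj (w y) * vop 2 3 (vop 2 3 w) y) \<partial>lborel)"
      by (intro Bochner_Integration.integral_cong) (auto simp: q_def indicator_def algebra_simps)
    also have "\<dots> = - (\<integral>y. indicator (?B n) y *\<^sub>R (cnj (w y) * vop 1 3 (vop 1 3 w) y) \<partial>lborel)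
        - (\<integral>y. indicator (?B n) y *\<^sub>R (cnj (w y) * vop 2 3 (vop 2 3 w) y) \<partial>lborel)"
      using i1[of 1] i1[of 2] by simp
    also have "\<dots> = complex_of_real ((\<integral>y. indicator (?B n) y *\<^sub>R (cmod (vop 1 3 w y))\<^sup>2 \<partial>lborel) + (\<integral>y. indicator (?B n) y *\<^sub>R (cmod (vop 2 3 w y))\<^sup>2 \<partial>lborel))"
      by (simp add: integral_vop_vop_cball[OF w, simplified])
    also have "(\<integral>y. indicator (?B n) y *\<^sub>R (cmod (vop 1 3 w y))\<^sup>2 \<partial>lborel) + (\<integral>y. indicator (?B n) y *\<^sub>R (cmod (vop 2 3 w y))\<^sup>2 \<partial>lborel)
        = (\<integral>y. indicator (?B n) y *\<^sub>R (cmod (vop 1 3 w y))\<^sup>2 + indicator (?B n) y *\<^sub>R (cmod (vop 2 3 w y))\<^sup>2 \<partial>lborel)"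
      by (rule Bochner_Integration.integral_add[symmetric]) (use i2[of 1] i2[of 2] in auto)
    finally show ?thesis unfolding e_def by (simp only: scaleR_add_right)
  qed
  have lim: "(\<lambda>n. \<integral>y. indicator (?B n) y *\<^sub>R q y \<partial>lborel) \<longlonglongrightarrow> (\<integral>y. q y \<partial>lborel)"
  proof (rule integral_dominated_convergence[where w = "\<lambda>y. norm (q y)"])
    have "(\<lambda>n. indicator (?B n) y *\<^sub>R q y) \<longlonglongrightarrow> q y" for y
    proof (rule tendsto_eventually)
      obtain N :: nat where "norm y \<le> real N" using real_arch_simple by blast
      then have "indicator (?B n) y *\<^sub>R q y = q y" if "n \<ge> N" for n
        using that by (simp add: indicator_def)
      then show "\<forall>\<^sub>F n in sequentially. indicator (?B n) y *\<^sub>R q y = q y"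
        by (rule eventually_sequentiallyI)
    qed
    then show "AE y in lborel. (\<lambda>n. indicator (?B n) y *\<^sub>R q y) \<longlonglongrightarrow> q y" by (rule AE_I2)
    show qm: "q \<in> borel_measurable lborel" by (rule borel_measurable_integrable[OF iq])
    show "(\<lambda>y. indicator (?B n) y *\<^sub>R q y) \<in> borel_measurable lborel" for n
      by (intro borel_measurable_scaleR borel_measurable_indicator qm) simp
    show "AE y in lborel. norm (indicator (?B n) y *\<^sub>R q y) \<le> norm (q y)" for n by (auto simp: indicator_def)
  qed (use iq in simp)
  have lim': "(\<lambda>n. \<integral>y. indicator (?B n) y *\<^sub>R e y \<partial>lborel) \<longlonglongrightarrow> Re (qform f)"
    using tendsto_Re[OF lim] unfolding ball qf[symmetric] by simp
  have e0: "e y \<ge> 0" for y by (simp add: e_def)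
  have zero: "(\<integral>y. indicator (?B n) y *\<^sub>R e y \<partial>lborel) = 0" for n
  proof (rule antisym)
    have "incseq (\<lambda>n. \<integral>y. indicator (?B n) y *\<^sub>R e y \<partial>lborel)"
    proof (rule incseq_SucI)
      show "(\<integral>y. indicator (?B n) y *\<^sub>R e y \<partial>lborel) \<le> (\<integral>y. indicator (?B (Suc n)) y *\<^sub>R e y \<partial>lborel)" for n
        by (rule integral_mono[OF ie ie]) (auto simp: indicator_def e0)
    qed
    from incseq_le[OF this lim', of n] show "(\<integral>y. indicator (?B n) y *\<^sub>R e y \<partial>lborel) \<le> 0" using q0 by simp
    show "0 \<le> (\<integral>y. indicator (?B n) y *\<^sub>R e y \<partial>lborel)"
      by (rule integral_nonneg_AE) (auto simp: e0)
  qed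
  have e_zero: "e y = 0" for y
  proof (rule ccontr)
    assume ne: "e y \<noteq> 0"
    obtain n :: nat where n: "norm y < real n" using reals_Archimedean2 by blast
    \<comment> \<open>A point of positive energy would make \<open>U\<close> a nonempty open null
      set.\<close>
    define U where "U = {y \<in> ball 0 (real n). e y \<noteq> 0}"
    have "open U"
    proof -
      have "open (ball 0 (real n) \<inter> e -` (- {0}))"
        by (rule continuous_open_preimage[OF ce]) auto
      then show ?thesis by (simp add: U_def Int_def vimage_def)
    qed
    have "AE y in lborel. indicator (?B n) y *\<^sub>R e y = 0"
      using zero[of n] integral_nonneg_eq_0_iff_AE[OF ie[of n]] e0 by simp
    then have "AE y in lborel. y \<notin> U" by (rule AE_mp) (auto simp: U_def indicator_def)
    then have "U \<in> null_sets lborel" using \<open>open U\<close> by (simp add: AE_iff_null_sets)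
    then have "negligible U" by (simp add: negligible_iff_null_sets null_sets_completionI)
    then have "U = {}" using open_not_negligible[OF \<open>open U\<close>] by blast
    moreover have "y \<in> U" using n ne by (simp add: U_def)
    ultimately show False by blast
  qed
  then have v0: "vop 1 3 w y = 0" "vop 2 3 w y = 0" for y
    by (auto simp: e_def add_nonneg_eq_0_iff)
  have "w (Rmap_inv x) = w (Rmap_inv y)"
    by (rule rot_invariant_imp_radial)
       (use rot_invariant_if_vop_zero[OF w _ v0(1)] rot_invariant_if_vop_zero[OF w _ v0(2)] xy
          orthogonal_transformation_norm[OF orthogonal_Rmap(2)] in auto)
  then show ?thesis by (simp add: w_def)
qed

text \<open>A radial function is constant along every orbit, so all generators annihilate it and the
  form is 0.\<close>

lemma radial_in_S0:
  assumes g: "smooth3 g" and sq: "sqint g" and rad: "\<And>x y. norm x = norm y \<Longrightarrow> g x = g y"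
  shows "g \<in> S0"
proof -
  have v0: "vop j k g = (\<lambda>x. 0)" if "j \<noteq> k" for j k
  proof
    fix x
    have "(\<lambda>r. g (rot j k r x)) = (\<lambda>r. g x)" using that by (intro ext rad) simp
    then have "((\<lambda>r. g x) has_vector_derivative vop j k g x) (at 0)"
      using has_vector_derivative_rot[OF g that, of x 0] by simp
    then show "vop j k g x = 0"
      by (rule vector_derivative_unique_at[OF _ has_vector_derivative_const])
  qed
  have "(\<lambda>x. g (Rmap x)) = g"
    using orthogonal_transformation_norm[OF orthogonal_Rmap(1)] by (intro ext rad) simp
  moreover have "vop j k (\<lambda>x. 0) = (\<lambda>x. 0)" if "j \<noteq> k" for j k
    using that by (simp add: vop_eq dpart_const)
  ultimately have "Tinv g = (\<lambda>x. 0)" by (auto simp: fun_eq_iff Tinv_eq[OF g] v0)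
  then show ?thesis by (simp add: S0_def domT_def qform_def l2inner_def g sq)
qed

section \<open>The projection onto the radial functions\<close>

lemma sqint_integrable_mult:
  assumes f: "sqint f" and g: "sqint g"
  shows "integrable lborel (\<lambda>x. cnj (f x) * g x)"
proof (rule Bochner_Integration.integrable_bound[where f = "\<lambda>x. (cmod (f x))\<^sup>2 + (cmod (g x))\<^sup>2"])
  show "integrable lborel (\<lambda>x. (cmod (f x))\<^sup>2 + (cmod (g x))\<^sup>2)" using f g by (simp add: sqint_def)
  have fm: "f \<in> borel_measurable lborel" "g \<in> borel_measurable lborel" using f g by (auto simp: sqint_def)
  have "(\<lambda>x. cnj (f x)) \<in> borel_measurable lborel"
    by (rule borel_measurable_continuous_on[OF _ fm(1)]) (intro continuous_intros)
  then show "(\<lambda>x. cnj (f x) * g x) \<in> borel_measurable lborel" using fm(2) by (rule borel_measurable_times)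
  have "cmod (f x) * cmod (g x) \<le> (cmod (f x))\<^sup>2 + (cmod (g x))\<^sup>2" for x
    using sum_squares_bound[of "cmod (f x)" "cmod (g x)"] mult_nonneg_nonneg[of "cmod (f x)" "cmod (g x)"]
    by (simp del: mult_nonneg_nonneg)
  then show "AE x in lborel. norm (cnj (f x) * g x) \<le> norm ((cmod (f x))\<^sup>2 + (cmod (g x))\<^sup>2)"
    by (simp add: norm_mult)
qed

lemma sqint_diff:
  assumes f: "sqint f" and g: "sqint g"
  shows "sqint (f - g)"
  unfolding sqint_def
proof
  have fm: "f \<in> borel_measurable lborel" "g \<in> borel_measurable lborel" using f g by (auto simp: sqint_def)
  then show m: "f - g \<in> borel_measurable lborel" unfolding fun_diff_def by (rule borel_measurable_diff)
  show "integrable lborel (\<lambda>x. (cmod ((f - g) x))\<^sup>2)"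
  proof (rule Bochner_Integration.integrable_bound[where f = "\<lambda>x. 2 * (cmod (f x))\<^sup>2 + 2 * (cmod (g x))\<^sup>2"])
    show "integrable lborel (\<lambda>x. 2 * (cmod (f x))\<^sup>2 + 2 * (cmod (g x))\<^sup>2)" using f g by (simp add: sqint_def)
    show "(\<lambda>x. (cmod ((f - g) x))\<^sup>2) \<in> borel_measurable lborel"
      by (rule borel_measurable_power[OF measurable_compose[OF m borel_measurable_norm]])
    have "(cmod (f x - g x))\<^sup>2 \<le> 2 * (cmod (f x))\<^sup>2 + 2 * (cmod (g x))\<^sup>2" for x
    proof -
      have "(cmod (f x - g x))\<^sup>2 \<le> (cmod (f x) + cmod (g x))\<^sup>2"
        by (intro power_mono norm_triangle_ineq4) simp
      then show ?thesis using sum_squares_bound[of "cmod (f x)" "cmod (g x)"] by (simp add: power2_sum)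
    qed
    then show "AE x in lborel. norm ((cmod ((f - g) x))\<^sup>2) \<le> norm (2 * (cmod (f x))\<^sup>2 + 2 * (cmod (g x))\<^sup>2)"
      by simp
  qed
qed

lemma l2inner_diff_right:
  assumes "sqint f" "sqint g" "sqint h"
  shows "l2inner f (g - h) = l2inner f g - l2inner f h"
  using sqint_integrable_mult[OF assms(1,2)] sqint_integrable_mult[OF assms(1,3)]
  by (simp add: l2inner_def right_diff_distrib)

lemma l2inner_commute: "l2inner f g = cnj (l2inner g f)"
  unfolding l2inner_def
  by (subst integral_bounded_linear'[OF bounded_linear_cnj bounded_linear_cnj, symmetric]) (simp_all add: mult.commute)

text \<open>Cauchy-Schwarz in the additive form 2ab <= e a^2 + b^2/e. The free weight e allows a
  fixed first factor to be paired with a second factor of norm below e, with a result of order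
  e.\<close>

lemma cmod_l2inner_le:
  assumes f: "sqint f" and g: "sqint g" and e: "e > 0"
  shows "cmod (l2inner f g) \<le> e * (\<integral>x. (cmod (f x))\<^sup>2 \<partial>lborel) + (\<integral>x. (cmod (g x))\<^sup>2 \<partial>lborel) / e"
proof -
  have i: "integrable lborel (\<lambda>x. (cmod (f x))\<^sup>2)" "integrable lborel (\<lambda>x. (cmod (g x))\<^sup>2)"
    using f g by (auto simp: sqint_def)
  have "cmod (l2inner f g) \<le> (\<integral>x. cmod (cnj (f x) * g x) \<partial>lborel)"
    unfolding l2inner_def by (rule integral_norm_bound)
  also have "\<dots> \<le> (\<integral>x. e * (cmod (f x))\<^sup>2 + (cmod (g x))\<^sup>2 / e \<partial>lborel)"
  proof (rule integral_mono)
    show "integrable lborel (\<lambda>x. cmod (cnj (f x) * g x))"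
      by (rule integrable_norm[OF sqint_integrable_mult[OF f g]])
    show "integrable lborel (\<lambda>x. e * (cmod (f x))\<^sup>2 + (cmod (g x))\<^sup>2 / e)" using i by simp
    fix x
    have "2 * (sqrt e * cmod (f x)) * (cmod (g x) / sqrt e) \<le> (sqrt e * cmod (f x))\<^sup>2 + (cmod (g x) / sqrt e)\<^sup>2"
      by (rule sum_squares_bound)
    then have "2 * (cmod (f x) * cmod (g x)) \<le> e * (cmod (f x))\<^sup>2 + (cmod (g x))\<^sup>2 / e"
      using e by (simp add: power_mult_distrib power_divide)
    moreover have "0 \<le> cmod (f x) * cmod (g x)" by simp
    ultimately show "cmod (cnj (f x) * g x) \<le> e * (cmod (f x))\<^sup>2 + (cmod (g x))\<^sup>2 / e"
      unfolding norm_mult complex_mod_cnj by linarith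
  qed
  finally show ?thesis using i by simp
qed

text \<open>The chosen projection g' is fixed at most up to null sets, so it is never identified
  with g. The residual psi - g is orthogonal to \<open>S0\<close>, hence to g', which elements of
  \<open>S0\<close> approximate; together with the orthogonality of psi - g' to g this turns <psi,
  g'> into <g, g>.\<close>

lemma beta_inv_eq:
  assumes psi: "sqint (psi \<theta>)" and g: "g \<in> S0" and orth: "\<And>h. h \<in> S0 \<Longrightarrow> l2inner h (psi \<theta> - g) = 0"
  shows "beta_inv \<alpha> \<theta> = (1 - \<alpha>) * (\<integral>x. (cmod (g x))\<^sup>2 \<partial>lborel)"
proof -
  have sq: "sqint h" if "h \<in> S0" for h using that by (simp add: S0_def domT_def)
  have "\<exists>h\<in>S0. L2norm (g - h) < \<epsilon>" if "\<epsilon> > 0" for \<epsilon>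
    using g that by (intro bexI[of _ g]) (simp add: L2norm_def)
  then have "is_proj S0 (psi \<theta>) g" using sq[OF g] orth unfolding is_proj_def by blast
  define g' where "g' = (SOME g. is_proj S0 (psi \<theta>) g)"
  have pr: "is_proj S0 (psi \<theta>) g'"
    unfolding g'_def by (rule someI[where P = "is_proj S0 (psi \<theta>)"]) fact
  have g': "sqint g'" and appr: "\<And>\<epsilon>. \<epsilon> > 0 \<Longrightarrow> \<exists>h\<in>S0. L2norm (g' - h) < \<epsilon>"
    and orth': "\<And>h. h \<in> S0 \<Longrightarrow> l2inner h (psi \<theta> - g') = 0"
    using pr unfolding is_proj_def by blast+
  define d where "d = psi \<theta> - g"
  have sd: "sqint d" unfolding d_def using psi sq[OF g] by (rule sqint_diff)
  define A where "A = (\<integral>x. (cmod (d x))\<^sup>2 \<partial>lborel)"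
  have "cmod (l2inner d g') \<le> 0"
  proof (rule field_le_epsilon)
    fix \<epsilon>' :: real assume e': "\<epsilon>' > 0"
    have A: "A \<ge> 0" unfolding A_def by (rule integral_nonneg_AE) simp
    \<comment> \<open>Dividing by A + 1 makes the total error \<epsilon> A + \<epsilon> equal to the
      given bound, also when A = 0.\<close>
    define \<epsilon> where "\<epsilon> = \<epsilon>' / (A + 1)"
    have e: "\<epsilon> > 0" using e' A by (simp add: \<epsilon>_def)
    obtain h where h: "h \<in> S0" "L2norm (g' - h) < \<epsilon>" using appr[OF e] by blast
    let ?B = "\<integral>x. (cmod ((g' - h) x))\<^sup>2 \<partial>lborel"
    have B0: "?B \<ge> 0" by (rule integral_nonneg_AE) simp
    have "?B \<le> \<epsilon>\<^sup>2"
    proof -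
      have "sqrt ?B < \<epsilon>" using h(2) by (simp add: L2norm_def)
      then have "(sqrt ?B)\<^sup>2 \<le> \<epsilon>\<^sup>2" using B0 by (intro power_mono) auto
      then show ?thesis using B0 by simp
    qed
    then have B: "?B / \<epsilon> \<le> \<epsilon>" using e by (simp add: divide_le_eq power2_eq_square)
    have "l2inner d h = 0" using orth[OF h(1)] l2inner_commute[of d h] by (simp add: d_def)
    then have "l2inner d g' = l2inner d (g' - h)" using l2inner_diff_right[OF sd g' sq[OF h(1)]] by simp
    then have "cmod (l2inner d g') \<le> \<epsilon> * A + ?B / \<epsilon>"
      using cmod_l2inner_le[OF sd sqint_diff[OF g' sq[OF h(1)]] e] by (simp only: A_def)
    also have "\<dots> \<le> \<epsilon> * A + \<epsilon>" using B by simp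
    also have "\<dots> = \<epsilon> * (A + 1)" by (simp add: distrib_left)
    also have "\<dots> = \<epsilon>'" using A by (simp add: \<epsilon>_def)
    finally show "cmod (l2inner d g') \<le> 0 + \<epsilon>'" by simp
  qed
  then have "l2inner d g' = 0" by simp
  then have "l2inner g' (psi \<theta> - g) = 0" using l2inner_commute[of g' d] by (simp add: d_def)
  then have "l2inner g' (psi \<theta>) = l2inner g' g" using l2inner_diff_right[OF g' psi sq[OF g]] by simp
  then have "l2inner (psi \<theta>) g' = l2inner g g'"
    using l2inner_commute[of "psi \<theta>" g'] l2inner_commute[of g g'] by simp
  also have "\<dots> = l2inner g (psi \<theta>)" using orth'[OF g] l2inner_diff_right[OF sq[OF g] psi g'] by simp
  also have "\<dots> = l2inner g g" using orth[OF g] l2inner_diff_right[OF sq[OF g] psi sq[OF g]] by simp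
  also have "\<dots> = complex_of_real (\<integral>x. (cmod (g x))\<^sup>2 \<partial>lborel)"
    unfolding l2inner_def integral_complex_of_real[symmetric]
    by (intro Bochner_Integration.integral_cong refl) (simp only: complex_norm_square mult.commute)
  finally show ?thesis by (simp add: beta_inv_def g'_def[symmetric])
qed

section \<open>Cylindrical and spherical coordinates\<close>

text \<open>Half lines are stable under intersection, generate the Borel sets and exhaust the line
  by sets of finite measure. A distribution function thus determines the measure even when the total
  mass is infinite, as for the images of Lebesgue measure below.\<close>

lemma sigma_finite_eqI_atMost:
  fixes M N :: "real measure"
  assumes "sets M = sets borel" "sets N = sets borel"
    and eq: "\<And>t. emeasure M {..t} = emeasure N {..t}" and fin: "\<And>t. emeasure M {..t} \<noteq> \<infinity>"
  shows "M = N"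
proof (rule measure_eqI_generator_eq[where E = "range (\<lambda>a::real. {..a})" and \<Omega> = UNIV and A = "\<lambda>n. {..real n}"])
  show "Int_stable (range (\<lambda>a::real. {..a}))"
    by (auto simp: Int_stable_def)
  show "sets M = sigma_sets UNIV (range (\<lambda>a::real. {..a}))" "sets N = sigma_sets UNIV (range (\<lambda>a::real. {..a}))"
  proof -
    have "sets (borel :: real measure) = sigma_sets UNIV (range (\<lambda>a::real. {..a}))"
      by (subst borel_eq_atMost) (simp add: sets_measure_of)
    then show "sets M = sigma_sets UNIV (range (\<lambda>a::real. {..a}))" "sets N = sigma_sets UNIV (range (\<lambda>a::real. {..a}))"
      using assms(1,2) by simp_all
  qed
  show "(\<Union>i. {..real i}) = UNIV" using real_arch_simple by auto
qed (use eq fin in auto)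

text \<open>A disc of squared radius t has area pi t, which is linear in t, so the squared radius
  has constant density.\<close>

lemma distr_square_norm_plane:
  "distr lborel borel (\<lambda>p::real \<times> real. (fst p)\<^sup>2 + (snd p)\<^sup>2) = density lborel (\<lambda>t. ennreal pi * indicator {0..} t)"
proof (rule sigma_finite_eqI_atMost)
  have m: "(\<lambda>p::real \<times> real. (fst p)\<^sup>2 + (snd p)\<^sup>2) \<in> lborel \<rightarrow>\<^sub>M borel"
    by (simp, intro borel_measurable_continuous_onI continuous_intros)
  have l: "emeasure (distr lborel borel (\<lambda>p::real \<times> real. (fst p)\<^sup>2 + (snd p)\<^sup>2)) {..t} = ennreal pi * ennreal (max 0 t)" for t
  proof (cases "t \<ge> 0")
    case True
    have "(\<lambda>p::real \<times> real. (fst p)\<^sup>2 + (snd p)\<^sup>2) -` {..t} \<inter> space lborel = cball 0 (sqrt t)"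
      using True by (auto simp: norm_prod_def real_sqrt_le_iff split: prod.splits)
    then show ?thesis using m True
      by (simp add: emeasure_distr emeasure_cball ennreal_mult[symmetric] eval_unit_ball_vol flip: numeral_2_eq_2)
  next
    case False
    have "\<not> (fst p)\<^sup>2 + (snd p)\<^sup>2 \<le> t" for p :: "real \<times> real"
      using False zero_le_power2[of "fst p"] zero_le_power2[of "snd p"] by linarith
    then have "(\<lambda>p::real \<times> real. (fst p)\<^sup>2 + (snd p)\<^sup>2) -` {..t} \<inter> space lborel = {}" by auto
    then show ?thesis using m False by (simp add: emeasure_distr)
  qed
  have r: "emeasure (density lborel (\<lambda>t. ennreal pi * indicator {0..} t)) {..t} = ennreal pi * ennreal (max 0 t)" for t
  proof -
    have "emeasure (density lborel (\<lambda>t. ennreal pi * indicator {0..} t)) {..t}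
        = (\<integral>\<^sup>+x. ennreal pi * indicator {0..t} x \<partial>lborel)"
      by (subst emeasure_density) (auto intro!: nn_integral_cong simp: indicator_def)
    also have "\<dots> = ennreal pi * emeasure lborel {0..t}" by (simp add: nn_integral_cmult)
    also have "emeasure lborel {0..t} = ennreal (max 0 t)" by (cases "t \<ge> 0") auto
    finally show ?thesis .
  qed
  show "emeasure (distr lborel borel (\<lambda>p::real \<times> real. (fst p)\<^sup>2 + (snd p)\<^sup>2)) {..t}
     = emeasure (density lborel (\<lambda>t. ennreal pi * indicator {0..} t)) {..t}" for t by (simp only: l r)
  show "emeasure (distr lborel borel (\<lambda>p::real \<times> real. (fst p)\<^sup>2 + (snd p)\<^sup>2)) {..t} \<noteq> \<infinity>" for t
    by (simp only: l) (simp add: ennreal_mult_eq_top_iff)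
qed simp_all

lemma distr_norm_space:
  "distr lborel borel (norm :: real^3 \<Rightarrow> real) = density lborel (\<lambda>r. ennreal (4 * pi * r\<^sup>2) * indicator {0..} r)"
proof (rule sigma_finite_eqI_atMost)
  have l: "emeasure (distr lborel borel (norm :: real^3 \<Rightarrow> real)) {..t} = ennreal (4/3 * pi * (max 0 t)^3)" for t
  proof (cases "t \<ge> 0")
    case True
    have "(norm :: real^3 \<Rightarrow> real) -` {..t} \<inter> space lborel = cball 0 t" by auto
    then show ?thesis using True by (simp add: emeasure_distr emeasure_cball eval_unit_ball_vol)
  next
    case False
    have "\<not> norm x \<le> t" for x :: "real^3" using False norm_ge_zero[of x] by linarith
    then have "(norm :: real^3 \<Rightarrow> real) -` {..t} \<inter> space lborel = {}" by auto
    then show ?thesis using False by (simp add: emeasure_distr)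
  qed
  have r: "emeasure (density lborel (\<lambda>r. ennreal (4 * pi * r\<^sup>2) * indicator {0..} r)) {..t} = ennreal (4/3 * pi * (max 0 t)^3)" for t
  proof -
    have "emeasure (density lborel (\<lambda>r. ennreal (4 * pi * r\<^sup>2) * indicator {0..} r)) {..t}
        = (\<integral>\<^sup>+x. ennreal (4 * pi * x\<^sup>2) * indicator {0..t} x \<partial>lborel)"
      by (subst emeasure_density) (auto intro!: nn_integral_cong simp: indicator_def)
    also have "\<dots> = ennreal (4/3 * pi * (max 0 t)^3)"
    proof (cases "t \<ge> 0")
      case True
      have "(\<integral>\<^sup>+x. ennreal (4 * pi * x\<^sup>2) * indicator {0..t} x \<partial>lborel) = ennreal (4/3 * pi * t^3 - 4/3 * pi * 0^3)"
        by (rule nn_integral_FTC_Icc)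
           (use True in \<open>auto intro!: derivative_eq_intros simp flip: has_real_derivative_iff_has_vector_derivative\<close>)
      then show ?thesis using True by simp
    qed simp
    finally show ?thesis .
  qed
  show "emeasure (distr lborel borel (norm :: real^3 \<Rightarrow> real)) {..t}
     = emeasure (density lborel (\<lambda>r. ennreal (4 * pi * r\<^sup>2) * indicator {0..} r)) {..t}" for t by (simp only: l r)
  show "emeasure (distr lborel borel (norm :: real^3 \<Rightarrow> real)) {..t} \<noteq> \<infinity>" for t by (simp only: l) simp
qed simp_all

lemma nn_integral_norm_space:
  assumes "F \<in> borel_measurable borel"
  shows "(\<integral>\<^sup>+x. F (norm (x::real^3)) \<partial>lborel) = (\<integral>\<^sup>+r. ennreal (4 * pi * r\<^sup>2) * indicator {0..} r * F r \<partial>lborel)"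
proof -
  have "(\<integral>\<^sup>+x. F (norm (x::real^3)) \<partial>lborel) = (\<integral>\<^sup>+r. F r \<partial>distr lborel borel (norm :: real^3 \<Rightarrow> real))"
    using assms by (subst nn_integral_distr) auto
  also have "\<dots> = (\<integral>\<^sup>+r. ennreal (4 * pi * r\<^sup>2) * indicator {0..} r * F r \<partial>lborel)"
    unfolding distr_norm_space using assms by (subst nn_integral_density) auto
  finally show ?thesis .
qed

definition vec3 :: "real \<times> real \<times> real \<Rightarrow> real^3" where
  "vec3 p = vector [fst p, fst (snd p), snd (snd p)]"

lemma vec3_nth [simp]: "vec3 p $ 1 = fst p" "vec3 p $ 2 = fst (snd p)" "vec3 p $ 3 = snd (snd p)"
  by (simp_all add: vec3_def vector_3)

lemma measurable_vec3: "vec3 \<in> borel \<rightarrow>\<^sub>M borel"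
proof (intro borel_measurable_continuous_onI)
  have "continuous_on UNIV (\<lambda>p. vec3 p $ i)" for i
    using exhaust_3[of i] by (elim disjE; simp; intro continuous_intros)
  then have "continuous_on UNIV (\<lambda>p. \<chi> i. vec3 p $ i)" by (intro continuous_on_vec_lambda)
  then show "continuous_on UNIV vec3" by simp
qed

lemma emeasure_lborel_Times:
  fixes X :: "'a::euclidean_space set" and Y :: "'b::euclidean_space set"
  assumes "X \<in> sets borel" "Y \<in> sets borel"
  shows "emeasure lborel (X \<times> Y) = emeasure lborel X * emeasure lborel Y"
  unfolding lborel_prod[symmetric] using assms by (intro lborel.emeasure_pair_measure_Times) auto

text \<open>Gives access to Fubini's theorem on \<open>real^3\<close>, one coordinate at a
  time.\<close>

lemma distr_vec3: "distr lborel borel vec3 = lborel"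
proof (rule lborel_eqI[symmetric])
  fix l u :: "real^3" assume lu: "\<And>b. b \<in> Basis \<Longrightarrow> l \<bullet> b \<le> u \<bullet> b"
  have le: "l$i \<le> u$i" for i using lu[of "axis i 1"] by (simp add: inner_axis)
  have "vec3 -` box l u = {l$1<..<u$1} \<times> {l$2<..<u$2} \<times> {l$3<..<u$3}"
    by (auto simp: mem_box_cart forall_3)
  then have "emeasure (distr lborel borel vec3) (box l u) = emeasure lborel ({l$1<..<u$1} \<times> {l$2<..<u$2} \<times> {l$3<..<u$3})"
    using measurable_vec3 by (simp add: emeasure_distr)
  also have "\<dots> = ennreal (u$1 - l$1) * (ennreal (u$2 - l$2) * ennreal (u$3 - l$3))"
    using le by (simp add: emeasure_lborel_Times borel_open open_Times)
  also have "\<dots> = ennreal ((u$1 - l$1) * (u$2 - l$2) * (u$3 - l$3))"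
    using le by (simp add: ennreal_mult mult.assoc)
  also have "(u$1 - l$1) * (u$2 - l$2) * (u$3 - l$3) = (\<Prod>b\<in>Basis. (u - l) \<bullet> b)"
  proof -
    have "(\<Prod>b\<in>Basis. (u - l) \<bullet> b) = (\<Prod>i\<in>UNIV. (u - l) \<bullet> axis i 1)"
    proof -
      have B: "(Basis :: (real^3) set) = range (\<lambda>i. axis i 1)" by (auto simp: Basis_vec_def)
      have "inj (\<lambda>i::3. axis i (1::real))" by (auto simp: inj_on_def axis_eq_axis)
      then show ?thesis unfolding B by (simp add: prod.reindex)
    qed
    moreover have "(\<Prod>i\<in>(UNIV::3 set). h i) = h 1 * h 2 * h 3" for h :: "3 \<Rightarrow> real"
      unfolding UNIV_3 by (simp add: mult.assoc)
    ultimately show ?thesis by (simp only: inner_axis vector_minus_component) simp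
  qed
  finally show "emeasure (distr lborel borel vec3) (box l u) = (\<Prod>b\<in>Basis. (u - l) \<bullet> b)" .
qed simp

text \<open>For a fixed first coordinate u the squared norm is u^2 plus the squared radius in a
  plane, which has constant density pi. This is Archimedes' hat-box theorem: for each squared norm t
  the axis coordinate is uniform on [-sqrt t, sqrt t].\<close>

lemma nn_integral_cylinder:
  assumes F: "F \<in> borel_measurable borel"
  shows "(\<integral>\<^sup>+x. F (x$1, x \<bullet> x) \<partial>(lborel :: (real^3) measure))
    = (\<integral>\<^sup>+p. ennreal pi * indicator {p. (fst p)\<^sup>2 \<le> snd p} p * F p \<partial>lborel)"
proof -
  have cont: "continuous_on UNIV (\<lambda>x::real^3. (x$1, x \<bullet> x))" by (intro continuous_intros)
  have m1: "(\<lambda>x::real^3. F (x$1, x \<bullet> x)) \<in> borel_measurable borel"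
    by (rule measurable_compose[OF borel_measurable_continuous_onI[OF cont] F])
  have m2: "(\<lambda>p. F (fst p, (fst p)\<^sup>2 + (fst (snd p))\<^sup>2 + (snd (snd p))\<^sup>2)) \<in> borel_measurable (borel :: (real \<times> real \<times> real) measure)"
    by (rule measurable_compose[OF borel_measurable_continuous_onI F]) (intro continuous_intros)
  have m3: "(\<lambda>t. F (u, u\<^sup>2 + t)) \<in> borel_measurable borel" for u
    by (rule measurable_compose[OF borel_measurable_continuous_onI F]) (intro continuous_intros)
  have m4: "(\<lambda>t. F (u, t)) \<in> borel_measurable borel" for u
    by (rule measurable_compose[OF borel_measurable_continuous_onI F]) (intro continuous_intros)
  have S: "{p::real \<times> real. (fst p)\<^sup>2 \<le> snd p} \<in> sets borel"
    by (intro borel_closed closed_Collect_le continuous_intros)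
  have "(\<integral>\<^sup>+x. F (x$1, x \<bullet> x) \<partial>(lborel :: (real^3) measure)) = (\<integral>\<^sup>+p. F (vec3 p $ 1, vec3 p \<bullet> vec3 p) \<partial>lborel)"
    by (subst distr_vec3[symmetric], subst nn_integral_distr) (use measurable_vec3 m1 in auto)
  also have "\<dots> = (\<integral>\<^sup>+p. F (fst p, (fst p)\<^sup>2 + (fst (snd p))\<^sup>2 + (snd (snd p))\<^sup>2) \<partial>(lborel :: (real \<times> real \<times> real) measure))"
    by (simp add: inner_vec_def sum_3 power2_eq_square)
  also have "\<dots> = (\<integral>\<^sup>+u. (\<integral>\<^sup>+q. F (u, u\<^sup>2 + ((fst q)\<^sup>2 + (snd q)\<^sup>2)) \<partial>lborel) \<partial>lborel)"
    using lborel.nn_integral_fst[of "\<lambda>p. F (fst p, (fst p)\<^sup>2 + (fst (snd p))\<^sup>2 + (snd (snd p))\<^sup>2)" lborel] m2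
    by (simp add: lborel_prod add.assoc)
  also have "\<dots> = (\<integral>\<^sup>+u. (\<integral>\<^sup>+t. ennreal pi * indicator {0..} t * F (u, u\<^sup>2 + t) \<partial>lborel) \<partial>lborel)"
  proof (rule nn_integral_cong)
    fix u :: real
    have m: "(\<lambda>p::real \<times> real. (fst p)\<^sup>2 + (snd p)\<^sup>2) \<in> lborel \<rightarrow>\<^sub>M borel"
      by (simp, intro borel_measurable_continuous_onI continuous_intros)
    have "(\<integral>\<^sup>+q. F (u, u\<^sup>2 + ((fst q)\<^sup>2 + (snd q)\<^sup>2)) \<partial>lborel)
      = (\<integral>\<^sup>+t. F (u, u\<^sup>2 + t) \<partial>distr lborel borel (\<lambda>p::real \<times> real. (fst p)\<^sup>2 + (snd p)\<^sup>2))"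
      by (subst nn_integral_distr[OF m]) (use m3 in auto)
    also have "\<dots> = (\<integral>\<^sup>+t. ennreal pi * indicator {0..} t * F (u, u\<^sup>2 + t) \<partial>lborel)"
      unfolding distr_square_norm_plane using m3 by (subst nn_integral_density) auto
    finally show "(\<integral>\<^sup>+q. F (u, u\<^sup>2 + ((fst q)\<^sup>2 + (snd q)\<^sup>2)) \<partial>lborel) = (\<integral>\<^sup>+t. ennreal pi * indicator {0..} t * F (u, u\<^sup>2 + t) \<partial>lborel)" .
  qed
  also have "\<dots> = (\<integral>\<^sup>+u. (\<integral>\<^sup>+t. ennreal pi * indicator {p. (fst p)\<^sup>2 \<le> snd p} (u, t) * F (u, t) \<partial>lborel) \<partial>lborel)"
  proof (rule nn_integral_cong)
    fix u :: real
    have "(\<integral>\<^sup>+t. ennreal pi * indicator {u\<^sup>2..} t * F (u, t) \<partial>lborel)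
       = (\<integral>\<^sup>+t. ennreal pi * indicator {u\<^sup>2..} (u\<^sup>2 + 1 * t) * F (u, u\<^sup>2 + 1 * t) \<partial>lborel)"
      using nn_integral_real_affine[of "\<lambda>t. ennreal pi * indicator {u\<^sup>2..} t * F (u, t)" 1 "u\<^sup>2"] m4 by simp
    also have "\<dots> = (\<integral>\<^sup>+t. ennreal pi * indicator {0..} t * F (u, u\<^sup>2 + t) \<partial>lborel)"
      by (intro nn_integral_cong) (auto simp: indicator_def)
    finally show "(\<integral>\<^sup>+t. ennreal pi * indicator {0..} t * F (u, u\<^sup>2 + t) \<partial>lborel)
       = (\<integral>\<^sup>+t. ennreal pi * indicator {p. (fst p)\<^sup>2 \<le> snd p} (u, t) * F (u, t) \<partial>lborel)"
      by (simp add: indicator_def)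
  qed
  also have "\<dots> = (\<integral>\<^sup>+p. ennreal pi * indicator {p. (fst p)\<^sup>2 \<le> snd p} p * F p \<partial>(lborel \<Otimes>\<^sub>M lborel))"
    using S F by (intro lborel.nn_integral_fst) (simp add: lborel_prod)
  finally show ?thesis by (simp add: lborel_prod)
qed

text \<open>An equality of measures, so that Bochner integrals of complex functions can be
  transformed as well as nonnegative ones.\<close>

lemma distr_cylinder:
  "distr lborel borel (\<lambda>x::real^3. (x$1, x \<bullet> x)) = density lborel (\<lambda>p. ennreal (pi * indicator {p. (fst p)\<^sup>2 \<le> snd p} p))"
proof (rule measure_eqI)
  have cont: "continuous_on UNIV (\<lambda>x::real^3. (x$1, x \<bullet> x))" by (intro continuous_intros)
  have m: "(\<lambda>x::real^3. (x$1, x \<bullet> x)) \<in> lborel \<rightarrow>\<^sub>M borel" using borel_measurable_continuous_onI[OF cont] by simp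
  have S: "{p::real \<times> real. (fst p)\<^sup>2 \<le> snd p} \<in> sets borel"
    by (intro borel_closed closed_Collect_le continuous_intros)
  fix A assume "A \<in> sets (distr lborel borel (\<lambda>x::real^3. (x$1, x \<bullet> x)))"
  then have A: "A \<in> sets borel" by simp
  have "emeasure (distr lborel borel (\<lambda>x::real^3. (x$1, x \<bullet> x))) A = (\<integral>\<^sup>+q. indicator A q \<partial>distr lborel borel (\<lambda>x::real^3. (x$1, x \<bullet> x)))"
    using A by simp
  also have "\<dots> = (\<integral>\<^sup>+x. indicator A (x$1, x \<bullet> x) \<partial>(lborel :: (real^3) measure))"
    using m A by (subst nn_integral_distr) auto
  also have "\<dots> = (\<integral>\<^sup>+p. ennreal pi * indicator {p. (fst p)\<^sup>2 \<le> snd p} p * indicator A p \<partial>lborel)"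
    using A by (intro nn_integral_cylinder) auto
  also have "\<dots> = emeasure (density lborel (\<lambda>p. ennreal (pi * indicator {p. (fst p)\<^sup>2 \<le> snd p} p))) A"
  proof -
    have D: "(\<lambda>p::real \<times> real. ennreal (pi * indicator {p. (fst p)\<^sup>2 \<le> snd p} p)) \<in> borel_measurable lborel"
      using S by simp
    show ?thesis using A by (subst emeasure_density[OF D]) (auto intro!: nn_integral_cong simp: indicator_def)
  qed
  finally show "emeasure (distr lborel borel (\<lambda>x::real^3. (x$1, x \<bullet> x))) A
     = emeasure (density lborel (\<lambda>p. ennreal (pi * indicator {p. (fst p)\<^sup>2 \<le> snd p} p))) A" .
qed simp

lemma integral_cylinder:
  fixes f :: "real \<times> real \<Rightarrow> complex"
  assumes f: "f \<in> borel_measurable borel"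
  shows "(\<integral>x. f (x$1, x \<bullet> x) \<partial>(lborel :: (real^3) measure))
      = (\<integral>p. (pi * indicator {p. (fst p)\<^sup>2 \<le> snd p} p) *\<^sub>R f p \<partial>lborel)"
    and "integrable lborel (\<lambda>x::real^3. f (x$1, x \<bullet> x)) \<longleftrightarrow>
      integrable lborel (\<lambda>p. (pi * indicator {p. (fst p)\<^sup>2 \<le> snd p} p) *\<^sub>R f p)"
proof -
  have cont: "continuous_on UNIV (\<lambda>x::real^3. (x$1, x \<bullet> x))" by (intro continuous_intros)
  have m: "(\<lambda>x::real^3. (x$1, x \<bullet> x)) \<in> lborel \<rightarrow>\<^sub>M borel" using borel_measurable_continuous_onI[OF cont] by simp
  have S: "{p::real \<times> real. (fst p)\<^sup>2 \<le> snd p} \<in> sets borel"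
    by (intro borel_closed closed_Collect_le continuous_intros)
  have D: "(\<lambda>p::real \<times> real. pi * indicator {p. (fst p)\<^sup>2 \<le> snd p} p) \<in> borel_measurable lborel"
    using S by simp
  have fl: "f \<in> borel_measurable lborel" using f by simp
  have "(\<integral>x. f (x$1, x \<bullet> x) \<partial>(lborel :: (real^3) measure)) = (\<integral>p. f p \<partial>distr lborel borel (\<lambda>x::real^3. (x$1, x \<bullet> x)))"
    using integral_distr[OF m f] by simp
  also have "\<dots> = (\<integral>p. (pi * indicator {p. (fst p)\<^sup>2 \<le> snd p} p) *\<^sub>R f p \<partial>lborel)"
    unfolding distr_cylinder by (rule integral_density[OF fl D]) simp
  finally show "(\<integral>x. f (x$1, x \<bullet> x) \<partial>(lborel :: (real^3) measure))
      = (\<integral>p. (pi * indicator {p. (fst p)\<^sup>2 \<le> snd p} p) *\<^sub>R f p \<partial>lborel)" .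
  have "integrable lborel (\<lambda>x::real^3. f (x$1, x \<bullet> x)) \<longleftrightarrow> integrable (distr lborel borel (\<lambda>x::real^3. (x$1, x \<bullet> x))) f"
    using integrable_distr_eq[OF m f] by simp
  also have "\<dots> \<longleftrightarrow> integrable lborel (\<lambda>p. (pi * indicator {p. (fst p)\<^sup>2 \<le> snd p} p) *\<^sub>R f p)"
    unfolding distr_cylinder by (rule integrable_density[OF fl D]) simp
  finally show "integrable lborel (\<lambda>x::real^3. f (x$1, x \<bullet> x)) \<longleftrightarrow>
      integrable lborel (\<lambda>p. (pi * indicator {p. (fst p)\<^sup>2 \<le> snd p} p) *\<^sub>R f p)" .
qed

section \<open>Coherent states\<close>

text \<open>Write b = p + iq. The substitution x = p + y/sqrt 2 absorbs the real part, and the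
  imaginary part leaves the characteristic function of the standard normal law at sqrt 2 q; no
  contour is moved.\<close>

lemma has_bochner_integral_gauss:
  "has_bochner_integral lborel (\<lambda>x. exp (- (complex_of_real x)\<^sup>2 + 2 * b * complex_of_real x)) (complex_of_real (sqrt pi) * exp (b\<^sup>2))"
proof -
  define p q where "p = Re b" and "q = Im b"
  have b: "b = complex_of_real p + \<i> * complex_of_real q" by (simp add: p_def q_def complex_eq_iff)
  let ?t = "sqrt 2 * q"
  have int: "integrable lborel (\<lambda>y. std_normal_density y *\<^sub>R iexp (?t * y))"
  proof (rule Bochner_Integration.integrable_bound[where f = std_normal_density])
    show "integrable lborel std_normal_density" by (rule integrable_normal_density) simp
    show "(\<lambda>y. std_normal_density y *\<^sub>R iexp (?t * y)) \<in> borel_measurable lborel" by simp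
  qed (simp add: normal_density_nonneg)
  have "(\<integral>y. std_normal_density y *\<^sub>R iexp (?t * y) \<partial>lborel) = char std_normal_distribution ?t"
    unfolding char_def by (subst integral_density) (simp_all add: normal_density_nonneg)
  also have "\<dots> = complex_of_real (exp (- q\<^sup>2))"
    unfolding char_std_normal_distribution by (simp add: power_mult_distrib)
  finally have "has_bochner_integral lborel (\<lambda>y. std_normal_density y *\<^sub>R iexp (?t * y)) (complex_of_real (exp (- q\<^sup>2)))"
    using int by (simp add: has_bochner_integral_iff)
  then have "has_bochner_integral lborel (\<lambda>y. (complex_of_real (sqrt (2 * pi)) * exp (complex_of_real (p\<^sup>2) + 2 * \<i> * complex_of_real (p * q))) *
       (std_normal_density y *\<^sub>R iexp (?t * y)))
     ((complex_of_real (sqrt (2 * pi)) * exp (complex_of_real (p\<^sup>2) + 2 * \<i> * complex_of_real (p * q))) * complex_of_real (exp (- q\<^sup>2)))"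
    by (rule has_bochner_integral_mult_right)
  moreover have "(complex_of_real (sqrt (2 * pi)) * exp (complex_of_real (p\<^sup>2) + 2 * \<i> * complex_of_real (p * q))) *
       (std_normal_density y *\<^sub>R iexp (?t * y))
     = exp (- (complex_of_real (p + 1 / sqrt 2 * y))\<^sup>2 + 2 * b * complex_of_real (p + 1 / sqrt 2 * y))" for y
  proof -
    have "complex_of_real (sqrt (2 * pi)) * complex_of_real (std_normal_density y) = exp (complex_of_real (- y\<^sup>2 / 2))"
    proof -
      have "sqrt (2 * pi) * std_normal_density y = exp (- y\<^sup>2 / 2)" by (simp add: std_normal_density_def)
      then show ?thesis by (simp only: of_real_mult[symmetric] exp_of_real)
    qed
    then have "(complex_of_real (sqrt (2 * pi)) * exp (complex_of_real (p\<^sup>2) + 2 * \<i> * complex_of_real (p * q))) *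
       (std_normal_density y *\<^sub>R iexp (?t * y))
      = exp (complex_of_real (- y\<^sup>2 / 2)) * exp (complex_of_real (p\<^sup>2) + 2 * \<i> * complex_of_real (p * q)) * iexp (?t * y)"
      by (simp add: scaleR_conv_of_real mult_ac)
    also have "\<dots> = exp (complex_of_real (- y\<^sup>2 / 2) + (complex_of_real (p\<^sup>2) + 2 * \<i> * complex_of_real (p * q)) + \<i> * complex_of_real (?t * y))"
      by (simp only: exp_add)
    also have "complex_of_real (- y\<^sup>2 / 2) + (complex_of_real (p\<^sup>2) + 2 * \<i> * complex_of_real (p * q)) + \<i> * complex_of_real (?t * y)
      = - (complex_of_real (p + 1 / sqrt 2 * y))\<^sup>2 + 2 * b * complex_of_real (p + 1 / sqrt 2 * y)"
    proof -
      have s: "1 / sqrt 2 * (1 / sqrt 2) = (1/2::real)" "sqrt 2 = 2 * (1 / sqrt (2::real))"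
        by (simp_all add: real_div_sqrt)
      define r where "r = 1 / sqrt (2::real)"
      have r: "r * r = 1/2" "sqrt 2 = 2 * r" using s by (simp_all add: r_def)
      have "Re (complex_of_real (- y\<^sup>2 / 2) + (complex_of_real (p\<^sup>2) + 2 * \<i> * complex_of_real (p * q)) + \<i> * complex_of_real (?t * y))
         = Re (- (complex_of_real (p + r * y))\<^sup>2 + 2 * b * complex_of_real (p + r * y))"
      proof -
        have "- y\<^sup>2 / 2 = - (r * r) * y\<^sup>2" unfolding r(1) by simp
        then show ?thesis unfolding b by (simp add: power2_eq_square algebra_simps)
      qed
      moreover have "Im (complex_of_real (- y\<^sup>2 / 2) + (complex_of_real (p\<^sup>2) + 2 * \<i> * complex_of_real (p * q)) + \<i> * complex_of_real (?t * y))
         = Im (- (complex_of_real (p + r * y))\<^sup>2 + 2 * b * complex_of_real (p + r * y))"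
        unfolding b r(2) by (simp add: power2_eq_square algebra_simps)
      ultimately show ?thesis unfolding r_def by (rule complex_eqI)
    qed
    finally show ?thesis .
  qed
  moreover have "(complex_of_real (sqrt (2 * pi)) * exp (complex_of_real (p\<^sup>2) + 2 * \<i> * complex_of_real (p * q))) * complex_of_real (exp (- q\<^sup>2))
     = (complex_of_real (sqrt pi) * exp (b\<^sup>2)) /\<^sub>R \<bar>1 / sqrt 2\<bar>"
  proof -
    have "b\<^sup>2 = (complex_of_real (p\<^sup>2) + 2 * \<i> * complex_of_real (p * q)) + complex_of_real (- q\<^sup>2)"
      unfolding b by (simp add: power2_eq_square algebra_simps)
    then have "exp (b\<^sup>2) = exp (complex_of_real (p\<^sup>2) + 2 * \<i> * complex_of_real (p * q)) * complex_of_real (exp (- q\<^sup>2))"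
      by (simp only: exp_add exp_of_real)
    then show ?thesis by (simp add: scaleR_conv_of_real real_sqrt_mult)
  qed
  ultimately have "has_bochner_integral lborel (\<lambda>y. exp (- (complex_of_real (p + 1 / sqrt 2 * y))\<^sup>2 + 2 * b * complex_of_real (p + 1 / sqrt 2 * y)))
     ((complex_of_real (sqrt pi) * exp (b\<^sup>2)) /\<^sub>R \<bar>1 / sqrt 2\<bar>)"
    by (simp only:)
  then show ?thesis
    by (subst lborel_has_bochner_integral_real_affine_iff[where c = "1 / sqrt 2" and t = p]) simp_all
qed

lemma has_bochner_integral_Times:
  fixes f :: "'a::euclidean_space \<Rightarrow> complex" and g :: "'b::euclidean_space \<Rightarrow> complex"
  assumes f: "has_bochner_integral lborel f I" and g: "has_bochner_integral lborel g J"
  shows "has_bochner_integral lborel (\<lambda>p. f (fst p) * g (snd p)) (I * J)"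
proof -
  have fi: "integrable lborel f" "integrable lborel g" and IJ: "integral\<^sup>L lborel f = I" "integral\<^sup>L lborel g = J"
    using f g by (auto simp: has_bochner_integral_iff)
  have fm: "f \<in> borel_measurable borel" "g \<in> borel_measurable borel"
    using borel_measurable_integrable[OF fi(1)] borel_measurable_integrable[OF fi(2)] by simp_all
  have m: "(\<lambda>p. f (fst p) * g (snd p)) \<in> borel_measurable (lborel \<Otimes>\<^sub>M lborel)"
    using fm by simp
  have int: "integrable (lborel \<Otimes>\<^sub>M lborel) (\<lambda>p. f (fst p) * g (snd p))"
  proof (rule lborel_pair.Fubini_integrable[OF m])
    have "(\<lambda>x. \<integral>y. norm (f (fst (x, y)) * g (snd (x, y))) \<partial>lborel) = (\<lambda>x. norm (f x) * (\<integral>y. norm (g y) \<partial>lborel))"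
      by (simp add: norm_mult)
    then show "integrable lborel (\<lambda>x. \<integral>y. norm (f (fst (x, y)) * g (snd (x, y))) \<partial>lborel)"
      using fi(1) by simp
    show "AE x in lborel. integrable lborel (\<lambda>y. f (fst (x, y)) * g (snd (x, y)))" using fi(2) by simp
  qed
  have "integral\<^sup>L (lborel \<Otimes>\<^sub>M lborel) (\<lambda>p. f (fst p) * g (snd p)) = (\<integral>x. (\<integral>y. f x * g y \<partial>lborel) \<partial>lborel)"
    using lborel_pair.integral_fst[of "\<lambda>x y. f x * g y"] int by (simp add: split_beta')
  also have "\<dots> = I * J" using IJ by simp
  finally show ?thesis using int by (simp add: has_bochner_integral_iff lborel_prod)
qed

lemma has_bochner_integral_prod3:
  fixes f1 f2 f3 :: "real \<Rightarrow> complex"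
  assumes "has_bochner_integral lborel f1 I1" "has_bochner_integral lborel f2 I2" "has_bochner_integral lborel f3 I3"
  shows "has_bochner_integral lborel (\<lambda>x::real^3. f1 (x$1) * f2 (x$2) * f3 (x$3)) (I1 * I2 * I3)"
proof -
  have "has_bochner_integral lborel (\<lambda>p. f1 (fst p) * (f2 (fst (snd p)) * f3 (snd (snd p)))) (I1 * (I2 * I3))"
    by (rule has_bochner_integral_Times[OF assms(1) has_bochner_integral_Times[OF assms(2,3)]])
  then have h: "has_bochner_integral lborel (\<lambda>p. f1 (vec3 p $ 1) * f2 (vec3 p $ 2) * f3 (vec3 p $ 3)) (I1 * I2 * I3)"
    by (simp add: mult.assoc)
  have fm: "f1 \<in> borel_measurable borel" "f2 \<in> borel_measurable borel" "f3 \<in> borel_measurable borel"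
    using assms[THEN borel_measurable_has_bochner_integral] by simp_all
  have nth: "(\<lambda>x::real^3. x$i) \<in> borel \<rightarrow>\<^sub>M borel" for i
    by (rule borel_measurable_continuous_onI) (intro continuous_intros)
  have m: "(\<lambda>x::real^3. f1 (x$1) * f2 (x$2) * f3 (x$3)) \<in> borel_measurable borel"
    by (rule borel_measurable_times[OF borel_measurable_times])
       (rule measurable_compose[OF nth fm(1)] measurable_compose[OF nth fm(2)] measurable_compose[OF nth fm(3)])+
  have v: "vec3 \<in> lborel \<rightarrow>\<^sub>M borel" using measurable_vec3 by simp
  show ?thesis
    using h integrable_distr_eq[OF v m] integral_distr[OF v m] by (simp add: has_bochner_integral_iff distr_vec3)
qed

text \<open>The sum of the two exponents is quadratic in x with linear coefficient sqrt 2 (conj z +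
  w), a Gaussian integral with b = (conj z + w)/sqrt 2. In b^2 the squares of conj z and w cancel
  against the prefactors and the cross term survives.\<close>

lemma coh_inner:
  "has_bochner_integral lborel (\<lambda>x. cnj (coh z x) * coh w x) (exp (- complex_of_real (((cmod z)\<^sup>2 + (cmod w)\<^sup>2) / 2) + cnj z * w))"
proof -
  define r where "r = complex_of_real (sqrt 2)"
  have rr: "r * r = 2" unfolding r_def by (metis of_real_mult of_real_numeral real_sqrt_mult_self abs_numeral)
  define b where "b = (cnj z + w) / r"
  define N where "N = complex_of_real (pi powr (-1/4) * exp (- (cmod z)\<^sup>2 / 2)) * complex_of_real (pi powr (-1/4) * exp (- (cmod w)\<^sup>2 / 2))"
  have r0: "r \<noteq> 0" using rr by auto
  have eq: "cnj (coh z x) * coh w x = (N * exp (- (cnj z)\<^sup>2 / 2 - w\<^sup>2 / 2)) * exp (- (complex_of_real x)\<^sup>2 + 2 * b * complex_of_real x)" for x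
  proof -
    have c: "cnj (coh z x) = complex_of_real (pi powr (-1/4) * exp (- (cmod z)\<^sup>2 / 2)) *
       exp (- (complex_of_real x)\<^sup>2 / 2 + r * cnj z * complex_of_real x - (cnj z)\<^sup>2 / 2)"
      by (simp add: coh_def r_def exp_cnj)
    have b2: "2 * b = r * (cnj z + w)"
    proof -
      have "2 * b = r * r * ((cnj z + w) / r)" by (simp only: b_def rr)
      then show ?thesis using r0 by simp
    qed
    have "cnj (coh z x) * coh w x = N * (exp (- (complex_of_real x)\<^sup>2 / 2 + r * cnj z * complex_of_real x - (cnj z)\<^sup>2 / 2)
        * exp (- (complex_of_real x)\<^sup>2 / 2 + r * w * complex_of_real x - w\<^sup>2 / 2))"
      unfolding c by (simp add: coh_def N_def r_def)
    also have "\<dots> = N * exp ((- (cnj z)\<^sup>2 / 2 - w\<^sup>2 / 2) + (- (complex_of_real x)\<^sup>2 + 2 * b * complex_of_real x))"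
      unfolding b2 by (simp add: exp_add[symmetric] algebra_simps)
    finally show ?thesis by (simp only: exp_add mult.assoc)
  qed
  have N: "N * complex_of_real (sqrt pi) = exp (- complex_of_real (((cmod z)\<^sup>2 + (cmod w)\<^sup>2) / 2))"
  proof -
    have "pi powr (-1/4) * pi powr (-1/4) * sqrt pi = 1"
      by (simp add: powr_half_sqrt[symmetric] powr_add[symmetric])
    then have "(pi powr (-1/4) * exp (- (cmod z)\<^sup>2 / 2)) * (pi powr (-1/4) * exp (- (cmod w)\<^sup>2 / 2)) * sqrt pi
       = exp (- (cmod z)\<^sup>2 / 2) * exp (- (cmod w)\<^sup>2 / 2)" by (simp add: mult_ac)
    also have "\<dots> = exp (- (((cmod z)\<^sup>2 + (cmod w)\<^sup>2) / 2))" by (simp add: exp_add[symmetric] add_divide_distrib)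
    finally show ?thesis unfolding N_def by (simp flip: of_real_mult exp_of_real)
  qed
  have b2: "b\<^sup>2 = (cnj z)\<^sup>2 / 2 + w\<^sup>2 / 2 + cnj z * w"
    unfolding b_def power_divide using rr by (simp add: power2_eq_square algebra_simps add_divide_distrib)
  have "(N * exp (- (cnj z)\<^sup>2 / 2 - w\<^sup>2 / 2)) * (complex_of_real (sqrt pi) * exp (b\<^sup>2))
     = (N * complex_of_real (sqrt pi)) * exp ((- (cnj z)\<^sup>2 / 2 - w\<^sup>2 / 2) + b\<^sup>2)"
    by (simp only: exp_add mult_ac)
  also have "(- (cnj z)\<^sup>2 / 2 - w\<^sup>2 / 2) + b\<^sup>2 = cnj z * w" unfolding b2 by simp
  finally have fin: "(N * exp (- (cnj z)\<^sup>2 / 2 - w\<^sup>2 / 2)) * (complex_of_real (sqrt pi) * exp (b\<^sup>2))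
     = exp (- complex_of_real (((cmod z)\<^sup>2 + (cmod w)\<^sup>2) / 2) + cnj z * w)"
    unfolding N by (simp only: exp_add)
  have fe: "(\<lambda>x. cnj (coh z x) * coh w x)
     = (\<lambda>x. (N * exp (- (cnj z)\<^sup>2 / 2 - w\<^sup>2 / 2)) * exp (- (complex_of_real x)\<^sup>2 + 2 * b * complex_of_real x))"
    by (rule ext) (rule eq)
  show ?thesis unfolding fe fin[symmetric]
    by (rule has_bochner_integral_mult_right) (rule has_bochner_integral_gauss)
qed

lemma prodcoh_inner:
  "has_bochner_integral lborel (\<lambda>x. cnj (prodcoh z x) * prodcoh w x)
     (exp (- complex_of_real (((cmod (z$1))\<^sup>2 + (cmod (w$1))\<^sup>2) / 2) + cnj (z$1) * w$1)
    * exp (- complex_of_real (((cmod (z$2))\<^sup>2 + (cmod (w$2))\<^sup>2) / 2) + cnj (z$2) * w$2)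
    * exp (- complex_of_real (((cmod (z$3))\<^sup>2 + (cmod (w$3))\<^sup>2) / 2) + cnj (z$3) * w$3))"
proof -
  have eq: "(\<lambda>x. cnj (prodcoh z x) * prodcoh w x) = (\<lambda>x. (cnj (coh (z$1) (x$1)) * coh (w$1) (x$1)) * (cnj (coh (z$2) (x$2)) * coh (w$2) (x$2))
      * (cnj (coh (z$3) (x$3)) * coh (w$3) (x$3)))"
    by (rule ext) (simp only: prodcoh_def complex_cnj_mult mult_ac)
  show ?thesis unfolding eq by (rule has_bochner_integral_prod3[OF coh_inner coh_inner coh_inner])
qed

lemma cmod_coh_overlap: "(cmod (exp (- complex_of_real (((cmod z)\<^sup>2 + (cmod w)\<^sup>2) / 2) + cnj z * w)))\<^sup>2 = exp (- (cmod (z - w))\<^sup>2)"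
proof -
  have "(cmod (z - w))\<^sup>2 = (cmod z)\<^sup>2 + (cmod w)\<^sup>2 - 2 * Re (cnj z * w)"
    unfolding cmod_power2 by (simp add: power2_eq_square algebra_simps)
  moreover have "(exp t)\<^sup>2 = exp (2 * t)" for t :: real by (rule exp_double[symmetric])
  ultimately show ?thesis by (simp only: norm_exp_eq_Re) (simp add: field_simps)
qed

text \<open>Makes the outcome density of the heterodyne measurement, up to the factor pi^-3, an
  explicit Gaussian centred at (\<theta>,\<theta>,\<theta>).\<close>

lemma overlap_psi:
  "(cmod (l2inner (prodcoh z) (psi \<theta>)))\<^sup>2 = exp (- ((cmod (z$1 - \<theta>))\<^sup>2 + (cmod (z$2 - \<theta>))\<^sup>2 + (cmod (z$3 - \<theta>))\<^sup>2))"
proof -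
  have "l2inner (prodcoh z) (psi \<theta>) = exp (- complex_of_real (((cmod (z$1))\<^sup>2 + (cmod \<theta>)\<^sup>2) / 2) + cnj (z$1) * \<theta>)
    * exp (- complex_of_real (((cmod (z$2))\<^sup>2 + (cmod \<theta>)\<^sup>2) / 2) + cnj (z$2) * \<theta>)
    * exp (- complex_of_real (((cmod (z$3))\<^sup>2 + (cmod \<theta>)\<^sup>2) / 2) + cnj (z$3) * \<theta>)"
    unfolding l2inner_def psi_def using prodcoh_inner[of z "\<chi> j. \<theta>"] by (simp add: has_bochner_integral_iff)
  then show ?thesis
    by (simp only: norm_mult power_mult_distrib cmod_coh_overlap) (simp add: exp_add[symmetric] algebra_simps)
qed

lemma continuous_coh: "continuous_on S (coh \<theta>)"
  unfolding coh_def by (intro continuous_intros) auto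

lemma sqint_psi: "sqint (psi \<theta>)"
  unfolding sqint_def
proof
  have "continuous_on UNIV (psi \<theta>)"
    unfolding psi_def prodcoh_def by (intro continuous_intros continuous_on_compose2[OF continuous_coh[of UNIV]]) auto
  then show "psi \<theta> \<in> borel_measurable lborel" using borel_measurable_continuous_onI by simp
  have "integrable lborel (\<lambda>x. cnj (psi \<theta> x) * psi \<theta> x)"
    using prodcoh_inner[of "\<chi> j. \<theta>" "\<chi> j. \<theta>"] by (simp add: has_bochner_integral_iff psi_def)
  then have "integrable lborel (\<lambda>x. cmod (cnj (psi \<theta> x) * psi \<theta> x))" by (rule integrable_norm)
  then show "integrable lborel (\<lambda>x. (cmod (psi \<theta> x))\<^sup>2)" by (simp add: norm_mult power2_eq_square)
qed

section \<open>The radial part of a product of coherent states\<close>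

text \<open>The function sinh(z)/z as a power series in w = z^2. It is entire and involves no square
  root, so evaluated at a multiple of |x|^2 it gives a smooth function.\<close>

definition sinhc :: "complex \<Rightarrow> complex" where
  "sinhc w = (\<Sum>n. (1 / fact (2 * n + 1)) * w ^ n)"

lemma sinhc_summable: "summable (\<lambda>n. (1 / fact (2 * n + 1)) * (w::complex) ^ n)"
proof (rule summable_comparison_test)
  have "norm ((1 / fact (2 * n + 1)) * w ^ n) \<le> norm (w ^ n /\<^sub>R fact n)" for n
  proof -
    have "(fact n :: real) \<le> fact (2 * n + 1)" by (rule fact_mono) simp
    then have "1 / (fact (2 * n + 1) :: real) \<le> 1 / fact n" by (intro divide_left_mono) auto
    then have "1 / fact (2 * n + 1) * norm w ^ n \<le> 1 / fact n * norm w ^ n" by (intro mult_right_mono) auto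
    moreover have "norm ((1::complex) / fact m) = 1 / fact m" for m by (simp add: norm_divide)
    moreover have "norm (w ^ n /\<^sub>R fact n) = 1 / fact n * norm w ^ n" by (simp add: norm_power divide_inverse)
    ultimately show ?thesis by (simp only: norm_mult norm_power)
  qed
  then show "\<exists>N. \<forall>n\<ge>N. norm ((1 / fact (2 * n + 1)) * w ^ n) \<le> norm (w ^ n /\<^sub>R fact n)" by blast
  show "summable (\<lambda>n. norm (w ^ n /\<^sub>R fact n))" by (rule summable_norm_exp)
qed

lemma sinhc_holomorphic: "sinhc holomorphic_on UNIV"
proof -
  have "(sinhc has_field_derivative (\<Sum>n. diffs (\<lambda>n. 1 / fact (2 * n + 1)) n * w ^ n)) (at w)" for w
    unfolding sinhc_def[abs_def] by (rule termdiffs_strong_converges_everywhere[OF sinhc_summable])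
  then show ?thesis unfolding holomorphic_on_open[OF open_UNIV] by blast
qed

lemma sinhc_square: "z * sinhc (z\<^sup>2) = sinh z"
proof -
  have "(\<lambda>n. if even n then 0 else z ^ n /\<^sub>R fact n) sums sinh z" by (rule sinh_converges)
  then have "(\<lambda>n. (\<lambda>n. if even n then 0 else z ^ n /\<^sub>R fact n) (2 * n + 1)) sums sinh z"
    by (subst sums_mono_reindex) (auto simp: strict_mono_def elim!: oddE)
  moreover have "(\<lambda>n. if even n then 0 else z ^ n /\<^sub>R fact n) (2 * n + 1) = z * ((1 / fact (2 * n + 1)) * (z\<^sup>2) ^ n)" for n
    by (simp add: power_mult[symmetric] scaleR_conv_of_real divide_inverse mult_ac)
  ultimately have s1: "(\<lambda>n. z * ((1 / fact (2 * n + 1)) * (z\<^sup>2) ^ n)) sums sinh z" by (simp only:)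
  have s2: "(\<lambda>n. z * ((1 / fact (2 * n + 1)) * (z\<^sup>2) ^ n)) sums (z * sinhc (z\<^sup>2))"
    unfolding sinhc_def by (intro sums_mult summable_sums sinhc_summable)
  show ?thesis by (rule sums_unique2[OF s2 s1])
qed

text \<open>The mean of exp(a u) over [-r, r] is sinh(a r)/(a r). By the hat-box theorem it is also
  the mean of exp(a x_1) over the sphere of radius r, so this is orthogonality to radial functions
  on a single fibre.\<close>

lemma sinhc_interval_mean:
  assumes a: "a \<noteq> 0"
  shows "(\<integral>u. indicator {u. u\<^sup>2 \<le> t} u *\<^sub>R (exp (a * complex_of_real u) - sinhc (a\<^sup>2 * complex_of_real t)) \<partial>lborel) = 0"
proof (cases "t \<ge> 0")
  case False
  have "\<not> u\<^sup>2 \<le> t" for u :: real using False zero_le_power2[of u] by linarith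
  then show ?thesis by simp
next
  case True
  define r where "r = sqrt t"
  have r: "r \<ge> 0" "t = r\<^sup>2" using True by (auto simp: r_def)
  let ?F = "\<lambda>u. exp (a * complex_of_real u) / a - complex_of_real u * sinhc (a\<^sup>2 * complex_of_real t)"
  have set: "{u. u\<^sup>2 \<le> t} = {-r..r}" using r by (auto simp: abs_le_square_iff[symmetric] abs_le_iff)
  have "(\<integral>u. indicator {-r..r} u *\<^sub>R (exp (a * complex_of_real u) - sinhc (a\<^sup>2 * complex_of_real t)) \<partial>lborel) = ?F r - ?F (-r)"
  proof (rule integral_FTC_atLeastAtMost)
    show "- r \<le> r" using r by simp
    show "continuous_on {- r..r} (\<lambda>u. exp (a * complex_of_real u) - sinhc (a\<^sup>2 * complex_of_real t))"
      by (intro continuous_intros)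
    fix u
    have D: "(?F has_vector_derivative (exp (a * complex_of_real u) * a / a - sinhc (a\<^sup>2 * complex_of_real t))) (at u)"
    proof -
      have "((\<lambda>z. exp (a * z) / a - z * sinhc (a\<^sup>2 * complex_of_real t)) has_field_derivative
          (exp (a * complex_of_real u) * a / a - sinhc (a\<^sup>2 * complex_of_real t))) (at (complex_of_real u))"
        using a by (auto intro!: derivative_eq_intros)
      then show ?thesis by (rule has_vector_derivative_real_field)
    qed
    show "(?F has_vector_derivative (exp (a * complex_of_real u) - sinhc (a\<^sup>2 * complex_of_real t))) (at u within {-r..r})"
      by (rule has_vector_derivative_at_within) (use D a in simp)
  qed
  also have "?F r - ?F (-r) = 0"
  proof -
    have "a * complex_of_real r * sinhc ((a * complex_of_real r)\<^sup>2) = (exp (a * complex_of_real r) - exp (- (a * complex_of_real r))) / 2"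
      unfolding sinhc_square by (simp add: sinh_def scaleR_conv_of_real)
    then have "complex_of_real r * sinhc (a\<^sup>2 * complex_of_real t) = (exp (a * complex_of_real r) - exp (- (a * complex_of_real r))) / (2 * a)"
      using a r(2) by (simp add: power_mult_distrib field_simps)
    then have "complex_of_real r * sinhc (a\<^sup>2 * complex_of_real t) + complex_of_real r * sinhc (a\<^sup>2 * complex_of_real t)
        = exp (a * complex_of_real r) / a - exp (- (a * complex_of_real r)) / a"
      using a by (simp add: diff_divide_distrib)
    moreover have "?F r - ?F (-r) = (exp (a * complex_of_real r) / a - exp (- (a * complex_of_real r)) / a)
        - (complex_of_real r * sinhc (a\<^sup>2 * complex_of_real t) + complex_of_real r * sinhc (a\<^sup>2 * complex_of_real t))"
      by simp
    ultimately show ?thesis by (simp only: diff_self)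
  qed
  finally show ?thesis unfolding set .
qed

definition psi_norm :: "complex \<Rightarrow> complex" where
  "psi_norm \<theta> = (complex_of_real (pi powr (-1/4) * exp (- (cmod \<theta>)\<^sup>2 / 2))) ^ 3 * exp (- 3 * \<theta>\<^sup>2 / 2)"

lemma psi_eq:
  "psi \<theta> x = psi_norm \<theta> * exp (- complex_of_real (x \<bullet> x) / 2) * exp (complex_of_real (sqrt 2) * \<theta> * complex_of_real (x$1 + x$2 + x$3))"
proof -
  have "psi \<theta> x = (complex_of_real (pi powr (-1/4) * exp (- (cmod \<theta>)\<^sup>2 / 2))) ^ 3 *
    (exp (- (complex_of_real (x$1))\<^sup>2 / 2 + complex_of_real (sqrt 2) * \<theta> * complex_of_real (x$1) - \<theta>\<^sup>2 / 2)
   * exp (- (complex_of_real (x$2))\<^sup>2 / 2 + complex_of_real (sqrt 2) * \<theta> * complex_of_real (x$2) - \<theta>\<^sup>2 / 2)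
   * exp (- (complex_of_real (x$3))\<^sup>2 / 2 + complex_of_real (sqrt 2) * \<theta> * complex_of_real (x$3) - \<theta>\<^sup>2 / 2))"
    by (simp only: psi_def prodcoh_def coh_def vec_lambda_beta power3_eq_cube mult_ac)
  moreover have ip: "complex_of_real (x \<bullet> x) = (complex_of_real (x$1))\<^sup>2 + (complex_of_real (x$2))\<^sup>2 + (complex_of_real (x$3))\<^sup>2"
    by (simp add: inner_vec_def sum_3 power2_eq_square)
  have "(- (complex_of_real (x$1))\<^sup>2 / 2 + complex_of_real (sqrt 2) * \<theta> * complex_of_real (x$1) - \<theta>\<^sup>2 / 2)
     + (- (complex_of_real (x$2))\<^sup>2 / 2 + complex_of_real (sqrt 2) * \<theta> * complex_of_real (x$2) - \<theta>\<^sup>2 / 2)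
     + (- (complex_of_real (x$3))\<^sup>2 / 2 + complex_of_real (sqrt 2) * \<theta> * complex_of_real (x$3) - \<theta>\<^sup>2 / 2)
     = - 3 * \<theta>\<^sup>2 / 2 + (- complex_of_real (x \<bullet> x) / 2 + complex_of_real (sqrt 2) * \<theta> * complex_of_real (x$1 + x$2 + x$3))"
    unfolding ip by (simp add: field_simps)
  then have "exp (- (complex_of_real (x$1))\<^sup>2 / 2 + complex_of_real (sqrt 2) * \<theta> * complex_of_real (x$1) - \<theta>\<^sup>2 / 2)
   * exp (- (complex_of_real (x$2))\<^sup>2 / 2 + complex_of_real (sqrt 2) * \<theta> * complex_of_real (x$2) - \<theta>\<^sup>2 / 2)
   * exp (- (complex_of_real (x$3))\<^sup>2 / 2 + complex_of_real (sqrt 2) * \<theta> * complex_of_real (x$3) - \<theta>\<^sup>2 / 2)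
   = exp (- 3 * \<theta>\<^sup>2 / 2) * (exp (- complex_of_real (x \<bullet> x) / 2) * exp (complex_of_real (sqrt 2) * \<theta> * complex_of_real (x$1 + x$2 + x$3)))"
    by (simp only: exp_add[symmetric])
  ultimately show ?thesis unfolding psi_norm_def by (simp only: mult.assoc)
qed

text \<open>The exponents -3|\<theta>|^2 and -3 Re(\<theta>^2) add up to -6 (Re \<theta>)^2, written
  as the square that later cancels against the Gaussian integral of cosh.\<close>

lemma cmod_psi_norm: "(cmod (psi_norm \<theta>))\<^sup>2 = pi powr (-3/2) * exp (- (Re (complex_of_real (sqrt 6) * \<theta>))\<^sup>2)"
proof -
  have "(cmod (psi_norm \<theta>))\<^sup>2 = ((pi powr (-1/4) * exp (- (cmod \<theta>)\<^sup>2 / 2)) ^ 3 * exp (Re (- 3 * \<theta>\<^sup>2 / 2)))\<^sup>2"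
    unfolding psi_norm_def by (simp only: norm_mult norm_power norm_exp_eq_Re norm_of_real) simp
  also have "\<dots> = (pi powr (-1/4)) ^ 6 * (exp (- (cmod \<theta>)\<^sup>2 / 2) ^ 6 * exp (Re (- 3 * \<theta>\<^sup>2 / 2)) ^ 2)"
    by (simp add: power_mult_distrib power_mult[symmetric])
  also have "(pi powr (-1/4)) ^ 6 = pi powr (-3/2)" by (simp add: powr_realpow[symmetric] powr_powr)
  also have "exp (- (cmod \<theta>)\<^sup>2 / 2) ^ 6 * exp (Re (- 3 * \<theta>\<^sup>2 / 2)) ^ 2 = exp (- (Re (complex_of_real (sqrt 6) * \<theta>))\<^sup>2)"
  proof -
    have "Re (- 3 * \<theta>\<^sup>2 / 2) = - 3 / 2 * ((Re \<theta>)\<^sup>2 - (Im \<theta>)\<^sup>2)" by (simp add: power2_eq_square)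
    then show ?thesis
      by (simp add: exp_of_nat_mult[symmetric] exp_add[symmetric] cmod_power2 power_mult_distrib) (simp add: field_simps)
  qed
  finally show ?thesis .
qed

text \<open>The average of \<open>psi \<theta>\<close> over spheres about the origin. The exponent
  sqrt 2 \<theta> (x_1 + x_2 + x_3) is sqrt 6 \<theta> times the coordinate of x in direction
  (1,1,1), a vector of length sqrt 3.\<close>

definition radial_part :: "complex \<Rightarrow> wf" where
  "radial_part \<theta> x = psi_norm \<theta> * exp (- complex_of_real (x \<bullet> x) / 2) * sinhc ((complex_of_real (sqrt 6) * \<theta>)\<^sup>2 * complex_of_real (x \<bullet> x))"

lemma smooth3_radial_part: "smooth3 (radial_part \<theta>)"
proof -
  have "(\<lambda>w. sinhc ((complex_of_real (sqrt 6) * \<theta>)\<^sup>2 * w)) holomorphic_on UNIV"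
    using holomorphic_on_compose_gen[OF _ sinhc_holomorphic, of "\<lambda>w. (complex_of_real (sqrt 6) * \<theta>)\<^sup>2 * w" UNIV]
    by (simp add: o_def holomorphic_on_mult)
  then have "(\<lambda>w. psi_norm \<theta> * exp (- w / 2) * sinhc ((complex_of_real (sqrt 6) * \<theta>)\<^sup>2 * w)) holomorphic_on UNIV"
    by (intro holomorphic_intros) auto
  from smooth3_radial[OF this] show ?thesis by (simp add: radial_part_def[abs_def])
qed

section \<open>Norm and orthogonality of the radial part\<close>

lemma has_bochner_integral_half_line_even:
  fixes F :: "real \<Rightarrow> real"
  assumes F: "has_bochner_integral lborel F I" and even: "\<And>x. F (- x) = F x"
  shows "has_bochner_integral lborel (\<lambda>x. indicator {0..} x * F x) (I / 2)"
proof -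
  have i: "integrable lborel F" using F by (simp add: has_bochner_integral_iff)
  have ih: "integrable lborel (\<lambda>x. indicator {0..} x * F x)"
    using integrable_mult_indicator[OF _ i, of "{0..}"] by simp
  then obtain J where J: "has_bochner_integral lborel (\<lambda>x. indicator {0..} x *\<^sub>R F x) J"
    by (auto simp: has_bochner_integral_iff)
  have "has_bochner_integral lborel F (2 *\<^sub>R J)" by (rule has_bochner_integral_even_function[OF J]) (rule even)
  from has_bochner_integral_eq[OF F this] have "I = 2 *\<^sub>R J" .
  then show ?thesis using J by simp
qed

lemma has_bochner_integral_cosh_cos:
  "has_bochner_integral lborel (\<lambda>r. exp (- r\<^sup>2) * (cosh (2 * p * r) - cos (2 * q * r))) (sqrt pi * (exp (p\<^sup>2) - exp (- q\<^sup>2)))"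
proof -
  have re: "has_bochner_integral lborel (\<lambda>x. Re (exp (- (complex_of_real x)\<^sup>2 + 2 * b * complex_of_real x))) (Re (complex_of_real (sqrt pi) * exp (b\<^sup>2)))" for b
    by (rule has_bochner_integral_bounded_linear[OF bounded_linear_Re has_bochner_integral_gauss])
  have e: "Re (exp (- (complex_of_real x)\<^sup>2 + 2 * b * complex_of_real x)) = exp (- x\<^sup>2) * (exp (2 * Re b * x) * cos (2 * Im b * x))" for b x
  proof -
    have eqs: "Re (- (complex_of_real x)\<^sup>2 + 2 * b * complex_of_real x) = - x\<^sup>2 + 2 * Re b * x"
      "Im (- (complex_of_real x)\<^sup>2 + 2 * b * complex_of_real x) = 2 * Im b * x" by (simp_all add: power2_eq_square)
    show ?thesis unfolding Re_exp eqs by (simp only: exp_add mult.assoc)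
  qed
  have "has_bochner_integral lborel (\<lambda>x. exp (- x\<^sup>2) * exp (2 * p * x)) (sqrt pi * exp (p\<^sup>2))"
    using re[of "complex_of_real p"] unfolding e by (simp add: exp_of_real flip: of_real_power)
  moreover have "has_bochner_integral lborel (\<lambda>x. exp (- x\<^sup>2) * exp (- (2 * p * x))) (sqrt pi * exp (p\<^sup>2))"
    using re[of "complex_of_real (- p)"] unfolding e by (simp add: exp_of_real flip: of_real_power)
  moreover have "has_bochner_integral lborel (\<lambda>x. exp (- x\<^sup>2) * cos (2 * q * x)) (sqrt pi * exp (- q\<^sup>2))"
    using re[of "\<i> * complex_of_real q"] unfolding e by (simp add: power_mult_distrib exp_of_real flip: of_real_power of_real_minus)
  ultimately have "has_bochner_integral lborel (\<lambda>x. (1/2) * (exp (- x\<^sup>2) * exp (2 * p * x) + exp (- x\<^sup>2) * exp (- (2 * p * x))) - exp (- x\<^sup>2) * cos (2 * q * x))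
      ((1/2) * (sqrt pi * exp (p\<^sup>2) + sqrt pi * exp (p\<^sup>2)) - sqrt pi * exp (- q\<^sup>2))"
    by (intro has_bochner_integral_diff has_bochner_integral_mult_right has_bochner_integral_add)
  then show ?thesis by (simp add: cosh_def algebra_simps)
qed

lemma cmod_sinh_square: "(cmod (sinh z))\<^sup>2 = (cosh (2 * Re z) - cos (2 * Im z)) / 2"
proof -
  have "sinh z = Complex (sinh (Re z) * cos (Im z)) (cosh (Re z) * sin (Im z))"
    by (simp add: complex_eq_iff sinh_def cosh_def Re_exp Im_exp algebra_simps)
  then have "(cmod (sinh z))\<^sup>2 = (sinh (Re z))\<^sup>2 * (cos (Im z))\<^sup>2 + (cosh (Re z))\<^sup>2 * (sin (Im z))\<^sup>2"
    by (simp add: cmod_power2 power_mult_distrib)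
  also have "\<dots> = (cosh (Re z))\<^sup>2 - (cos (Im z))\<^sup>2"
  proof -
    have sq: "(sinh (Re z))\<^sup>2 = (cosh (Re z))\<^sup>2 - 1" "(sin (Im z))\<^sup>2 = 1 - (cos (Im z))\<^sup>2"
      using hyperbolic_pythagoras[of "Re z"] by (simp_all add: sin_squared_eq)
    show ?thesis unfolding sq by (simp add: algebra_simps)
  qed
  also have "\<dots> = (cosh (2 * Re z) - cos (2 * Im z)) / 2"
    by (simp add: cosh_double_cosh cos_double_cos)
  finally show ?thesis .
qed

text \<open>In polar coordinates the area factor r^2 clears the denominator of |sinh(a r)/(a r)|^2,
  leaving a Gaussian times cosh(2pr) - cos(2qr) with a = p + iq. Its integral, proportional to
  exp(p^2) - exp(-q^2), meets the factor exp(-p^2) from \<open>psi_norm\<close>, and p^2 + q^2 =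
  |a|^2 = 6|\<theta>|^2.\<close>

lemma radial_part_norm:
  assumes \<theta>: "\<theta> \<noteq> 0"
  shows "has_bochner_integral lborel (\<lambda>x. (cmod (radial_part \<theta> x))\<^sup>2) ((1 - exp (- 6 * (cmod \<theta>)\<^sup>2)) / (6 * (cmod \<theta>)\<^sup>2))"
proof -
  define a where "a = complex_of_real (sqrt 6) * \<theta>"
  define p q where "p = Re a" and "q = Im a"
  have na: "(cmod a)\<^sup>2 = 6 * (cmod \<theta>)\<^sup>2" by (simp add: a_def norm_mult power_mult_distrib)
  have a0: "a \<noteq> 0" "(cmod a)\<^sup>2 > 0" using \<theta> by (auto simp: a_def)
  have pq: "(cmod a)\<^sup>2 = p\<^sup>2 + q\<^sup>2" by (simp add: p_def q_def cmod_power2)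
  \<comment> \<open>The sphere contributes 4 pi, the formula for |sinh|^2 a factor 1/2, and the
    denominator of sinh(a r)/(a r) the division by |a|^2.\<close>
  define k where "k = 2 * pi * (cmod (psi_norm \<theta>))\<^sup>2 / (cmod a)\<^sup>2"
  have k0: "k \<ge> 0" unfolding k_def by (intro divide_nonneg_nonneg mult_nonneg_nonneg) auto
  define G where "G r = (cmod (psi_norm \<theta>))\<^sup>2 * exp (- r\<^sup>2) * (cmod (sinhc (a\<^sup>2 * complex_of_real (r\<^sup>2))))\<^sup>2" for r
  have gG: "(cmod (radial_part \<theta> x))\<^sup>2 = G (norm x)" for x
  proof -
    have "(cmod (exp (- complex_of_real (x \<bullet> x) / 2)))\<^sup>2 = exp (- (norm x)\<^sup>2)"
      by (simp add: norm_exp_eq_Re exp_double[symmetric] power2_norm_eq_inner)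
    then show ?thesis
      unfolding radial_part_def G_def a_def[symmetric] norm_mult power_mult_distrib by (simp add: power2_norm_eq_inner)
  qed
  have Gm: "G \<in> borel_measurable borel"
  proof (rule borel_measurable_continuous_onI)
    have "continuous_on UNIV sinhc" by (rule holomorphic_on_imp_continuous_on[OF sinhc_holomorphic])
    then have "continuous_on UNIV (\<lambda>r. sinhc (a\<^sup>2 * complex_of_real (r\<^sup>2)))"
      by (rule continuous_on_compose2) (intro continuous_intros | simp)+
    then show "continuous_on UNIV G" unfolding G_def[abs_def] by (intro continuous_intros)
  qed
  have key: "4 * pi * r\<^sup>2 * G r = k * (exp (- r\<^sup>2) * (cosh (2 * p * r) - cos (2 * q * r)))" for r
  proof -
    have "(cmod a)\<^sup>2 * (r\<^sup>2 * (cmod (sinhc (a\<^sup>2 * complex_of_real (r\<^sup>2))))\<^sup>2) = (cmod (a * complex_of_real r * sinhc ((a * complex_of_real r)\<^sup>2)))\<^sup>2"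
      by (simp add: norm_mult power_mult_distrib)
    also have "\<dots> = (cosh (2 * p * r) - cos (2 * q * r)) / 2"
      unfolding sinhc_square cmod_sinh_square by (simp add: p_def q_def mult.assoc)
    finally have rs: "r\<^sup>2 * (cmod (sinhc (a\<^sup>2 * complex_of_real (r\<^sup>2))))\<^sup>2 = (cosh (2 * p * r) - cos (2 * q * r)) / (2 * (cmod a)\<^sup>2)"
      using a0(2) by (simp add: field_simps)
    have "4 * pi * r\<^sup>2 * G r = 4 * pi * (cmod (psi_norm \<theta>))\<^sup>2 * exp (- r\<^sup>2) * (r\<^sup>2 * (cmod (sinhc (a\<^sup>2 * complex_of_real (r\<^sup>2))))\<^sup>2)"
      by (simp only: G_def mult_ac)
    then show ?thesis unfolding rs k_def using a0(2) by (simp add: field_simps)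
  qed
  let ?H = "\<lambda>r. indicator {0..} r * (k * (exp (- r\<^sup>2) * (cosh (2 * p * r) - cos (2 * q * r))))"
  have H: "has_bochner_integral lborel ?H (k * (sqrt pi * (exp (p\<^sup>2) - exp (- q\<^sup>2))) / 2)"
    by (rule has_bochner_integral_half_line_even[OF has_bochner_integral_mult_right[OF has_bochner_integral_cosh_cos]]) simp
  have H0: "?H r \<ge> 0" for r
  proof -
    have "G r \<ge> 0" by (simp add: G_def)
    then have "4 * pi * r\<^sup>2 * G r \<ge> 0" by simp
    then show ?thesis unfolding key by (simp add: indicator_def)
  qed
  have "(\<integral>\<^sup>+x. ennreal ((cmod (radial_part \<theta> x))\<^sup>2) \<partial>lborel) = (\<integral>\<^sup>+x. ennreal (G (norm x)) \<partial>(lborel :: (real^3) measure))"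
    by (simp only: gG)
  also have "\<dots> = (\<integral>\<^sup>+r. ennreal (4 * pi * r\<^sup>2) * indicator {0..} r * ennreal (G r) \<partial>lborel)"
    by (rule nn_integral_norm_space) (use Gm in simp)
  also have "\<dots> = (\<integral>\<^sup>+r. ennreal (?H r) \<partial>lborel)"
  proof (rule nn_integral_cong)
    fix r :: real
    have "ennreal (4 * pi * r\<^sup>2) * ennreal (G r) = ennreal (4 * pi * r\<^sup>2 * G r)"
      by (rule ennreal_mult[symmetric]) (auto simp: G_def)
    then show "ennreal (4 * pi * r\<^sup>2) * indicator {0..} r * ennreal (G r) = ennreal (?H r)"
      unfolding key by (simp add: indicator_def)
  qed
  also have "\<dots> = ennreal (k * (sqrt pi * (exp (p\<^sup>2) - exp (- q\<^sup>2))) / 2)"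
  proof -
    have iH: "integrable lborel ?H" "integral\<^sup>L lborel ?H = k * (sqrt pi * (exp (p\<^sup>2) - exp (- q\<^sup>2))) / 2"
      using H unfolding has_bochner_integral_iff by blast+
    show ?thesis by (simp only: nn_integral_eq_integral[OF iH(1) AE_I2[OF H0]] iH(2))
  qed
  also have "k * (sqrt pi * (exp (p\<^sup>2) - exp (- q\<^sup>2))) / 2 = (1 - exp (- 6 * (cmod \<theta>)\<^sup>2)) / (6 * (cmod \<theta>)\<^sup>2)"
  proof -
    have pp: "pi * sqrt pi * pi powr (-3/2) = 1"
    proof -
      have "pi powr 1 * pi powr (1/2) * pi powr (-3/2) = pi powr 0" by (simp only: powr_add[symmetric]) simp
      then show ?thesis by (simp add: powr_half_sqrt)
    qed
    have "k * (sqrt pi * (exp (p\<^sup>2) - exp (- q\<^sup>2))) / 2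
      = (pi * sqrt pi * pi powr (-3/2)) * (exp (- p\<^sup>2) * (exp (p\<^sup>2) - exp (- q\<^sup>2))) / (cmod a)\<^sup>2"
      unfolding k_def cmod_psi_norm a_def[symmetric] p_def[symmetric] by (simp add: mult_ac)
    also have "exp (- p\<^sup>2) * (exp (p\<^sup>2) - exp (- q\<^sup>2)) = 1 - exp (- (p\<^sup>2 + q\<^sup>2))"
      by (simp add: right_diff_distrib exp_add[symmetric])
    finally show ?thesis unfolding pp pq[symmetric] by (simp only: na) simp
  qed
  finally have "(\<integral>\<^sup>+x. ennreal ((cmod (radial_part \<theta> x))\<^sup>2) \<partial>lborel) = ennreal ((1 - exp (- 6 * (cmod \<theta>)\<^sup>2)) / (6 * (cmod \<theta>)\<^sup>2))" .
  moreover have "(\<lambda>x. (cmod (radial_part \<theta> x))\<^sup>2) \<in> borel_measurable lborel"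
    using smooth3_continuous[OF smooth3_radial_part[of \<theta>], of UNIV]
    by (simp, intro borel_measurable_continuous_onI continuous_intros)
  ultimately show ?thesis
    by (intro has_bochner_integral_nn_integral) auto
qed

lemma radial_part_in_S0:
  assumes "\<theta> \<noteq> 0"
  shows "radial_part \<theta> \<in> S0"
proof (rule radial_in_S0[OF smooth3_radial_part])
  show "sqint (radial_part \<theta>)"
    using smooth3_measurable[OF smooth3_radial_part] radial_part_norm[OF assms] by (simp add: sqint_def has_bochner_integral_iff)
  show "radial_part \<theta> x = radial_part \<theta> y" if "norm x = norm y" for x y
    using that by (simp add: radial_part_def power2_norm_eq_inner[symmetric])
qed

text \<open>An orthogonal map aligns (1,1,1) with the first axis, after which the integrand depends
  on x_1 and |x|^2 alone. A radial h is constant on each fibre t = |x|^2, and the fibre integral of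
  exp(a u) minus its mean is 0.\<close>

lemma radial_part_orthogonal:
  assumes h: "h \<in> S0" and \<theta>: "\<theta> \<noteq> 0"
  shows "l2inner h (psi \<theta> - radial_part \<theta>) = 0"
proof -
  define a where "a = complex_of_real (sqrt 6) * \<theta>"
  have a0: "a \<noteq> 0" using \<theta> by (simp add: a_def)
  let ?one = "vec3 (1, 1, 1)" and ?e1 = "axis 1 1 :: real^3"
  have sq: "sqint h" and sm: "smooth3 h" using h by (auto simp: S0_def domT_def)
  have sg: "sqint (radial_part \<theta>)" using radial_part_in_S0[OF \<theta>] by (simp add: S0_def domT_def)
  have "norm (sqrt 3 *\<^sub>R ?e1) = norm ?one" by (simp add: norm_eq_sqrt_inner[of ?one] inner_vec_def sum_3)
  then obtain A where A: "orthogonal_transformation A" "A (sqrt 3 *\<^sub>R ?e1) = ?one"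
    using orthogonal_transformation_exists[of "sqrt 3 *\<^sub>R ?e1" ?one] by metis
  have Ai: "A x \<bullet> A y = x \<bullet> y" for x y using A(1) by (simp add: orthogonal_transformation_def)
  have sum: "A x $ 1 + A x $ 2 + A x $ 3 = sqrt 3 * x $ 1" for x
  proof -
    have "A x $ 1 + A x $ 2 + A x $ 3 = A x \<bullet> ?one" by (simp add: inner_vec_def sum_3)
    also have "\<dots> = x \<bullet> (sqrt 3 *\<^sub>R ?e1)" unfolding A(2)[symmetric] by (rule Ai)
    finally show ?thesis by (simp add: inner_axis)
  qed
  define H where "H t = h (sqrt t *\<^sub>R ?e1)" for t
  have hH: "h (A x) = H (x \<bullet> x)" for x
    unfolding H_def by (rule S0_radial[OF h]) (simp add: orthogonal_transformation_norm[OF A(1)] norm_eq_sqrt_inner[of x])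
  define f where "f p = cnj (H (snd p)) * (psi_norm \<theta> * exp (- complex_of_real (snd p) / 2)) *
     (exp (a * complex_of_real (fst p)) - sinhc (a\<^sup>2 * complex_of_real (snd p)))" for p
  have "continuous_on UNIV (\<lambda>p::real \<times> real. H (snd p))"
    unfolding H_def by (rule continuous_on_compose2[OF smooth3_continuous[OF sm, of UNIV]]) (intro continuous_intros | simp)+
  moreover have "continuous_on UNIV (\<lambda>p::real \<times> real. sinhc (a\<^sup>2 * complex_of_real (snd p)))"
    by (rule continuous_on_compose2[OF holomorphic_on_imp_continuous_on[OF sinhc_holomorphic]]) (intro continuous_intros | simp)+
  ultimately have "continuous_on UNIV f"
    unfolding f_def[abs_def] by (intro continuous_intros) auto
  then have fm: "f \<in> borel_measurable borel" by (rule borel_measurable_continuous_onI)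
  have s6: "complex_of_real (sqrt 2) * \<theta> * complex_of_real (sqrt 3 * t) = a * complex_of_real t" for t
  proof -
    have "sqrt 2 * sqrt 3 = sqrt (6::real)" by (simp add: real_sqrt_mult[symmetric])
    then have "complex_of_real (sqrt 2) * complex_of_real (sqrt 3) = complex_of_real (sqrt 6)" by (simp only: of_real_mult[symmetric])
    then show ?thesis unfolding a_def by (simp add: mult_ac)
  qed
  have feq: "cnj (h (A x)) * (psi \<theta> - radial_part \<theta>) (A x) = f (x$1, x \<bullet> x)" for x
    unfolding hH fun_diff_def psi_eq radial_part_def Ai sum s6 f_def a_def[symmetric] by (simp add: right_diff_distrib mult.assoc)
  have int: "integrable lborel (\<lambda>x. cnj (h x) * (psi \<theta> - radial_part \<theta>) x)"
    by (rule sqint_integrable_mult[OF sq sqint_diff[OF sqint_psi sg]])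
  then have m: "(\<lambda>x. cnj (h x) * (psi \<theta> - radial_part \<theta>) x) \<in> borel_measurable borel"
    using borel_measurable_integrable[OF int] by simp
  have "integrable lborel (\<lambda>x::real^3. f (x$1, x \<bullet> x))"
    using int integral_orthogonal(2)[OF A(1) m] by (simp only: feq)
  then have ifi: "integrable lborel (\<lambda>p. (pi * indicator {p. (fst p)\<^sup>2 \<le> snd p} p) *\<^sub>R f p)"
    using integral_cylinder(2)[OF fm] by simp
  have "l2inner h (psi \<theta> - radial_part \<theta>) = (\<integral>x. f (x$1, x \<bullet> x) \<partial>(lborel :: (real^3) measure))"
    unfolding l2inner_def using integral_orthogonal(1)[OF A(1) m] by (simp only: feq)
  also have "\<dots> = (\<integral>p. (pi * indicator {p. (fst p)\<^sup>2 \<le> snd p} p) *\<^sub>R f p \<partial>lborel)"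
    by (rule integral_cylinder(1)[OF fm])
  also have "\<dots> = (\<integral>t. (\<integral>u. (pi * indicator {p. (fst p)\<^sup>2 \<le> snd p} (u, t)) *\<^sub>R f (u, t) \<partial>lborel) \<partial>lborel)"
    using lborel_pair.integral_snd[of "\<lambda>u t. (pi * indicator {p. (fst p)\<^sup>2 \<le> snd p} (u, t)) *\<^sub>R f (u, t)"] ifi
    by (simp add: lborel_prod split_beta')
  also have "\<dots> = 0"
  proof -
    have "(\<integral>u. (pi * indicator {p. (fst p)\<^sup>2 \<le> snd p} (u, t)) *\<^sub>R f (u, t) \<partial>lborel) = 0" for t :: real
    proof -
      have "(\<integral>u. (pi * indicator {p. (fst p)\<^sup>2 \<le> snd p} (u, t)) *\<^sub>R f (u, t) \<partial>lborel)
         = (\<integral>u. (complex_of_real pi * (cnj (H t) * (psi_norm \<theta> * exp (- complex_of_real t / 2)))) *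
            (indicator {u. u\<^sup>2 \<le> t} u *\<^sub>R (exp (a * complex_of_real u) - sinhc (a\<^sup>2 * complex_of_real t))) \<partial>lborel)"
        by (intro Bochner_Integration.integral_cong refl) (simp add: f_def indicator_def scaleR_conv_of_real mult.assoc)
      also have "\<dots> = 0" by (simp only: Bochner_Integration.integral_mult_right_zero sinhc_interval_mean[OF a0] mult_zero_right)
      finally show ?thesis .
    qed
    then show ?thesis by simp
  qed
  finally show ?thesis .
qed

lemma beta_inv_formula:
  assumes "\<theta> \<noteq> 0"
  shows "beta_inv \<alpha> \<theta> = (1 - \<alpha>) * ((1 - exp (- 6 * (cmod \<theta>)\<^sup>2)) / (6 * (cmod \<theta>)\<^sup>2))"
  using beta_inv_eq[OF sqint_psi radial_part_in_S0[OF assms] radial_part_orthogonal[OF _ assms]] radial_part_norm[OF assms]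
  by (simp add: has_bochner_integral_iff)

section \<open>The Gaussian measure of the acceptance region\<close>

text \<open>The condition |cos| >= \<alpha> on the angle between n = a x b and u, squared and
  cleared of denominators. In this polynomial form the set is closed, and the degenerate case n = 0
  belongs to it.\<close>

definition cone_set :: "real \<Rightarrow> real^3 \<Rightarrow> ((real^3) \<times> (real^3)) set" where
  "cone_set \<alpha> u = {p. \<alpha>\<^sup>2 * (norm (cross3 (fst p) (snd p)))\<^sup>2 * (norm u)\<^sup>2 \<le> (cross3 (fst p) (snd p) \<bullet> u)\<^sup>2}"

definition gauss3 :: "real^3 \<Rightarrow> ennreal" where
  "gauss3 x = ennreal (exp (- (norm x)\<^sup>2))"

definition gauss6 :: "(real^3) \<times> (real^3) \<Rightarrow> ennreal" where
  "gauss6 p = gauss3 (fst p) * gauss3 (snd p)"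

lemma gauss3_measurable: "gauss3 \<in> borel_measurable borel"
  unfolding gauss3_def[abs_def]
  by (intro measurable_compose[OF _ measurable_ennreal] borel_measurable_continuous_onI continuous_intros)

lemma gauss6_measurable: "gauss6 \<in> borel_measurable borel"
proof -
  have "(fst :: (real^3) \<times> (real^3) \<Rightarrow> _) \<in> borel \<rightarrow>\<^sub>M borel" "(snd :: (real^3) \<times> (real^3) \<Rightarrow> _) \<in> borel \<rightarrow>\<^sub>M borel"
    by (auto intro!: borel_measurable_continuous_onI continuous_intros)
  then show ?thesis unfolding gauss6_def[abs_def]
    by (intro borel_measurable_times_ennreal measurable_compose[OF _ gauss3_measurable])
qed

lemma nn_integral_lborel_pair:
  fixes F :: "'a::euclidean_space \<times> 'b::euclidean_space \<Rightarrow> ennreal"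
  assumes "F \<in> borel_measurable borel"
  shows "(\<integral>\<^sup>+p. F p \<partial>lborel) = (\<integral>\<^sup>+a. (\<integral>\<^sup>+b. F (a, b) \<partial>lborel) \<partial>lborel)"
proof -
  have "(\<integral>\<^sup>+a. (\<integral>\<^sup>+b. F (a, b) \<partial>lborel) \<partial>lborel) = (\<integral>\<^sup>+p. F p \<partial>(lborel \<Otimes>\<^sub>M lborel))"
    by (rule lborel.nn_integral_fst) (use assms in \<open>simp add: lborel_prod\<close>)
  then show ?thesis by (simp add: lborel_prod)
qed

lemma nn_integral_lborel_swap:
  fixes F :: "'a::euclidean_space \<times> 'b::euclidean_space \<Rightarrow> ennreal"
  assumes "F \<in> borel_measurable borel"
  shows "(\<integral>\<^sup>+a. (\<integral>\<^sup>+b. F (a, b) \<partial>lborel) \<partial>lborel) = (\<integral>\<^sup>+b. (\<integral>\<^sup>+a. F (a, b) \<partial>lborel) \<partial>lborel)"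
proof -
  have "case_prod (\<lambda>a b. F (a, b)) \<in> borel_measurable (lborel \<Otimes>\<^sub>M lborel)" using assms by (simp add: lborel_prod)
  from lborel_pair.Fubini'[OF this] show ?thesis by simp
qed

lemma measurable_Pair_const:
  fixes F :: "'a::euclidean_space \<times> 'b::euclidean_space \<Rightarrow> ennreal"
  assumes "F \<in> borel_measurable borel"
  shows "(\<lambda>b. F (a, b)) \<in> borel_measurable borel" "(\<lambda>a. F (a, b)) \<in> borel_measurable borel"
  by (rule measurable_compose[OF borel_measurable_continuous_onI assms], intro continuous_intros)+

text \<open>The two factors may be transformed independently: equal maps give rotation invariance,
  and a reflection in one factor only gives the sign symmetries.\<close>

lemma nn_integral_pair_orthogonal:
  fixes A B :: "real^3 \<Rightarrow> real^3"
  assumes A: "orthogonal_transformation A" and B: "orthogonal_transformation B" and F: "F \<in> borel_measurable borel"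
  shows "(\<integral>\<^sup>+p. F (A (fst p), B (snd p)) \<partial>lborel) = (\<integral>\<^sup>+p. F p \<partial>lborel)"
proof -
  have cA: "continuous_on UNIV A" "continuous_on UNIV B"
    using A B by (auto simp: linear_continuous_on linear_linear orthogonal_transformation_linear)
  have "continuous_on UNIV (\<lambda>p. (A (fst p), B (snd p)))"
    by (intro continuous_on_Pair continuous_on_compose2[OF cA(1)] continuous_on_compose2[OF cA(2)] continuous_on_fst continuous_on_snd continuous_on_id) auto
  then have m: "(\<lambda>p. F (A (fst p), B (snd p))) \<in> borel_measurable borel"
    by (rule measurable_compose[OF borel_measurable_continuous_onI F])
  have "(\<integral>\<^sup>+p. F (A (fst p), B (snd p)) \<partial>lborel) = (\<integral>\<^sup>+a. (\<integral>\<^sup>+b. F (A a, B b) \<partial>lborel) \<partial>lborel)"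
    using nn_integral_lborel_pair[OF m] by simp
  also have "\<dots> = (\<integral>\<^sup>+a. (\<integral>\<^sup>+b. F (A a, b) \<partial>lborel) \<partial>lborel)"
    by (intro nn_integral_cong nn_integral_orthogonal[OF B] measurable_Pair_const[OF F])
  also have "\<dots> = (\<integral>\<^sup>+a. (\<integral>\<^sup>+b. F (a, b) \<partial>lborel) \<partial>lborel)"
  proof (rule nn_integral_orthogonal[OF A])
    have "(\<lambda>a. \<integral>\<^sup>+b. F (a, b) \<partial>lborel) \<in> borel_measurable lborel"
      by (rule lborel.borel_measurable_nn_integral_fst) (use F in \<open>simp add: lborel_prod\<close>)
    then show "(\<lambda>a. \<integral>\<^sup>+b. F (a, b) \<partial>lborel) \<in> borel_measurable borel" by simp
  qed
  finally show ?thesis using nn_integral_lborel_pair[OF F] by simp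
qed

lemma nn_integral_gauss3: "(\<integral>\<^sup>+x. gauss3 x \<partial>lborel) = ennreal (sqrt pi ^ 3)"
proof -
  have "has_bochner_integral lborel (\<lambda>x::real^3. complex_of_real (exp (- (norm x)\<^sup>2))) (complex_of_real (sqrt pi ^ 3))"
  proof -
    have g: "has_bochner_integral lborel (\<lambda>x. exp (- (complex_of_real x)\<^sup>2)) (complex_of_real (sqrt pi))"
      using has_bochner_integral_gauss[of 0] by simp
    have "exp (- (complex_of_real (x$1))\<^sup>2) * exp (- (complex_of_real (x$2))\<^sup>2) * exp (- (complex_of_real (x$3))\<^sup>2)
        = complex_of_real (exp (- (norm x)\<^sup>2))" for x :: "real^3"
    proof -
      have "(norm x)\<^sup>2 = (x$1)\<^sup>2 + (x$2)\<^sup>2 + (x$3)\<^sup>2"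
        unfolding power2_norm_eq_inner by (simp add: inner_vec_def sum_3 power2_eq_square)
      then have "complex_of_real (exp (- (norm x)\<^sup>2)) = exp (- (complex_of_real (x$1))\<^sup>2 + - (complex_of_real (x$2))\<^sup>2 + - (complex_of_real (x$3))\<^sup>2)"
        by (simp add: exp_of_real[symmetric])
      then show ?thesis by (simp only: exp_add)
    qed
    moreover have "complex_of_real (sqrt pi) * complex_of_real (sqrt pi) * complex_of_real (sqrt pi) = complex_of_real (sqrt pi ^ 3)"
      by (simp only: power3_eq_cube of_real_mult)
    ultimately show ?thesis using has_bochner_integral_prod3[OF g g g] by (simp only:)
  qed
  then have "has_bochner_integral lborel (\<lambda>x::real^3. Re (complex_of_real (exp (- (norm x)\<^sup>2)))) (Re (complex_of_real (sqrt pi ^ 3)))"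
    by (rule has_bochner_integral_bounded_linear[OF bounded_linear_Re])
  then have "has_bochner_integral lborel (\<lambda>x::real^3. exp (- (norm x)\<^sup>2)) (sqrt pi ^ 3)" by simp
  then show ?thesis unfolding gauss3_def
    by (subst nn_integral_eq_integral) (auto simp: has_bochner_integral_iff)
qed

lemma nn_integral_gauss6: "(\<integral>\<^sup>+p. gauss6 p \<partial>lborel) = ennreal (pi ^ 3)"
proof -
  have "(\<integral>\<^sup>+p. gauss6 p \<partial>lborel) = (\<integral>\<^sup>+a. gauss3 a * (\<integral>\<^sup>+b. gauss3 b \<partial>lborel) \<partial>lborel)"
    unfolding nn_integral_lborel_pair[OF gauss6_measurable] using gauss3_measurable
    by (simp add: gauss6_def nn_integral_cmult)
  also have "\<dots> = ennreal (sqrt pi ^ 3) * ennreal (sqrt pi ^ 3)"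
    using gauss3_measurable by (simp add: nn_integral_multc nn_integral_gauss3)
  also have "\<dots> = ennreal (pi ^ 3)" by (simp add: ennreal_mult[symmetric] power_mult_distrib[symmetric])
  finally show ?thesis .
qed

text \<open>Joint closedness in direction and point supplies the measurability for exchanging
  integrals when the direction u is averaged.\<close>

lemma closed_cone_set_joint:
  "closed {q :: (real^3) \<times> ((real^3) \<times> (real^3)). snd q \<in> cone_set \<alpha> (fst q)}"
proof -
  have c: "continuous_on UNIV (\<lambda>q :: (real^3) \<times> ((real^3) \<times> (real^3)). cross3 (fst (snd q)) (snd (snd q)))"
    by (intro continuous_on_cross continuous_intros)
  show ?thesis unfolding cone_set_def mem_Collect_eq by (intro closed_Collect_le continuous_intros c)
qed

lemma cone_set_borel: "cone_set \<alpha> u \<in> sets borel"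
proof -
  have c: "continuous_on UNIV (\<lambda>q :: (real^3) \<times> (real^3). cross3 (fst q) (snd q))"
    by (intro continuous_on_cross continuous_intros)
  have "closed (cone_set \<alpha> u)" unfolding cone_set_def by (intro closed_Collect_le continuous_intros c)
  then show ?thesis by (rule borel_closed)
qed

text \<open>The cross product picks up the determinant, which is 1 or -1 and disappears under
  squares and norms.\<close>

lemma cross3_orthogonal:
  assumes A: "orthogonal_transformation A"
  shows "(cross3 (A a) (A b) \<bullet> A u)\<^sup>2 = (cross3 a b \<bullet> u)\<^sup>2" "norm (cross3 (A a) (A b)) = norm (cross3 a b)"
proof -
  have d: "det (matrix A) = 1 \<or> det (matrix A) = -1"
    using A orthogonal_transformation_matrix det_orthogonal_matrix by blast
  have c: "cross3 (A a) (A b) = det (matrix A) *\<^sub>R A (cross3 a b)" by (rule cross_orthogonal_transformation[OF A])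
  have i: "A x \<bullet> A y = x \<bullet> y" for x y using A by (simp add: orthogonal_transformation_def)
  show "(cross3 (A a) (A b) \<bullet> A u)\<^sup>2 = (cross3 a b \<bullet> u)\<^sup>2" using d unfolding c by (auto simp: i)
  show "norm (cross3 (A a) (A b)) = norm (cross3 a b)"
    using d unfolding c by (auto simp: orthogonal_transformation_norm[OF A])
qed

lemma cone_set_orthogonal:
  assumes A: "orthogonal_transformation A"
  shows "(A a, A b) \<in> cone_set \<alpha> (A u) \<longleftrightarrow> (a, b) \<in> cone_set \<alpha> u"
  by (simp add: cone_set_def cross3_orthogonal[OF A] orthogonal_transformation_norm[OF A])

lemma cone_set_scale:
  assumes "t \<noteq> 0"
  shows "cone_set \<alpha> (t *\<^sub>R u) = cone_set \<alpha> u"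
proof -
  have "(\<alpha>\<^sup>2 * N * (norm (t *\<^sub>R u))\<^sup>2 \<le> (n \<bullet> (t *\<^sub>R u))\<^sup>2) \<longleftrightarrow> (\<alpha>\<^sup>2 * N * (norm u)\<^sup>2 \<le> (n \<bullet> u)\<^sup>2)" for N and n :: "real^3"
  proof -
    have "(\<alpha>\<^sup>2 * N * (norm (t *\<^sub>R u))\<^sup>2 \<le> (n \<bullet> (t *\<^sub>R u))\<^sup>2) \<longleftrightarrow> (t\<^sup>2 * (\<alpha>\<^sup>2 * N * (norm u)\<^sup>2) \<le> t\<^sup>2 * (n \<bullet> u)\<^sup>2)"
      by (simp add: power_mult_distrib mult_ac)
    also have "\<dots> \<longleftrightarrow> (\<alpha>\<^sup>2 * N * (norm u)\<^sup>2 \<le> (n \<bullet> u)\<^sup>2)"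
      using assms by (intro mult_le_cancel_left_pos) simp
    finally show ?thesis .
  qed
  then show ?thesis unfolding cone_set_def by blast
qed

text \<open>Only the direction of u matters, by homogeneity, and an orthogonal map carrying one
  direction to another preserves both \<open>gauss6\<close> and Lebesgue measure.\<close>

lemma cone_measure_const:
  assumes "u \<noteq> 0"
  shows "(\<integral>\<^sup>+p. indicator (cone_set \<alpha> u) p * gauss6 p \<partial>lborel) = (\<integral>\<^sup>+p. indicator (cone_set \<alpha> (axis 1 1)) p * gauss6 p \<partial>lborel)"
proof -
  have "norm (axis 1 1 :: real^3) = norm (u /\<^sub>R norm u)" using assms by simp
  then obtain A :: "real^3 \<Rightarrow> real^3" where A: "orthogonal_transformation A" "A (axis 1 1) = u /\<^sub>R norm u"
    using orthogonal_transformation_exists[of "axis 1 1" "u /\<^sub>R norm u"] by metis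
  have m: "(\<lambda>p. indicator (cone_set \<alpha> (A (axis 1 1))) p * gauss6 p) \<in> borel_measurable borel"
    by (intro borel_measurable_times_ennreal gauss6_measurable borel_measurable_indicator cone_set_borel)
  have "cone_set \<alpha> u = cone_set \<alpha> (A (axis 1 1))" unfolding A(2) using assms by (intro cone_set_scale[symmetric]) simp
  then have "(\<integral>\<^sup>+p. indicator (cone_set \<alpha> u) p * gauss6 p \<partial>lborel)
     = (\<integral>\<^sup>+p. indicator (cone_set \<alpha> (A (axis 1 1))) (A (fst p), A (snd p)) * gauss6 (A (fst p), A (snd p)) \<partial>lborel)"
    using nn_integral_pair_orthogonal[OF A(1) A(1) m] by simp
  also have "\<dots> = (\<integral>\<^sup>+p. indicator (cone_set \<alpha> (axis 1 1)) p * gauss6 p \<partial>lborel)"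
  proof (rule nn_integral_cong)
    fix p :: "(real^3) \<times> (real^3)"
    have "indicator (cone_set \<alpha> (A (axis 1 1))) (A (fst p), A (snd p)) = (indicator (cone_set \<alpha> (axis 1 1)) p :: ennreal)"
      using cone_set_orthogonal[OF A(1), of "fst p" "snd p" \<alpha> "axis 1 1"] by (simp add: indicator_def)
    moreover have "gauss6 (A (fst p), A (snd p)) = gauss6 p"
      by (simp add: gauss6_def gauss3_def orthogonal_transformation_norm[OF A(1)])
    ultimately show "indicator (cone_set \<alpha> (A (axis 1 1))) (A (fst p), A (snd p)) * gauss6 (A (fst p), A (snd p))
      = indicator (cone_set \<alpha> (axis 1 1)) p * gauss6 p" by simp
  qed
  finally show ?thesis .
qed

text \<open>The set is [-r, r] without the open middle part of half-length \<alpha> r, a fraction 1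
  - \<alpha> of the interval; by the hat-box theorem this is the area fraction of two opposite
  spherical caps.\<close>

lemma emeasure_annulus:
  assumes "0 \<le> \<alpha>" "\<alpha> < 1" "r \<ge> 0"
  shows "emeasure lborel {u::real. (\<alpha> * r)\<^sup>2 \<le> u\<^sup>2 \<and> u\<^sup>2 \<le> r\<^sup>2} = ennreal (1 - \<alpha>) * ennreal (2 * r)"
proof -
  have ar: "0 \<le> \<alpha> * r" "\<alpha> * r \<le> r" using assms by (auto simp: mult_left_le_one_le)
  have eq: "{u::real. (\<alpha> * r)\<^sup>2 \<le> u\<^sup>2 \<and> u\<^sup>2 \<le> r\<^sup>2} = {-r..r} - {-(\<alpha> * r)<..<\<alpha> * r}"
  proof -
    have "(\<alpha> * r)\<^sup>2 \<le> u\<^sup>2 \<longleftrightarrow> \<alpha> * r \<le> \<bar>u\<bar>" "u\<^sup>2 \<le> r\<^sup>2 \<longleftrightarrow> \<bar>u\<bar> \<le> r" for u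
      using abs_le_square_iff[of "\<alpha> * r" u] abs_le_square_iff[of u r] ar assms(3) by auto
    then show ?thesis by auto
  qed
  have "emeasure lborel ({-r..r} - {-(\<alpha> * r)<..<\<alpha> * r}) = emeasure lborel {-r..r} - emeasure lborel {-(\<alpha> * r)<..<\<alpha> * r}"
    by (rule emeasure_Diff) (use ar in auto)
  also have "\<dots> = ennreal (2 * r) - ennreal (2 * (\<alpha> * r))" using ar assms(3) by simp
  also have "\<dots> = ennreal (2 * r - 2 * (\<alpha> * r))" using ar by (intro ennreal_minus) simp
  also have "2 * r - 2 * (\<alpha> * r) = (1 - \<alpha>) * (2 * r)" by (simp add: algebra_simps)
  also have "ennreal ((1 - \<alpha>) * (2 * r)) = ennreal (1 - \<alpha>) * ennreal (2 * r)" using assms by (intro ennreal_mult) auto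
  finally show ?thesis unfolding eq .
qed

text \<open>Every fibre t contributes the same fraction 1 - \<alpha>, which is pulled out. The
  remaining integral does not involve \<alpha> and is left unevaluated.\<close>

lemma cone_axis_gauss:
  assumes "0 \<le> \<alpha>" "\<alpha> < 1"
  shows "(\<integral>\<^sup>+x. indicator {x. \<alpha>\<^sup>2 * (norm x)\<^sup>2 \<le> (x$1)\<^sup>2} x * gauss3 x \<partial>lborel)
    = ennreal (1 - \<alpha>) * (\<integral>\<^sup>+t. ennreal pi * ennreal (exp (- t)) * (indicator {0..} t * ennreal (2 * sqrt t)) \<partial>lborel)"
proof -
  define F :: "real \<times> real \<Rightarrow> ennreal" where "F p = indicator {p. \<alpha>\<^sup>2 * snd p \<le> (fst p)\<^sup>2} p * ennreal (exp (- snd p))" for p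
  have S: "{p::real \<times> real. \<alpha>\<^sup>2 * snd p \<le> (fst p)\<^sup>2} \<in> sets borel" "{p::real \<times> real. (fst p)\<^sup>2 \<le> snd p} \<in> sets borel"
    by (intro borel_closed closed_Collect_le continuous_intros)+
  have "(\<lambda>p::real \<times> real. ennreal (exp (- snd p))) \<in> borel_measurable borel"
    by (intro measurable_compose[OF _ measurable_ennreal] borel_measurable_continuous_onI continuous_intros)
  then have Fm: "F \<in> borel_measurable borel" unfolding F_def[abs_def]
    by (intro borel_measurable_times_ennreal borel_measurable_indicator S)
  let ?G = "\<lambda>p. ennreal pi * indicator {p. (fst p)\<^sup>2 \<le> snd p} p * F p"
  have Gm: "?G \<in> borel_measurable borel"
    by (intro borel_measurable_times_ennreal borel_measurable_indicator S Fm borel_measurable_const)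
  have "(\<integral>\<^sup>+x. indicator {x. \<alpha>\<^sup>2 * (norm x)\<^sup>2 \<le> (x$1)\<^sup>2} x * gauss3 x \<partial>lborel) = (\<integral>\<^sup>+x. F (x$1, x \<bullet> x) \<partial>(lborel :: (real^3) measure))"
    by (intro nn_integral_cong) (simp add: F_def gauss3_def indicator_def power2_norm_eq_inner)
  also have "\<dots> = (\<integral>\<^sup>+p. ?G p \<partial>lborel)" by (rule nn_integral_cylinder[OF Fm])
  also have "\<dots> = (\<integral>\<^sup>+t. (\<integral>\<^sup>+u. ?G (u, t) \<partial>lborel) \<partial>lborel)"
    unfolding nn_integral_lborel_pair[OF Gm] by (rule nn_integral_lborel_swap[OF Gm])
  also have "\<dots> = (\<integral>\<^sup>+t. ennreal (1 - \<alpha>) * (ennreal pi * ennreal (exp (- t)) * (indicator {0..} t * ennreal (2 * sqrt t))) \<partial>lborel)"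
  proof (rule nn_integral_cong)
    fix t :: real
    have "(\<integral>\<^sup>+u. ?G (u, t) \<partial>lborel) = (\<integral>\<^sup>+u. (ennreal pi * ennreal (exp (- t))) * indicator {u. \<alpha>\<^sup>2 * t \<le> u\<^sup>2 \<and> u\<^sup>2 \<le> t} u \<partial>lborel)"
      by (intro nn_integral_cong) (auto simp: F_def indicator_def)
    also have "\<dots> = (ennreal pi * ennreal (exp (- t))) * emeasure lborel {u. \<alpha>\<^sup>2 * t \<le> u\<^sup>2 \<and> u\<^sup>2 \<le> t}"
    proof (rule nn_integral_cmult_indicator)
      have "closed {u::real. \<alpha>\<^sup>2 * t \<le> u\<^sup>2 \<and> u\<^sup>2 \<le> t}"
        by (intro closed_Collect_conj closed_Collect_le continuous_intros)
      then show "{u::real. \<alpha>\<^sup>2 * t \<le> u\<^sup>2 \<and> u\<^sup>2 \<le> t} \<in> sets lborel" by simp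
    qed
    also have "emeasure lborel {u. \<alpha>\<^sup>2 * t \<le> u\<^sup>2 \<and> u\<^sup>2 \<le> t} = ennreal (1 - \<alpha>) * (indicator {0..} t * ennreal (2 * sqrt t))"
    proof (cases "t \<ge> 0")
      case True
      then show ?thesis using emeasure_annulus[OF assms, of "sqrt t"] by (simp add: power_mult_distrib)
    next
      case False
      have "\<not> u\<^sup>2 \<le> t" for u :: real using False zero_le_power2[of u] by linarith
      then show ?thesis using False by simp
    qed
    finally show "(\<integral>\<^sup>+u. ?G (u, t) \<partial>lborel) = ennreal (1 - \<alpha>) * (ennreal pi * ennreal (exp (- t)) * (indicator {0..} t * ennreal (2 * sqrt t)))"
      by (simp only: mult_ac)
  qed
  also have "\<dots> = ennreal (1 - \<alpha>) * (\<integral>\<^sup>+t. ennreal pi * ennreal (exp (- t)) * (indicator {0..} t * ennreal (2 * sqrt t)) \<partial>lborel)"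
  proof (rule nn_integral_cmult)
    have "(\<lambda>t. ennreal (exp (- t))) \<in> borel_measurable borel" "(\<lambda>t. ennreal (2 * sqrt t)) \<in> borel_measurable borel"
      by (intro measurable_compose[OF _ measurable_ennreal] borel_measurable_continuous_onI continuous_intros)+
    then have "(\<lambda>t. ennreal pi * ennreal (exp (- t)) * (indicator {0..} t * ennreal (2 * sqrt t))) \<in> borel_measurable borel"
      by (intro borel_measurable_times_ennreal borel_measurable_indicator borel_measurable_const) simp_all
    then show "(\<lambda>t. ennreal pi * ennreal (exp (- t)) * (indicator {0..} t * ennreal (2 * sqrt t))) \<in> borel_measurable lborel" by simp
  qed
  finally show ?thesis .
qed

lemma cone_direction_gauss:
  fixes n :: "real^3"
  assumes \<alpha>: "0 \<le> \<alpha>" "\<alpha> < 1" and n: "n \<noteq> 0"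
  shows "(\<integral>\<^sup>+u. indicator {u. \<alpha>\<^sup>2 * (norm n)\<^sup>2 * (norm u)\<^sup>2 \<le> (n \<bullet> u)\<^sup>2} u * gauss3 u \<partial>lborel) = ennreal (1 - \<alpha>) * ennreal (sqrt pi ^ 3)"
proof -
  have "norm (norm n *\<^sub>R axis 1 1 :: real^3) = norm n" by simp
  then obtain A :: "real^3 \<Rightarrow> real^3" where A: "orthogonal_transformation A" "A (norm n *\<^sub>R axis 1 1) = n"
    using orthogonal_transformation_exists[of "norm n *\<^sub>R axis 1 1" n] by metis
  let ?S = "{u. \<alpha>\<^sup>2 * (norm n)\<^sup>2 * (norm u)\<^sup>2 \<le> (n \<bullet> u)\<^sup>2}"
  have "?S \<in> sets borel" by (intro borel_closed closed_Collect_le continuous_intros)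
  then have m: "(\<lambda>u. indicator ?S u * gauss3 u) \<in> borel_measurable borel"
    by (intro borel_measurable_times_ennreal gauss3_measurable borel_measurable_indicator)
  have nA: "n \<bullet> A u = norm n * u$1" for u
  proof -
    have "n \<bullet> A u = A (norm n *\<^sub>R axis 1 1) \<bullet> A u" by (simp only: A(2))
    also have "\<dots> = (norm n *\<^sub>R axis 1 1) \<bullet> u" using A(1) by (simp add: orthogonal_transformation_def)
    finally show ?thesis by (simp add: inner_axis inner_commute)
  qed
  have "A u \<in> ?S \<longleftrightarrow> u \<in> {x. \<alpha>\<^sup>2 * (norm x)\<^sup>2 \<le> (x$1)\<^sup>2}" for u
  proof -
    have "A u \<in> ?S \<longleftrightarrow> (norm n)\<^sup>2 * (\<alpha>\<^sup>2 * (norm u)\<^sup>2) \<le> (norm n)\<^sup>2 * (u$1)\<^sup>2"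
      by (simp add: nA orthogonal_transformation_norm[OF A(1)] power_mult_distrib mult_ac)
    also have "\<dots> \<longleftrightarrow> \<alpha>\<^sup>2 * (norm u)\<^sup>2 \<le> (u$1)\<^sup>2" using n by (intro mult_le_cancel_left_pos) simp
    finally show ?thesis by simp
  qed
  then have "(\<integral>\<^sup>+u. indicator ?S u * gauss3 u \<partial>lborel) = (\<integral>\<^sup>+x. indicator {x. \<alpha>\<^sup>2 * (norm x)\<^sup>2 \<le> (x$1)\<^sup>2} x * gauss3 x \<partial>lborel)"
    unfolding nn_integral_orthogonal[OF A(1) m, symmetric]
    by (intro nn_integral_cong) (simp add: indicator_def gauss3_def orthogonal_transformation_norm[OF A(1)])
  also have "\<dots> = ennreal (1 - \<alpha>) * ennreal (sqrt pi ^ 3)"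
  proof -
    \<comment> \<open>At \<alpha> = 0 the cone is all of space, which identifies the unevaluated
      integral with the total Gaussian mass.\<close>
    have "(\<integral>\<^sup>+x. gauss3 x \<partial>lborel) = (\<integral>\<^sup>+x. indicator {x. 0\<^sup>2 * (norm x)\<^sup>2 \<le> (x$1)\<^sup>2} x * gauss3 x \<partial>lborel)" by simp
    then have "(\<integral>\<^sup>+t. ennreal pi * ennreal (exp (- t)) * (indicator {0..} t * ennreal (2 * sqrt t)) \<partial>lborel) = ennreal (sqrt pi ^ 3)"
      using cone_axis_gauss[of 0] nn_integral_gauss3 by simp
    then show ?thesis by (simp only: cone_axis_gauss[OF \<alpha>])
  qed
  finally show ?thesis .
qed

section \<open>Degenerate configurations form null sets\<close>

lemma AE_lborel_pair:
  fixes P :: "'a::euclidean_space \<times> 'b::euclidean_space \<Rightarrow> bool"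
  assumes S: "{p. P p} \<in> sets borel" and AE: "AE a in lborel. AE b in lborel. P (a, b)"
  shows "AE p in lborel. P p"
proof -
  have "{p. P p} \<in> sets (lborel \<Otimes>\<^sub>M lborel)" unfolding lborel_prod using S by simp
  then show ?thesis unfolding lborel_prod[symmetric]
    by (intro lborel_pair.AE_pair_measure AE) (simp add: space_pair_measure)
qed

lemma AE_inner_neq_0:
  fixes v :: "'a::euclidean_space"
  assumes "v \<noteq> 0"
  shows "AE x in lborel. v \<bullet> x \<noteq> 0"
proof -
  have "negligible {x. v \<bullet> x = 0}" by (rule negligible_hyperplane) (use assms in simp)
  moreover have "{x. v \<bullet> x = 0} \<in> sets borel" by (intro borel_closed closed_Collect_eq continuous_intros)
  ultimately have "{x. v \<bullet> x = 0} \<in> null_sets lborel"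
    by (simp add: negligible_iff_null_sets null_sets_def emeasure_completion)
  then show ?thesis using AE_not_in by fastforce
qed

text \<open>For fixed a the triple product is linear in b with coefficient vector u x a, which is
  nonzero for almost every a; then the exceptional b form a hyperplane.\<close>

lemma AE_cross3_inner_neq_0:
  assumes u: "u \<noteq> 0"
  shows "AE p in lborel. cross3 (fst p) (snd p) \<bullet> u \<noteq> 0"
proof (rule AE_lborel_pair)
  have c: "continuous_on UNIV (\<lambda>q :: (real^3) \<times> (real^3). cross3 (fst q) (snd q))"
    by (intro continuous_on_cross continuous_intros)
  have "open {p :: (real^3) \<times> (real^3). cross3 (fst p) (snd p) \<bullet> u \<noteq> 0}"
    by (intro open_Collect_neq continuous_intros c)
  then show "{p :: (real^3) \<times> (real^3). cross3 (fst p) (snd p) \<bullet> u \<noteq> 0} \<in> sets borel" by (rule borel_open)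
  \<comment> \<open>A witness v not parallel to u: if (v x u) . a is nonzero then u x a is nonzero,
    so it is enough that a avoids the hyperplane orthogonal to v x u.\<close>
  obtain v :: "real^3" where v: "cross3 v u \<noteq> 0"
  proof -
    have "cross3 u (axis i 1) = 0 \<Longrightarrow> cross3 (axis i 1) u = 0" for i by (simp add: cross_skew[of "axis i 1" u])
    moreover have "cross3 (axis i 1) u = 0 \<Longrightarrow> cross3 u (axis i 1) = 0" for i by (simp add: cross_skew[of u "axis i 1"])
    ultimately show ?thesis using cross_basis_nonzero[OF u] that by blast
  qed
  have ae: "AE a in lborel. cross3 v u \<bullet> a \<noteq> 0" by (rule AE_inner_neq_0[OF v])
  show "AE a in lborel. AE b in lborel. cross3 (fst (a, b)) (snd (a, b)) \<bullet> u \<noteq> 0"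
  proof (rule AE_mp[OF ae], rule AE_I2, rule impI)
    fix a assume "cross3 v u \<bullet> a \<noteq> 0"
    then have "cross3 u a \<bullet> v \<noteq> 0" by (simp add: cross_triple[of v u a])
    then have "cross3 u a \<noteq> 0" by auto
    from AE_inner_neq_0[OF this] show "AE b in lborel. cross3 (fst (a, b)) (snd (a, b)) \<bullet> u \<noteq> 0"
      by (simp add: cross_triple[of u a])
  qed
qed

text \<open>By rotation invariance the measure does not depend on the direction u, so u may be averaged
  over a Gaussian; for a fixed normal vector the average is a ratio of spherical caps.\<close>

lemma cone_set_gauss:
  assumes \<alpha>: "0 \<le> \<alpha>" "\<alpha> < 1" and u: "u \<noteq> 0"
  shows "(\<integral>\<^sup>+p. indicator (cone_set \<alpha> u) p * gauss6 p \<partial>lborel) = ennreal ((1 - \<alpha>) * pi ^ 3)"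
proof -
  define P where "P = (\<integral>\<^sup>+p. indicator (cone_set \<alpha> (axis 1 1)) p * gauss6 p \<partial>lborel)"
  let ?S = "{q :: (real^3) \<times> ((real^3) \<times> (real^3)). snd q \<in> cone_set \<alpha> (fst q)}"
  let ?F = "\<lambda>q. indicator ?S q * gauss3 (fst q) * gauss6 (snd q)"
  have "(\<lambda>q::(real^3) \<times> ((real^3) \<times> (real^3)). gauss3 (fst q)) \<in> borel_measurable borel"
    "(\<lambda>q::(real^3) \<times> ((real^3) \<times> (real^3)). gauss6 (snd q)) \<in> borel_measurable borel"
    by (rule measurable_compose[OF _ gauss3_measurable] measurable_compose[OF _ gauss6_measurable],
        intro borel_measurable_continuous_onI continuous_intros)+
  then have Fm: "?F \<in> borel_measurable borel"
    by (intro borel_measurable_times_ennreal borel_measurable_indicator borel_closed closed_cone_set_joint)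
  have mp: "(\<lambda>p. indicator (cone_set \<alpha> v) p * gauss6 p) \<in> borel_measurable lborel" for v
    using cone_set_borel gauss6_measurable by simp
  have "ennreal (sqrt pi ^ 3) * P = (\<integral>\<^sup>+v. gauss3 v * P \<partial>lborel)"
    using gauss3_measurable by (simp add: nn_integral_multc nn_integral_gauss3)
  also have "\<dots> = (\<integral>\<^sup>+v. (\<integral>\<^sup>+p. ?F (v, p) \<partial>lborel) \<partial>lborel)"
  proof (rule nn_integral_cong_AE)
    have ae: "AE v in (lborel :: (real^3) measure). v \<noteq> 0" by (rule AE_lborel_singleton)
    show "AE v in lborel. gauss3 v * P = (\<integral>\<^sup>+p. ?F (v, p) \<partial>lborel)"
    proof (rule AE_mp[OF ae], rule AE_I2, rule impI)
      fix v :: "real^3" assume v: "v \<noteq> 0"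
      have "(\<integral>\<^sup>+p. ?F (v, p) \<partial>lborel) = (\<integral>\<^sup>+p. gauss3 v * (indicator (cone_set \<alpha> v) p * gauss6 p) \<partial>lborel)"
        by (intro nn_integral_cong) (simp add: indicator_def)
      also have "\<dots> = gauss3 v * P" unfolding P_def cone_measure_const[OF v, symmetric] by (rule nn_integral_cmult[OF mp])
      finally show "gauss3 v * P = (\<integral>\<^sup>+p. ?F (v, p) \<partial>lborel)" by simp
    qed
  qed
  also have "\<dots> = (\<integral>\<^sup>+p. (\<integral>\<^sup>+v. ?F (v, p) \<partial>lborel) \<partial>lborel)" by (rule nn_integral_lborel_swap[OF Fm])
  also have "\<dots> = (\<integral>\<^sup>+p. (ennreal (1 - \<alpha>) * ennreal (sqrt pi ^ 3)) * gauss6 p \<partial>lborel)"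
  proof (rule nn_integral_cong_AE)
    show "AE p in lborel. (\<integral>\<^sup>+v. ?F (v, p) \<partial>lborel) = (ennreal (1 - \<alpha>) * ennreal (sqrt pi ^ 3)) * gauss6 p"
    proof (rule AE_mp[OF AE_cross3_inner_neq_0[OF u]], rule AE_I2, rule impI)
      fix p :: "(real^3) \<times> (real^3)" assume "cross3 (fst p) (snd p) \<bullet> u \<noteq> 0"
      then have n: "cross3 (fst p) (snd p) \<noteq> 0" by auto
      let ?T = "{u. \<alpha>\<^sup>2 * (norm (cross3 (fst p) (snd p)))\<^sup>2 * (norm u)\<^sup>2 \<le> (cross3 (fst p) (snd p) \<bullet> u)\<^sup>2}"
      have "?T \<in> sets borel" by (intro borel_closed closed_Collect_le continuous_intros)
      then have mT: "(\<lambda>v. indicator ?T v * gauss3 v) \<in> borel_measurable lborel" using gauss3_measurable by simp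
      have "(\<integral>\<^sup>+v. ?F (v, p) \<partial>lborel) = (\<integral>\<^sup>+v. (indicator ?T v * gauss3 v) * gauss6 p \<partial>lborel)"
        by (intro nn_integral_cong) (simp add: indicator_def cone_set_def)
      also have "\<dots> = (\<integral>\<^sup>+v. indicator ?T v * gauss3 v \<partial>lborel) * gauss6 p" by (rule nn_integral_multc[OF mT])
      finally show "(\<integral>\<^sup>+v. ?F (v, p) \<partial>lborel) = (ennreal (1 - \<alpha>) * ennreal (sqrt pi ^ 3)) * gauss6 p"
        by (simp only: cone_direction_gauss[OF \<alpha> n])
    qed
  qed
  also have "\<dots> = (ennreal (1 - \<alpha>) * ennreal (sqrt pi ^ 3)) * ennreal (pi ^ 3)"
    using gauss6_measurable by (simp add: nn_integral_cmult nn_integral_gauss6)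
  finally have e: "ennreal (sqrt pi ^ 3) * P = ennreal (sqrt pi ^ 3) * ennreal ((1 - \<alpha>) * pi ^ 3)"
    using \<alpha> by (simp add: ennreal_mult mult_ac)
  have "ennreal (1 / sqrt pi ^ 3) * (ennreal (sqrt pi ^ 3) * x) = x" for x
    by (simp add: mult.assoc[symmetric] ennreal_mult[symmetric])
  then have "P = ennreal ((1 - \<alpha>) * pi ^ 3)" using e by metis
  then show ?thesis unfolding P_def using cone_measure_const[OF u] by simp
qed

section \<open>The heterodyne-Hotelling test\<close>

definition zmap :: "(real^3) \<times> (real^3) \<Rightarrow> complex^3" where
  "zmap p = (\<chi> j. Complex (fst p $ j) (snd p $ j))"

definition rvec :: "complex^3 \<Rightarrow> (real^3) \<times> (real^3)" where
  "rvec z = ((\<chi> j. Re (z$j)), (\<chi> j. Im (z$j)))"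

lemma zmap_rvec [simp]: "zmap (rvec z) = z"
  by (simp add: zmap_def rvec_def vec_eq_iff complex_eq_iff)

lemma continuous_zmap: "continuous_on S zmap"
  unfolding zmap_def[abs_def] Complex_eq by (intro continuous_on_vec_lambda continuous_intros)

lemma continuous_rvec: "continuous_on S rvec"
  unfolding rvec_def[abs_def] by (intro continuous_on_Pair continuous_on_vec_lambda continuous_intros)

lemma prod_Basis_real3: "(\<Prod>b\<in>Basis. (v::real^3) \<bullet> b) = (\<Prod>i\<in>UNIV. v $ i)"
proof -
  have B: "(Basis :: (real^3) set) = range (\<lambda>i. axis i 1)" by (auto simp: Basis_vec_def)
  have "inj (\<lambda>i::3. axis i (1::real))" by (auto simp: inj_on_def axis_eq_axis)
  then show ?thesis unfolding B by (simp add: prod.reindex inner_axis)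
qed

lemma prod_Basis_complex3: "(\<Prod>b\<in>Basis. (v::complex^3) \<bullet> b) = (\<Prod>i\<in>UNIV. Re (v $ i)) * (\<Prod>i\<in>UNIV. Im (v $ i))"
proof -
  have B: "(Basis :: (complex^3) set) = range (\<lambda>i. axis i 1) \<union> range (\<lambda>i. axis i \<i>)"
    by (auto simp: Basis_vec_def Basis_complex_def)
  have inj: "inj (\<lambda>i::3. axis i (1::complex))" "inj (\<lambda>i::3. axis i \<i>)" by (auto simp: inj_on_def axis_eq_axis)
  have "range (\<lambda>i::3. axis i (1::complex)) \<inter> range (\<lambda>i. axis i \<i>) = {}" by (auto simp: axis_eq_axis)
  then have "(\<Prod>b\<in>Basis. v \<bullet> b) = (\<Prod>b\<in>range (\<lambda>i. axis i 1). v \<bullet> b) * (\<Prod>b\<in>range (\<lambda>i. axis i \<i>). v \<bullet> b)"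
    unfolding B by (intro prod.union_disjoint) auto
  then show ?thesis using inj by (simp add: prod.reindex inner_axis inner_complex_def)
qed

lemma distr_zmap: "distr lborel borel zmap = lborel"
proof (rule lborel_eqI[symmetric])
  fix l u :: "complex^3" assume lu: "\<And>b. b \<in> Basis \<Longrightarrow> l \<bullet> b \<le> u \<bullet> b"
  have le: "Re (l$i) \<le> Re (u$i)" "Im (l$i) \<le> Im (u$i)" for i
    using lu[of "axis i 1"] lu[of "axis i \<i>"] by (simp_all add: inner_axis inner_complex_def Basis_complex_def)
  have mem: "z \<in> box l u \<longleftrightarrow> (\<forall>i. Re (l$i) < Re (z$i) \<and> Re (z$i) < Re (u$i) \<and> Im (l$i) < Im (z$i) \<and> Im (z$i) < Im (u$i))" for z
    by (auto simp: mem_box Basis_vec_def Basis_complex_def inner_axis inner_complex_def)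
  let ?B1 = "box (fst (rvec l)) (fst (rvec u))" and ?B2 = "box (snd (rvec l)) (snd (rvec u))"
  have pre: "zmap -` box l u = ?B1 \<times> ?B2"
    by (auto simp: mem mem_box_cart zmap_def rvec_def)
  have zm: "zmap \<in> lborel \<rightarrow>\<^sub>M borel" using borel_measurable_continuous_onI[OF continuous_zmap] by simp
  have "emeasure (distr lborel borel zmap) (box l u) = emeasure lborel (?B1 \<times> ?B2)"
    using zm pre by (simp add: emeasure_distr)
  also have "\<dots> = emeasure lborel ?B1 * emeasure lborel ?B2" by (rule emeasure_lborel_Times) auto
  also have "emeasure lborel ?B1 = ennreal (\<Prod>b\<in>Basis. (fst (rvec u) - fst (rvec l)) \<bullet> b)"
    by (rule emeasure_lborel_box) (use le in \<open>auto simp: Basis_vec_def inner_axis rvec_def\<close>)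
  also have "emeasure lborel ?B2 = ennreal (\<Prod>b\<in>Basis. (snd (rvec u) - snd (rvec l)) \<bullet> b)"
    by (rule emeasure_lborel_box) (use le in \<open>auto simp: Basis_vec_def inner_axis rvec_def\<close>)
  also have "ennreal (\<Prod>b\<in>Basis. (fst (rvec u) - fst (rvec l)) \<bullet> b) * ennreal (\<Prod>b\<in>Basis. (snd (rvec u) - snd (rvec l)) \<bullet> b)
     = ennreal ((\<Prod>b\<in>Basis. (fst (rvec u) - fst (rvec l)) \<bullet> b) * (\<Prod>b\<in>Basis. (snd (rvec u) - snd (rvec l)) \<bullet> b))"
    unfolding prod_Basis_real3 by (intro ennreal_mult[symmetric] prod_nonneg) (use le in \<open>auto simp: rvec_def\<close>)
  also have "(\<Prod>b\<in>Basis. (fst (rvec u) - fst (rvec l)) \<bullet> b) * (\<Prod>b\<in>Basis. (snd (rvec u) - snd (rvec l)) \<bullet> b) = (\<Prod>b\<in>Basis. (u - l) \<bullet> b)"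
    unfolding prod_Basis_real3 prod_Basis_complex3 by (simp add: rvec_def)
  finally show "emeasure (distr lborel borel zmap) (box l u) = (\<Prod>b\<in>Basis. (u - l) \<bullet> b)" .
qed simp

abbreviation ones :: "real^3" where "ones \<equiv> vec3 (1, 1, 1)"

lemma inner_ones: "x \<bullet> ones = x$1 + x$2 + x$3"
  by (simp only: inner_vec_def sum_3 vec3_nth fst_conv snd_conv inner_real_def mult_1_right)

lemma norm_ones: "(norm ones)\<^sup>2 = 3"
  unfolding power2_norm_eq_inner inner_ones vec3_nth by simp

lemma ones_neq_0: "ones \<noteq> 0"
proof
  assume "ones = 0"
  then have "(norm ones)\<^sup>2 = 0" by (simp only: norm_zero) simp
  then show False unfolding norm_ones by simp
qed

section \<open>Hotelling's statistic in terms of the normal vector\<close>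

lemma matrix_inv_2x2:
  fixes M :: "real^2^2" and x :: "real^2"
  assumes M: "M$1$1 = k" "M$1$2 = l" "M$2$1 = m" "M$2$2 = n" and d: "k * n - l * m \<noteq> 0"
  shows "x \<bullet> (matrix_inv M *v x) = (n * (x$1)\<^sup>2 - (l + m) * x$1 * x$2 + k * (x$2)\<^sup>2) / (k * n - l * m)"
proof -
  define e where "e = k * n - l * m"
  have e: "e \<noteq> 0" using d unfolding e_def .
  define B :: "real^2^2" where "B = (\<chi> i j. if i = 1 then (if j = 1 then n / e else - l / e) else (if j = 1 then - m / e else k / e))"
  have B: "B$1$1 = n / e" "B$1$2 = - l / e" "B$2$1 = - m / e" "B$2$2 = k / e"
    by (simp_all add: B_def)
  have one: "k * n / e - l * m / e = 1"
    using e by (simp add: e_def diff_divide_distrib[symmetric])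
  have "M ** B = mat 1"
    using one by (simp add: vec_eq_iff matrix_matrix_mult_def mat_def forall_2 sum_2 B M mult_ac)
  moreover have "B ** M = mat 1"
    using one by (simp add: vec_eq_iff matrix_matrix_mult_def mat_def forall_2 sum_2 B M mult_ac)
  ultimately have MB: "M ** B = mat 1" "B ** M = mat 1" by auto
  have inv: "matrix_inv M = B"
    unfolding matrix_inv_def
  proof (rule some_equality)
    fix C assume C: "M ** C = mat 1 \<and> C ** M = mat 1"
    have "C = (C ** M) ** B" using MB(1) by (simp add: matrix_mul_assoc[symmetric])
    then show "C = B" using C by simp
  qed (use MB in simp)
  have "x \<bullet> (matrix_inv M *v x) = x$1 * (n / e * x$1 + - l / e * x$2) + x$2 * (- m / e * x$1 + k / e * x$2)"
    unfolding inv by (simp add: inner_vec_def sum_2 matrix_vector_mult_def B)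
  also have "\<dots> = (n * (x$1)\<^sup>2 - (l + m) * x$1 * x$2 + k * (x$2)\<^sup>2) / e"
    using e by (simp add: power2_eq_square field_simps)
  finally show ?thesis unfolding e_def .
qed

lemma Xbar_zmap: "Xbar (zmap p) $ 1 = (fst p \<bullet> ones) / 3" "Xbar (zmap p) $ 2 = (snd p \<bullet> ones) / 3"
  by (simp_all add: Xbar_def Xv_def zmap_def inner_ones sum_3)

lemma Sigmabar_zmap:
  fixes p :: "(real^3) \<times> (real^3)"
  defines "x \<equiv> (fst p \<bullet> ones) / 3" and "y \<equiv> (snd p \<bullet> ones) / 3"
  shows "Sigmabar (zmap p) $ 1 $ 1 = ((fst p$1 - x)\<^sup>2 + (fst p$2 - x)\<^sup>2 + (fst p$3 - x)\<^sup>2) / 2"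
    and "Sigmabar (zmap p) $ 1 $ 2 = ((fst p$1 - x) * (snd p$1 - y) + (fst p$2 - x) * (snd p$2 - y) + (fst p$3 - x) * (snd p$3 - y)) / 2"
    and "Sigmabar (zmap p) $ 2 $ 1 = ((fst p$1 - x) * (snd p$1 - y) + (fst p$2 - x) * (snd p$2 - y) + (fst p$3 - x) * (snd p$3 - y)) / 2"
    and "Sigmabar (zmap p) $ 2 $ 2 = ((snd p$1 - y)\<^sup>2 + (snd p$2 - y)\<^sup>2 + (snd p$3 - y)\<^sup>2) / 2"
proof -
  have X: "Xbar (zmap p) $ 1 = x" "Xbar (zmap p) $ 2 = y" by (simp_all add: Xbar_zmap x_def y_def)
  have V: "Xv (zmap p) j $ 1 = fst p $ j" "Xv (zmap p) j $ 2 = snd p $ j" for j by (simp_all add: Xv_def zmap_def)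
  have S: "Sigmabar (zmap p) $ k $ l = ((Xv (zmap p) 1 $ k - Xbar (zmap p) $ k) * (Xv (zmap p) 1 $ l - Xbar (zmap p) $ l)
     + (Xv (zmap p) 2 $ k - Xbar (zmap p) $ k) * (Xv (zmap p) 2 $ l - Xbar (zmap p) $ l)
     + (Xv (zmap p) 3 $ k - Xbar (zmap p) $ k) * (Xv (zmap p) 3 $ l - Xbar (zmap p) $ l)) / 2" for k l
    by (simp add: Sigmabar_def outer_def sum_3)
  show "Sigmabar (zmap p) $ 1 $ 1 = ((fst p$1 - x)\<^sup>2 + (fst p$2 - x)\<^sup>2 + (fst p$3 - x)\<^sup>2) / 2"
    "Sigmabar (zmap p) $ 1 $ 2 = ((fst p$1 - x) * (snd p$1 - y) + (fst p$2 - x) * (snd p$2 - y) + (fst p$3 - x) * (snd p$3 - y)) / 2"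
    "Sigmabar (zmap p) $ 2 $ 1 = ((fst p$1 - x) * (snd p$1 - y) + (fst p$2 - x) * (snd p$2 - y) + (fst p$3 - x) * (snd p$3 - y)) / 2"
    "Sigmabar (zmap p) $ 2 $ 2 = ((snd p$1 - y)\<^sup>2 + (snd p$2 - y)\<^sup>2 + (snd p$3 - y)\<^sup>2) / 2"
    unfolding S X V by (simp_all add: power2_eq_square mult.commute)
qed

text \<open>Gram identities: let u = (1,1,1), a = x u + a', b = y u + b' with a', b' orthogonal to
  u, and n = a x b. The square of n . u = det(a', b', u) is 3 times the Gram determinant of a', b'.
  The part of n orthogonal to u is u x (x b' - y a'), whose squared norm 3|x b' - y a'|^2 is the
  term with factor 6. The entries s, t, w are halves of the Gram entries, 2 being the divisor of the
  sample covariance.\<close>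

lemma hotelling_identities:
  fixes a1 a2 a3 b1 b2 b3 :: real
  defines "x \<equiv> (a1 + a2 + a3) / 3" and "y \<equiv> (b1 + b2 + b3) / 3"
  defines "s \<equiv> ((a1 - x)\<^sup>2 + (a2 - x)\<^sup>2 + (a3 - x)\<^sup>2) / 2"
    and "t \<equiv> ((a1 - x) * (b1 - y) + (a2 - x) * (b2 - y) + (a3 - x) * (b3 - y)) / 2"
    and "w \<equiv> ((b1 - y)\<^sup>2 + (b2 - y)\<^sup>2 + (b3 - y)\<^sup>2) / 2"
    and "n1 \<equiv> a2 * b3 - a3 * b2" and "n2 \<equiv> a3 * b1 - a1 * b3" and "n3 \<equiv> a1 * b2 - a2 * b1"
  shows "12 * (s * w - t * t) = (n1 + n2 + n3)\<^sup>2"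
    and "n1\<^sup>2 + n2\<^sup>2 + n3\<^sup>2 = 4 * (s * w - t * t) + 6 * (w * x\<^sup>2 - (t + t) * x * y + s * y\<^sup>2)"
proof -
  \<comment> \<open>Differences from the first entry do not see the mean, so s, t, w and n . u
    become polynomials in four variables.\<close>
  define A2 A3 B2 B3 where "A2 = a2 - a1" and "A3 = a3 - a1" and "B2 = b2 - b1" and "B3 = b3 - b1"
  have a: "a2 = a1 + A2" "a3 = a1 + A3" "b2 = b1 + B2" "b3 = b1 + B3" by (simp_all add: A2_def A3_def B2_def B3_def)
  have x: "a1 - x = - (A2 + A3) / 3" "a2 - x = (2 * A2 - A3) / 3" "a3 - x = (2 * A3 - A2) / 3"
    "b1 - y = - (B2 + B3) / 3" "b2 - y = (2 * B2 - B3) / 3" "b3 - y = (2 * B3 - B2) / 3"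
    by (simp_all add: x_def y_def a field_simps)
  have s: "s = (A2\<^sup>2 + A3\<^sup>2 - A2 * A3) / 3" unfolding s_def x by (simp add: power2_eq_square field_simps)
  have w: "w = (B2\<^sup>2 + B3\<^sup>2 - B2 * B3) / 3" unfolding w_def x by (simp add: power2_eq_square field_simps)
  have t: "t = (2 * (A2 * B2 + A3 * B3) - A2 * B3 - A3 * B2) / 6" unfolding t_def x by (simp add: power2_eq_square field_simps)
  have n: "n1 + n2 + n3 = A2 * B3 - A3 * B2" unfolding n1_def n2_def n3_def a by (simp add: algebra_simps)
  show "12 * (s * w - t * t) = (n1 + n2 + n3)\<^sup>2"
    unfolding n s w t by (simp add: power2_eq_square field_simps)
  have xy: "a1 = x - (A2 + A3) / 3" "b1 = y - (B2 + B3) / 3" using x(1) x(4) by linarith+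
  show "n1\<^sup>2 + n2\<^sup>2 + n3\<^sup>2 = 4 * (s * w - t * t) + 6 * (w * x\<^sup>2 - (t + t) * x * y + s * y\<^sup>2)"
    unfolding n1_def n2_def n3_def s w t a xy by (simp add: power2_eq_square field_simps)
qed

text \<open>A nonzero n . u means a positive determinant d of \<open>Sigmabar\<close>, so the
  inverse is genuine and F = (3/4) N/d. Adding 4d to both sides of 6N <= 8cd turns F <= c into |n|^2
  <= (1 + 2c)(n . u)^2 / 3, the cone with cos^2 = 1/(1 + 2c).\<close>

lemma FHH_le_iff:
  fixes p :: "(real^3) \<times> (real^3)"
  assumes n: "cross3 (fst p) (snd p) \<bullet> ones \<noteq> 0" and c: "1 + 2 * c > 0" and \<alpha>: "\<alpha>\<^sup>2 = 1 / (1 + 2 * c)"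
  shows "FHH (zmap p) \<le> c \<longleftrightarrow> p \<in> cone_set \<alpha> ones"
proof -
  let ?a = "fst p" and ?b = "snd p" and ?n = "cross3 (fst p) (snd p)"
  define x y where "x = (?a \<bullet> ones) / 3" and "y = (?b \<bullet> ones) / 3"
  define s t w where "s = Sigmabar (zmap p) $ 1 $ 1" and "t = Sigmabar (zmap p) $ 1 $ 2" and "w = Sigmabar (zmap p) $ 2 $ 2"
  have t': "Sigmabar (zmap p) $ 2 $ 1 = t" by (simp add: t_def Sigmabar_zmap)
  define d N where "d = s * w - t * t" and "N = w * x\<^sup>2 - (t + t) * x * y + s * y\<^sup>2"
  have nn: "?n $ 1 = ?a$2 * ?b$3 - ?a$3 * ?b$2" "?n $ 2 = ?a$3 * ?b$1 - ?a$1 * ?b$3" "?n $ 3 = ?a$1 * ?b$2 - ?a$2 * ?b$1"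
    by (simp_all add: cross3_def)
  have id: "12 * d = (?n \<bullet> ones)\<^sup>2" "(norm ?n)\<^sup>2 = 4 * d + 6 * N"
  proof -
    show "12 * d = (?n \<bullet> ones)\<^sup>2"
      unfolding inner_ones nn d_def s_def t_def w_def Sigmabar_zmap unfolding inner_ones
      by (rule hotelling_identities(1))
    have "(norm ?n)\<^sup>2 = (?n$1)\<^sup>2 + (?n$2)\<^sup>2 + (?n$3)\<^sup>2"
      unfolding power2_norm_eq_inner by (simp add: inner_vec_def sum_3 power2_eq_square)
    also have "\<dots> = 4 * d + 6 * N"
      unfolding nn d_def N_def s_def t_def w_def Sigmabar_zmap x_def y_def unfolding inner_ones
      by (rule hotelling_identities(2))
    finally show "(norm ?n)\<^sup>2 = 4 * d + 6 * N" .
  qed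
  have d: "d > 0"
  proof -
    have "12 * d > 0" unfolding id(1) using n by simp
    then show ?thesis by simp
  qed
  have F: "FHH (zmap p) = 3 / 4 * (N / d)"
    using matrix_inv_2x2[OF s_def[symmetric] t_def[symmetric] t' w_def[symmetric], of "Xbar (zmap p)"] d
    unfolding Xbar_zmap x_def[symmetric] y_def[symmetric] d_def[symmetric] N_def[symmetric]
    by (simp add: FHH_def T2_def)
  have "FHH (zmap p) \<le> c \<longleftrightarrow> 3 * N \<le> 4 * c * d" unfolding F using d by (simp add: field_simps)
  also have "\<dots> \<longleftrightarrow> (norm ?n)\<^sup>2 \<le> (1 + 2 * c) * (4 * d)" unfolding id(2) by (auto simp: algebra_simps)
  also have "\<dots> \<longleftrightarrow> (norm ?n)\<^sup>2 * 3 \<le> (1 + 2 * c) * (?n \<bullet> ones)\<^sup>2" unfolding id(1)[symmetric] by (auto simp: algebra_simps)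
  also have "\<dots> \<longleftrightarrow> p \<in> cone_set \<alpha> ones"
    unfolding cone_set_def mem_Collect_eq norm_ones \<alpha> using c by (simp add: field_simps)
  finally show ?thesis .
qed

text \<open>On the set n . u = 0 the matrix is singular and \<open>matrix_inv\<close> returns an
  arbitrary value. That value is one fixed matrix, so F is a continuous quadratic expression
  there.\<close>

lemma FHH_set_borel: "{p. FHH (zmap p) \<le> c} \<in> sets borel" if c: "1 + 2 * c > 0" for c
proof -
  define \<alpha> where "\<alpha> = sqrt (1 / (1 + 2 * c))"
  have \<alpha>: "\<alpha>\<^sup>2 = 1 / (1 + 2 * c)" using c by (simp add: \<alpha>_def)
  \<comment> \<open>The choice from the empty predicate: for every singular matrix the predicate
    inside \<open>matrix_inv\<close> equals this one, so the chosen matrix is the same.\<close>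
  define J :: "real^2^2" where "J = (SOME B. False)"
  let ?n = "\<lambda>p::(real^3) \<times> (real^3). cross3 (fst p) (snd p) \<bullet> ones"
  have cn: "continuous_on UNIV ?n" by (intro continuous_intros continuous_on_cross)
  have J: "FHH (zmap p) = 1/2 * (1/2) * (3 * (Xbar (zmap p) \<bullet> (J *v Xbar (zmap p))))" if "?n p = 0" for p
  proof -
    let ?M = "Sigmabar (zmap p)"
    have "12 * (?M$1$1 * ?M$2$2 - ?M$1$2 * ?M$2$1) = (?n p)\<^sup>2"
      unfolding Sigmabar_zmap unfolding inner_ones by (subst hotelling_identities(1)) (simp add: cross3_def)
    then have "det ?M = 0" using that by (simp add: det_2)
    then have "\<not> invertible ?M" by (simp add: invertible_det_nz)
    then have "(\<lambda>B. ?M ** B = mat 1 \<and> B ** ?M = mat 1) = (\<lambda>B. False)" unfolding invertible_def by auto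
    then have "matrix_inv ?M = J" unfolding matrix_inv_def J_def by simp
    then show ?thesis by (simp add: FHH_def T2_def)
  qed
  have cX: "continuous_on UNIV (\<lambda>p. Xbar (zmap p))"
  proof -
    have "continuous_on UNIV (\<lambda>p. Xbar (zmap p) $ i)" for i
      using exhaust_2[of i] by (elim disjE; simp add: Xbar_zmap; intro continuous_intros; simp)
    then have "continuous_on UNIV (\<lambda>p. \<chi> i. Xbar (zmap p) $ i)" by (intro continuous_on_vec_lambda)
    then show ?thesis by simp
  qed
  have "continuous_on UNIV (\<lambda>p. J *v Xbar (zmap p))"
    by (rule continuous_on_compose2[of UNIV "\<lambda>x. J *v x"])
       (auto intro: linear_continuous_on matrix_vector_mul_bounded_linear cX)
  then have c2: "continuous_on UNIV (\<lambda>p. 1/2 * (1/2) * (3 * (Xbar (zmap p) \<bullet> (J *v Xbar (zmap p)))))"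
    using cX by (intro continuous_intros)
  have "{p. FHH (zmap p) \<le> c} = ({p. ?n p \<noteq> 0} \<inter> cone_set \<alpha> ones)
      \<union> ({p. ?n p = 0} \<inter> {p. 1/2 * (1/2) * (3 * (Xbar (zmap p) \<bullet> (J *v Xbar (zmap p)))) \<le> c})"
  proof (rule set_eqI)
    fix p
    show "p \<in> {p. FHH (zmap p) \<le> c} \<longleftrightarrow> p \<in> ({p. ?n p \<noteq> 0} \<inter> cone_set \<alpha> ones)
      \<union> ({p. ?n p = 0} \<inter> {p. 1/2 * (1/2) * (3 * (Xbar (zmap p) \<bullet> (J *v Xbar (zmap p)))) \<le> c})"
    proof (cases "?n p = 0")
      case True then show ?thesis unfolding mem_Collect_eq Un_iff Int_iff J[OF True] by simp
    next
      case False then show ?thesis using FHH_le_iff[OF False c \<alpha>] by simp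
    qed
  qed
  moreover have "{p. ?n p \<noteq> 0} \<in> sets borel" by (intro borel_open open_Collect_neq cn continuous_intros)
  moreover have "{p. ?n p = 0} \<in> sets borel" by (intro borel_closed closed_Collect_eq cn continuous_intros)
  moreover have "{p. 1/2 * (1/2) * (3 * (Xbar (zmap p) \<bullet> (J *v Xbar (zmap p)))) \<le> c} \<in> sets borel"
    by (intro borel_closed closed_Collect_le c2 continuous_intros)
  ultimately show ?thesis using cone_set_borel[of \<alpha> ones] by (simp only:) (intro sets.Un sets.Int)
qed

text \<open>The power of the Hotelling test times pi^3, in real coordinates, kept in
  \<open>ennreal\<close> so that the manipulations below need no integrability.\<close>

definition accept :: "real \<Rightarrow> complex \<Rightarrow> ennreal" where
  "accept \<alpha> \<theta> = (\<integral>\<^sup>+p. indicator (cone_set \<alpha> ones) p * gauss6 (fst p - Re \<theta> *\<^sub>R ones, snd p - Im \<theta> *\<^sub>R ones) \<partial>lborel)"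

text \<open>The region F <= c and the cone agree off the null set n . u = 0.\<close>

lemma beta_HH_eq:
  assumes c: "1 + 2 * c > 0" and \<alpha>: "\<alpha>\<^sup>2 = 1 / (1 + 2 * c)"
  shows "beta_HH c \<theta> = enn2real (accept \<alpha> \<theta>) / pi ^ 3"
proof -
  define S where "S = {z. FHH z \<le> c}"
  let ?g = "\<lambda>z. (cmod (l2inner (prodcoh z) (psi \<theta>)))\<^sup>2"
  let ?e = "\<lambda>p. exp (- ((norm (fst p - Re \<theta> *\<^sub>R ones))\<^sup>2 + (norm (snd p - Im \<theta> *\<^sub>R ones))\<^sup>2))"
  have zm: "zmap \<in> lborel \<rightarrow>\<^sub>M borel" using borel_measurable_continuous_onI[OF continuous_zmap] by simp
  have S: "S \<in> sets borel"
  proof -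
    have "rvec -` {p. FHH (zmap p) \<le> c} \<inter> space borel \<in> sets borel"
      by (rule measurable_sets[OF borel_measurable_continuous_onI[OF continuous_rvec] FHH_set_borel[OF c]])
    then show ?thesis by (simp add: S_def vimage_def)
  qed
  have gz: "?g (zmap p) = ?e p" for p
  proof -
    have "(norm (v - r *\<^sub>R ones))\<^sup>2 = (v$1 - r)\<^sup>2 + (v$2 - r)\<^sup>2 + (v$3 - r)\<^sup>2" for v :: "real^3" and r
      unfolding power2_norm_eq_inner by (simp add: inner_vec_def sum_3 power2_eq_square)
    then show ?thesis unfolding overlap_psi by (simp add: zmap_def cmod_power2 algebra_simps)
  qed
  have ge: "?g = (\<lambda>z. ?e (rvec z))" using gz[of "rvec _"] by (simp del: overlap_psi)
  have "continuous_on UNIV (\<lambda>z. ?e (rvec z))"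
    using continuous_rvec[of UNIV] by (intro continuous_intros)
  then have gm: "?g \<in> borel_measurable borel" unfolding ge by (rule borel_measurable_continuous_onI)
  have m: "(\<lambda>z. indicator S z *\<^sub>R ?g z) \<in> borel_measurable borel"
    by (intro borel_measurable_scaleR borel_measurable_indicator S gm)
  have em: "(\<lambda>p. indicator (cone_set \<alpha> ones) p * ?e p) \<in> borel_measurable lborel"
  proof -
    have "continuous_on UNIV ?e" by (intro continuous_intros)
    then have "?e \<in> borel_measurable borel" by (rule borel_measurable_continuous_onI)
    then show ?thesis using cone_set_borel[of \<alpha> ones] by simp
  qed
  have "beta_HH c \<theta> = 1 / pi ^ 3 * (\<integral>z. indicator S z *\<^sub>R ?g z \<partial>lborel)"
    by (simp add: beta_HH_def S_def set_lebesgue_integral_def)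
  also have "(\<integral>z. indicator S z *\<^sub>R ?g z \<partial>lborel) = (\<integral>p. indicator S (zmap p) *\<^sub>R ?g (zmap p) \<partial>lborel)"
    using integral_distr[OF zm m] by (simp only: distr_zmap)
  also have "\<dots> = (\<integral>p. indicator (cone_set \<alpha> ones) p * ?e p \<partial>lborel)"
  proof (rule integral_cong_AE)
    show "AE p in lborel. indicator S (zmap p) *\<^sub>R ?g (zmap p) = indicator (cone_set \<alpha> ones) p * ?e p"
    proof (rule AE_mp[OF AE_cross3_inner_neq_0[OF ones_neq_0]], rule AE_I2, rule impI)
      fix p :: "(real^3) \<times> (real^3)" assume "cross3 (fst p) (snd p) \<bullet> ones \<noteq> 0"
      from FHH_le_iff[OF this c \<alpha>] show "indicator S (zmap p) *\<^sub>R ?g (zmap p) = indicator (cone_set \<alpha> ones) p * ?e p"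
        unfolding gz S_def by (simp add: indicator_def)
    qed
    show "(\<lambda>p. indicator S (zmap p) *\<^sub>R ?g (zmap p)) \<in> borel_measurable lborel"
      by (rule measurable_compose[OF zm m])
  qed (rule em)
  also have "\<dots> = enn2real (\<integral>\<^sup>+p. ennreal (indicator (cone_set \<alpha> ones) p * ?e p) \<partial>lborel)"
    by (rule integral_eq_nn_integral[OF em]) simp
  also have "(\<integral>\<^sup>+p. ennreal (indicator (cone_set \<alpha> ones) p * ?e p) \<partial>lborel) = accept \<alpha> \<theta>"
    unfolding accept_def
    by (intro nn_integral_cong) (auto simp: indicator_def gauss6_def gauss3_def ennreal_mult[symmetric] exp_add[symmetric])
  finally show ?thesis by simp
qed

section \<open>Exponential tilting and bounds for the acceptance probability\<close>

lemma gauss3_shift: "gauss3 (x - r *\<^sub>R ones) = ennreal (exp (- 3 * r\<^sup>2)) * (gauss3 x * ennreal (exp (2 * r * (x \<bullet> ones))))"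
proof -
  have "(norm (x - r *\<^sub>R ones))\<^sup>2 = (norm x)\<^sup>2 - 2 * r * (x \<bullet> ones) + r\<^sup>2 * (norm ones)\<^sup>2"
  proof -
    have "(x - r *\<^sub>R v) \<bullet> (x - r *\<^sub>R v) = x \<bullet> x - 2 * r * (x \<bullet> v) + r\<^sup>2 * (v \<bullet> v)" for v :: "real^3"
      using inner_commute[of v x] by (simp add: inner_diff_left inner_diff_right power2_eq_square algebra_simps)
    then show ?thesis unfolding power2_norm_eq_inner .
  qed
  then have e: "- (norm (x - r *\<^sub>R ones))\<^sup>2 = - 3 * r\<^sup>2 + (- (norm x)\<^sup>2 + 2 * r * (x \<bullet> ones))"
    unfolding norm_ones by simp
  show ?thesis unfolding gauss3_def e exp_add by (simp add: ennreal_mult)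
qed

text \<open>Completing the square moves the displacement out of the Gaussian into an exponential
  weight, on which the sign symmetries of the cone can act.\<close>

definition accept_exp :: "real \<Rightarrow> real \<Rightarrow> real \<Rightarrow> ennreal" where
  "accept_exp \<alpha> r s = (\<integral>\<^sup>+p. indicator (cone_set \<alpha> ones) p * gauss6 p * ennreal (exp (2 * r * (fst p \<bullet> ones) + 2 * s * (snd p \<bullet> ones))) \<partial>lborel)"

lemma measurable_continuous_ennreal:
  fixes h :: "(real^3) \<times> (real^3) \<Rightarrow> real"
  assumes "continuous_on UNIV h"
  shows "(\<lambda>p. indicator (cone_set \<alpha> ones) p * gauss6 p * ennreal (h p)) \<in> borel_measurable borel"
  by (intro borel_measurable_times_ennreal borel_measurable_indicator cone_set_borel gauss6_measurable
      measurable_compose[OF borel_measurable_continuous_onI[OF assms] measurable_ennreal])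

lemma accept_eq: "accept \<alpha> \<theta> = ennreal (exp (- 3 * (cmod \<theta>)\<^sup>2)) * accept_exp \<alpha> (Re \<theta>) (Im \<theta>)"
proof -
  have "continuous_on UNIV (\<lambda>p::(real^3) \<times> (real^3). exp (2 * Re \<theta> * (fst p \<bullet> ones) + 2 * Im \<theta> * (snd p \<bullet> ones)))"
    by (intro continuous_intros)
  from measurable_continuous_ennreal[OF this]
  have m: "(\<lambda>p. indicator (cone_set \<alpha> ones) p * gauss6 p * ennreal (exp (2 * Re \<theta> * (fst p \<bullet> ones) + 2 * Im \<theta> * (snd p \<bullet> ones)))) \<in> borel_measurable lborel"
    by simp
  have e: "ennreal (exp (- 3 * (Re \<theta>)\<^sup>2)) * ennreal (exp (- 3 * (Im \<theta>)\<^sup>2)) = ennreal (exp (- 3 * (cmod \<theta>)\<^sup>2))"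
    by (simp add: ennreal_mult[symmetric] exp_add[symmetric] cmod_power2 algebra_simps)
  have "accept \<alpha> \<theta> = (\<integral>\<^sup>+p. ennreal (exp (- 3 * (cmod \<theta>)\<^sup>2)) *
     (indicator (cone_set \<alpha> ones) p * gauss6 p * ennreal (exp (2 * Re \<theta> * (fst p \<bullet> ones) + 2 * Im \<theta> * (snd p \<bullet> ones)))) \<partial>lborel)"
    unfolding accept_def
  proof (rule nn_integral_cong)
    fix p :: "(real^3) \<times> (real^3)"
    have "gauss6 (fst p - Re \<theta> *\<^sub>R ones, snd p - Im \<theta> *\<^sub>R ones) = ennreal (exp (- 3 * (cmod \<theta>)\<^sup>2)) *
       (gauss6 p * (ennreal (exp (2 * Re \<theta> * (fst p \<bullet> ones))) * ennreal (exp (2 * Im \<theta> * (snd p \<bullet> ones)))))"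
      unfolding gauss6_def fst_conv snd_conv gauss3_shift e[symmetric] by (simp only: mult_ac)
    also have "ennreal (exp (2 * Re \<theta> * (fst p \<bullet> ones))) * ennreal (exp (2 * Im \<theta> * (snd p \<bullet> ones)))
      = ennreal (exp (2 * Re \<theta> * (fst p \<bullet> ones) + 2 * Im \<theta> * (snd p \<bullet> ones)))"
      by (simp only: exp_add ennreal_mult exp_ge_zero)
    finally show "indicator (cone_set \<alpha> ones) p * gauss6 (fst p - Re \<theta> *\<^sub>R ones, snd p - Im \<theta> *\<^sub>R ones)
       = ennreal (exp (- 3 * (cmod \<theta>)\<^sup>2)) *
     (indicator (cone_set \<alpha> ones) p * gauss6 p * ennreal (exp (2 * Re \<theta> * (fst p \<bullet> ones) + 2 * Im \<theta> * (snd p \<bullet> ones))))"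
      by (simp only: mult_ac)
  qed
  also have "\<dots> = ennreal (exp (- 3 * (cmod \<theta>)\<^sup>2)) * accept_exp \<alpha> (Re \<theta>) (Im \<theta>)"
    unfolding accept_exp_def by (rule nn_integral_cmult[OF m])
  finally show ?thesis .
qed

lemma orthogonal_uminus: "orthogonal_transformation (uminus :: real^3 \<Rightarrow> real^3)"
  by (simp add: orthogonal_transformation linear_uminus)

text \<open>Changing the sign of a or of b alone reverses n and leaves the cone and the Gaussian
  unchanged.\<close>

lemma accept_exp_flip: "accept_exp \<alpha> (- r) s = accept_exp \<alpha> r s" "accept_exp \<alpha> r (- s) = accept_exp \<alpha> r s"
proof -
  have c: "continuous_on UNIV (\<lambda>p::(real^3) \<times> (real^3). exp (2 * r * (fst p \<bullet> ones) + 2 * s * (snd p \<bullet> ones)))"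
    by (intro continuous_intros)
  note m = measurable_continuous_ennreal[OF c, of \<alpha>]
  have ind: "indicator (cone_set \<alpha> ones) (- fst p, snd p) = (indicator (cone_set \<alpha> ones) p :: ennreal)"
    "indicator (cone_set \<alpha> ones) (fst p, - snd p) = (indicator (cone_set \<alpha> ones) p :: ennreal)" for p
    by (simp_all add: indicator_def cone_set_def)
  have g: "gauss6 (- fst p, snd p) = gauss6 p" "gauss6 (fst p, - snd p) = gauss6 p" for p
    by (simp_all add: gauss6_def gauss3_def)
  show "accept_exp \<alpha> (- r) s = accept_exp \<alpha> r s"
    unfolding accept_exp_def
    using nn_integral_pair_orthogonal[OF orthogonal_uminus orthogonal_transformation_id m] by (simp add: ind g)
  show "accept_exp \<alpha> r (- s) = accept_exp \<alpha> r s"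
    unfolding accept_exp_def
    using nn_integral_pair_orthogonal[OF orthogonal_transformation_id orthogonal_uminus m] by (simp add: ind g)
qed

lemma cosh_lower: "exp x + exp (- x) \<ge> 2 + (x::real)\<^sup>2"
proof -
  let ?f = "\<lambda>n. if even n then x ^ n /\<^sub>R fact n else 0"
  have s: "?f sums cosh x" by (rule cosh_converges)
  have "sum ?f {0, 2} \<le> suminf ?f"
  proof (rule sum_le_suminf)
    show "summable ?f" using s by (rule sums_summable)
    show "0 \<le> ?f n" for n by (auto intro!: mult_nonneg_nonneg simp: zero_le_even_power)
  qed simp
  also have "suminf ?f = cosh x" using s by (rule sums_unique[symmetric])
  finally show ?thesis by (simp add: cosh_def)
qed

lemma ennreal_pos_lower: "0 < x \<Longrightarrow> \<exists>m>0. ennreal m \<le> x"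
proof (cases x)
  case (real r)
  assume "0 < x" then show ?thesis using real by (intro exI[of _ r]) simp
next
  case top
  then show ?thesis by (intro exI[of _ 1]) simp
qed

text \<open>The event has Gaussian mass (1 - \<alpha>) pi^3 > 0, so the integral of an almost
  everywhere positive weight over it cannot vanish. A real lower bound is extracted, whether or not
  the moment is finite.\<close>

lemma accept_moment_pos:
  assumes \<alpha>: "0 \<le> \<alpha>" "\<alpha> < 1" and c: "continuous_on UNIV h" and h0: "\<And>p. h p \<ge> 0" and ne: "AE p in lborel. h p \<noteq> 0"
  shows "\<exists>m>0. ennreal m \<le> (\<integral>\<^sup>+p. indicator (cone_set \<alpha> ones) p * gauss6 p * ennreal (h p) \<partial>lborel)"
proof (rule ennreal_pos_lower, rule ccontr)
  have m: "(\<lambda>p. indicator (cone_set \<alpha> ones) p * gauss6 p * ennreal (h p)) \<in> borel_measurable lborel"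
    using measurable_continuous_ennreal[OF c] by simp
  assume "\<not> 0 < (\<integral>\<^sup>+p. indicator (cone_set \<alpha> ones) p * gauss6 p * ennreal (h p) \<partial>lborel)"
  then have "(\<integral>\<^sup>+p. indicator (cone_set \<alpha> ones) p * gauss6 p * ennreal (h p) \<partial>lborel) = 0" by (simp add: not_less)
  then have z: "AE p in lborel. indicator (cone_set \<alpha> ones) p * gauss6 p * ennreal (h p) = 0"
    by (simp only: nn_integral_0_iff_AE[OF m])
  have "AE p in lborel. indicator (cone_set \<alpha> ones) p * gauss6 p = 0"
    using z ne
  proof eventually_elim
    case (elim p)
    have "ennreal (h p) \<noteq> 0" using h0[of p] elim(2) by (simp add: less_le)
    then show ?case using elim(1) by (simp only: mult_eq_0_iff simp_thms)
  qed
  then have "(\<integral>\<^sup>+p. indicator (cone_set \<alpha> ones) p * gauss6 p \<partial>lborel) = (\<integral>\<^sup>+p. 0 \<partial>(lborel :: ((real^3) \<times> (real^3)) measure))"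
    by (rule nn_integral_cong_AE)
  then have "ennreal ((1 - \<alpha>) * pi ^ 3) = 0" unfolding cone_set_gauss[OF \<alpha> ones_neq_0] by simp
  moreover have "(1 - \<alpha>) * pi ^ 3 > 0" using \<alpha> by simp
  ultimately show False by simp
qed

lemma AE_fst_snd_inner_ones:
  "AE p in (lborel :: ((real^3) \<times> (real^3)) measure). fst p \<bullet> ones \<noteq> 0"
  "AE p in (lborel :: ((real^3) \<times> (real^3)) measure). snd p \<bullet> ones \<noteq> 0"
proof -
  have ae: "AE x in lborel. x \<bullet> ones \<noteq> 0" using AE_inner_neq_0[OF ones_neq_0] by (simp add: inner_commute)
  have o: "{p::(real^3) \<times> (real^3). fst p \<bullet> ones \<noteq> 0} \<in> sets borel" "{p::(real^3) \<times> (real^3). snd p \<bullet> ones \<noteq> 0} \<in> sets borel"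
    by (intro borel_open open_Collect_neq continuous_intros)+
  show "AE p in (lborel :: ((real^3) \<times> (real^3)) measure). fst p \<bullet> ones \<noteq> 0"
    by (rule AE_lborel_pair[OF o(1)], rule AE_mp[OF ae], rule AE_I2) simp
  show "AE p in (lborel :: ((real^3) \<times> (real^3)) measure). snd p \<bullet> ones \<noteq> 0"
    by (rule AE_lborel_pair[OF o(2)]) (use ae in simp)
qed

text \<open>The four sign choices of (r, s) give equal values, and the four exponential weights add
  up to (2 cosh x)(2 cosh y) >= (2 + x^2)(2 + y^2) with x = 2r (a . u) and y = 2s (b . u). The
  constant term integrates to the mass of the event, the quadratic terms to its second
  moments.\<close>

lemma accept_exp_lower:
  assumes \<alpha>: "0 \<le> \<alpha>" "\<alpha> < 1"
  shows "\<exists>m>0. \<forall>r s. ennreal ((1 - \<alpha>) * pi ^ 3 + 2 * m * (r\<^sup>2 + s\<^sup>2)) \<le> accept_exp \<alpha> r s"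
proof -
  let ?w = "\<lambda>p. indicator (cone_set \<alpha> ones) p * gauss6 p :: ennreal"
  define Ma where "Ma = (\<integral>\<^sup>+p. ?w p * ennreal ((fst p \<bullet> ones)\<^sup>2) \<partial>lborel)"
  define Mb where "Mb = (\<integral>\<^sup>+p. ?w p * ennreal ((snd p \<bullet> ones)\<^sup>2) \<partial>lborel)"
  have c1: "continuous_on UNIV (\<lambda>p::(real^3) \<times> (real^3). (fst p \<bullet> ones)\<^sup>2)" "continuous_on UNIV (\<lambda>p::(real^3) \<times> (real^3). (snd p \<bullet> ones)\<^sup>2)"
    by (intro continuous_intros)+
  have ae: "AE p in (lborel :: ((real^3) \<times> (real^3)) measure). (fst p \<bullet> ones)\<^sup>2 \<noteq> 0"
    "AE p in (lborel :: ((real^3) \<times> (real^3)) measure). (snd p \<bullet> ones)\<^sup>2 \<noteq> 0"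
    using AE_fst_snd_inner_ones by simp_all
  obtain m1 where m1: "m1 > 0" "ennreal m1 \<le> Ma" unfolding Ma_def using accept_moment_pos[OF \<alpha> c1(1) _ ae(1)] by auto
  obtain m2 where m2: "m2 > 0" "ennreal m2 \<le> Mb" unfolding Mb_def using accept_moment_pos[OF \<alpha> c1(2) _ ae(2)] by auto
  define m where "m = min m1 m2"
  have m0: "m > 0" using m1 m2 by (simp add: m_def)
  have mM: "ennreal m \<le> Ma" "ennreal m \<le> Mb"
  proof -
    have "ennreal m \<le> ennreal m1" "ennreal m \<le> ennreal m2" by (auto simp: m_def intro!: ennreal_leI)
    then show "ennreal m \<le> Ma" "ennreal m \<le> Mb" using m1(2) m2(2) by (auto intro: order.trans)
  qed
  have "ennreal ((1 - \<alpha>) * pi ^ 3 + 2 * m * (r\<^sup>2 + s\<^sup>2)) \<le> accept_exp \<alpha> r s" for r s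
  proof -
    let ?E = "\<lambda>r s p. exp (2 * r * (fst p \<bullet> ones) + 2 * s * (snd p \<bullet> ones))"
    have mE: "(\<lambda>p. ?w p * ennreal (?E r s p)) \<in> borel_measurable lborel" for r s
      using measurable_continuous_ennreal[of "?E r s" \<alpha>] by (simp add: continuous_intros)
    have mw: "?w \<in> borel_measurable lborel" using measurable_continuous_ennreal[of "\<lambda>p. 1" \<alpha>] by simp
    have ma: "(\<lambda>p. ?w p * ennreal ((fst p \<bullet> ones)\<^sup>2)) \<in> borel_measurable lborel" "(\<lambda>p. ?w p * ennreal ((snd p \<bullet> ones)\<^sup>2)) \<in> borel_measurable lborel"
      using measurable_continuous_ennreal[OF c1(1)] measurable_continuous_ennreal[OF c1(2)] by simp_all
    \<comment> \<open>The factor 4 counts the sign choices; 8 r^2 is the coefficient of (a . u)^2 in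
      2 x^2.\<close>
    have "ennreal (4 * ((1 - \<alpha>) * pi ^ 3 + 2 * m * (r\<^sup>2 + s\<^sup>2)))
       = ennreal 4 * ennreal ((1 - \<alpha>) * pi ^ 3) + (ennreal (8 * r\<^sup>2) * ennreal m + ennreal (8 * s\<^sup>2) * ennreal m)"
    proof -
      have "ennreal (4 * (P + 2 * m * (r\<^sup>2 + s\<^sup>2))) = ennreal 4 * ennreal P + (ennreal (8 * r\<^sup>2) * ennreal m + ennreal (8 * s\<^sup>2) * ennreal m)"
        if "P \<ge> 0" for P
      proof -
        have "4 * (P + 2 * m * (r\<^sup>2 + s\<^sup>2)) = 4 * P + (8 * r\<^sup>2 * m + 8 * s\<^sup>2 * m)" by (simp add: algebra_simps)
        then show ?thesis using that m0 by (simp add: ennreal_mult)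
      qed
      from this[of "(1 - \<alpha>) * pi ^ 3"] \<alpha> show ?thesis by simp
    qed
    also have "\<dots> \<le> ennreal 4 * ennreal ((1 - \<alpha>) * pi ^ 3) + (ennreal (8 * r\<^sup>2) * Ma + ennreal (8 * s\<^sup>2) * Mb)"
      by (intro add_mono mult_left_mono mM order_refl) auto
    also have "\<dots> = (\<integral>\<^sup>+p. ennreal 4 * ?w p + (ennreal (8 * r\<^sup>2) * (?w p * ennreal ((fst p \<bullet> ones)\<^sup>2)) + ennreal (8 * s\<^sup>2) * (?w p * ennreal ((snd p \<bullet> ones)\<^sup>2))) \<partial>lborel)"
      unfolding cone_set_gauss[OF \<alpha> ones_neq_0, symmetric] Ma_def Mb_def
      using mw ma by (simp add: nn_integral_add nn_integral_cmult)
    also have "\<dots> \<le> (\<integral>\<^sup>+p. (?w p * ennreal (?E r s p) + ?w p * ennreal (?E (-r) s p)) + (?w p * ennreal (?E r (-s) p) + ?w p * ennreal (?E (-r) (-s) p)) \<partial>lborel)"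
    proof (rule nn_integral_mono)
      fix p :: "(real^3) \<times> (real^3)"
      define x y where "x = 2 * r * (fst p \<bullet> ones)" and "y = 2 * s * (snd p \<bullet> ones)"
      have "4 + (8 * r\<^sup>2 * (fst p \<bullet> ones)\<^sup>2 + 8 * s\<^sup>2 * (snd p \<bullet> ones)\<^sup>2) = 4 + 2 * x\<^sup>2 + 2 * y\<^sup>2"
        by (simp add: x_def y_def power_mult_distrib)
      also have "\<dots> \<le> (2 + x\<^sup>2) * (2 + y\<^sup>2)" by (simp add: algebra_simps)
      also have "\<dots> \<le> (exp x + exp (- x)) * (exp y + exp (- y))"
        by (intro mult_mono cosh_lower) (auto intro: add_nonneg_nonneg)
      also have "\<dots> = (?E r s p + ?E (-r) s p) + (?E r (-s) p + ?E (-r) (-s) p)"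
        unfolding x_def y_def by (simp add: exp_add[symmetric] algebra_simps)
      finally have "ennreal (4 + (8 * r\<^sup>2 * (fst p \<bullet> ones)\<^sup>2 + 8 * s\<^sup>2 * (snd p \<bullet> ones)\<^sup>2))
          \<le> ennreal ((?E r s p + ?E (-r) s p) + (?E r (-s) p + ?E (-r) (-s) p))" by (rule ennreal_leI)
      from mult_left_mono[OF this, of "?w p"]
      have "?w p * ennreal (4 + (8 * r\<^sup>2 * (fst p \<bullet> ones)\<^sup>2 + 8 * s\<^sup>2 * (snd p \<bullet> ones)\<^sup>2))
         \<le> ?w p * ennreal ((?E r s p + ?E (-r) s p) + (?E r (-s) p + ?E (-r) (-s) p))" by simp
      moreover have "?w p * ennreal (4 + (8 * r\<^sup>2 * (fst p \<bullet> ones)\<^sup>2 + 8 * s\<^sup>2 * (snd p \<bullet> ones)\<^sup>2))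
        = ennreal 4 * ?w p + (ennreal (8 * r\<^sup>2) * (?w p * ennreal ((fst p \<bullet> ones)\<^sup>2)) + ennreal (8 * s\<^sup>2) * (?w p * ennreal ((snd p \<bullet> ones)\<^sup>2)))"
      proof -
        have "ennreal (4 + (8 * r\<^sup>2 * (fst p \<bullet> ones)\<^sup>2 + 8 * s\<^sup>2 * (snd p \<bullet> ones)\<^sup>2))
          = ennreal 4 + (ennreal (8 * r\<^sup>2) * ennreal ((fst p \<bullet> ones)\<^sup>2) + ennreal (8 * s\<^sup>2) * ennreal ((snd p \<bullet> ones)\<^sup>2))"
          by (subst ennreal_plus, simp, simp, subst ennreal_plus, simp, simp) (simp only: ennreal_mult zero_le_power2 zero_le_mult_iff zero_le_numeral simp_thms)
        then show ?thesis by (simp only: distrib_left mult_ac)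
      qed
      moreover have "?w p * ennreal ((?E r s p + ?E (-r) s p) + (?E r (-s) p + ?E (-r) (-s) p))
        = (?w p * ennreal (?E r s p) + ?w p * ennreal (?E (-r) s p)) + (?w p * ennreal (?E r (-s) p) + ?w p * ennreal (?E (-r) (-s) p))"
        by (simp only: ennreal_plus exp_ge_zero add_nonneg_nonneg distrib_left)
      ultimately show "ennreal 4 * ?w p + (ennreal (8 * r\<^sup>2) * (?w p * ennreal ((fst p \<bullet> ones)\<^sup>2)) + ennreal (8 * s\<^sup>2) * (?w p * ennreal ((snd p \<bullet> ones)\<^sup>2)))
         \<le> (?w p * ennreal (?E r s p) + ?w p * ennreal (?E (-r) s p)) + (?w p * ennreal (?E r (-s) p) + ?w p * ennreal (?E (-r) (-s) p))"
        by (simp only:)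
    qed
    also have "\<dots> = (accept_exp \<alpha> r s + accept_exp \<alpha> (-r) s) + (accept_exp \<alpha> r (-s) + accept_exp \<alpha> (-r) (-s))"
      unfolding accept_exp_def by (simp only: nn_integral_add mE borel_measurable_add)
    also have "\<dots> = ennreal 4 * accept_exp \<alpha> r s"
    proof -
      have "ennreal 4 = 1 + 1 + (1 + 1)" by simp
      then show ?thesis unfolding accept_exp_flip by (simp only: distrib_right mult_1)
    qed
    finally have "ennreal (1/4) * ennreal (4 * ((1 - \<alpha>) * pi ^ 3 + 2 * m * (r\<^sup>2 + s\<^sup>2))) \<le> ennreal (1/4) * (ennreal 4 * accept_exp \<alpha> r s)"
      by (rule mult_left_mono) simp
    moreover have "ennreal (1/4) * (ennreal 4 * y) = y" for y
      by (simp only: mult.assoc[symmetric] ennreal_mult[symmetric]) simp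
    moreover have "ennreal (1/4) * ennreal (4 * ((1 - \<alpha>) * pi ^ 3 + 2 * m * (r\<^sup>2 + s\<^sup>2))) = ennreal ((1 - \<alpha>) * pi ^ 3 + 2 * m * (r\<^sup>2 + s\<^sup>2))"
    proof -
      have "ennreal (1/4) * ennreal (4 * X) = ennreal X" if "X \<ge> 0" for X
        using that by (subst ennreal_mult[symmetric]) auto
      moreover have "(1 - \<alpha>) * pi ^ 3 + 2 * m * (r\<^sup>2 + s\<^sup>2) \<ge> 0" using \<alpha> m0 by (intro add_nonneg_nonneg mult_nonneg_nonneg) auto
      ultimately show ?thesis by blast
    qed
    ultimately show ?thesis by (simp only:)
  qed
  then show ?thesis using m0 by blast
qed

text \<open>As v is orthogonal to n, the inner product of n with v - r u is -r (n . u), on the cone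
  at least \<alpha> sqrt 3 |r| |n| in absolute value; Cauchy-Schwarz converts this into a distance.
  It serves for v = a and for v = b.\<close>

lemma cone_distance:
  assumes p: "p \<in> cone_set \<alpha> ones" and n: "cross3 (fst p) (snd p) \<bullet> ones \<noteq> 0"
    and v: "cross3 (fst p) (snd p) \<bullet> v = 0"
  shows "3 * \<alpha>\<^sup>2 * r\<^sup>2 \<le> (norm (v - r *\<^sub>R ones))\<^sup>2"
proof -
  let ?n = "cross3 (fst p) (snd p)"
  have n0: "(norm ?n)\<^sup>2 > 0" using n by auto
  have "\<bar>?n \<bullet> (v - r *\<^sub>R ones)\<bar> \<le> norm ?n * norm (v - r *\<^sub>R ones)" by (rule Cauchy_Schwarz_ineq2)
  then have "\<bar>?n \<bullet> (v - r *\<^sub>R ones)\<bar>\<^sup>2 \<le> (norm ?n * norm (v - r *\<^sub>R ones))\<^sup>2" by (intro power_mono) auto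
  moreover have "\<bar>?n \<bullet> (v - r *\<^sub>R ones)\<bar>\<^sup>2 = r\<^sup>2 * (?n \<bullet> ones)\<^sup>2" using v by (simp add: inner_diff_right power_mult_distrib)
  moreover have "r\<^sup>2 * (\<alpha>\<^sup>2 * (norm ?n)\<^sup>2 * 3) \<le> r\<^sup>2 * (?n \<bullet> ones)\<^sup>2"
    using p unfolding cone_set_def mem_Collect_eq norm_ones by (intro mult_left_mono) auto
  ultimately have "(norm ?n)\<^sup>2 * (3 * \<alpha>\<^sup>2 * r\<^sup>2) \<le> (norm ?n)\<^sup>2 * (norm (v - r *\<^sub>R ones))\<^sup>2"
    by (simp add: power_mult_distrib mult_ac)
  then show ?thesis using n0 by (simp only: mult_le_cancel_left_pos)
qed

text \<open>The Gaussian with half the exponent: the other half pays for exponential decay in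
  \<theta>, this half keeps the integral finite.\<close>

definition wide :: "real^3 \<Rightarrow> ennreal" where
  "wide x = ennreal (exp (- (norm x)\<^sup>2 / 2))"

lemma wide_measurable: "wide \<in> borel_measurable borel"
  unfolding wide_def[abs_def]
  by (intro measurable_compose[OF _ measurable_ennreal] borel_measurable_continuous_onI continuous_intros) simp

lemma nn_integral_wide_finite: "(\<integral>\<^sup>+x. wide x \<partial>lborel) < \<infinity>"
proof -
  have g: "has_bochner_integral lborel (\<lambda>x. exp (- (complex_of_real x)\<^sup>2)) (complex_of_real (sqrt pi))"
    using has_bochner_integral_gauss[of 0] by simp
  have "has_bochner_integral lborel (\<lambda>x. exp (- (complex_of_real (0 + 1 / sqrt 2 * x))\<^sup>2)) (complex_of_real (sqrt pi) /\<^sub>R \<bar>1 / sqrt 2\<bar>)"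
    using g by (subst (asm) lborel_has_bochner_integral_real_affine_iff[where c = "1 / sqrt 2" and t = 0]) simp_all
  moreover have "(\<lambda>x. exp (- (complex_of_real (0 + 1 / sqrt 2 * x))\<^sup>2)) = (\<lambda>x. complex_of_real (exp (- x\<^sup>2 / 2)))"
  proof
    fix x
    have "(0 + 1 / sqrt 2 * x)\<^sup>2 = x\<^sup>2 / 2" by (simp add: power_divide)
    then show "exp (- (complex_of_real (0 + 1 / sqrt 2 * x))\<^sup>2) = complex_of_real (exp (- x\<^sup>2 / 2))"
      by (simp only: of_real_power[symmetric] of_real_minus[symmetric] exp_of_real) simp
  qed
  ultimately have I: "has_bochner_integral lborel (\<lambda>x. complex_of_real (exp (- x\<^sup>2 / 2))) (complex_of_real (sqrt pi) /\<^sub>R \<bar>1 / sqrt 2\<bar>)"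
    by (simp only:)
  have "complex_of_real (exp (- (x$1)\<^sup>2 / 2)) * complex_of_real (exp (- (x$2)\<^sup>2 / 2)) * complex_of_real (exp (- (x$3)\<^sup>2 / 2))
     = complex_of_real (exp (- (norm x)\<^sup>2 / 2))" for x :: "real^3"
  proof -
    have "- (norm x)\<^sup>2 / 2 = - (x$1)\<^sup>2 / 2 + - (x$2)\<^sup>2 / 2 + - (x$3)\<^sup>2 / 2"
      unfolding power2_norm_eq_inner by (simp add: inner_vec_def sum_3 power2_eq_square)
    then show ?thesis by (simp only: exp_add of_real_mult)
  qed
  then have "integrable lborel (\<lambda>x::real^3. complex_of_real (exp (- (norm x)\<^sup>2 / 2)))"
    using has_bochner_integral_prod3[OF I I I] by (simp add: has_bochner_integral_iff)
  then have "integrable lborel (\<lambda>x::real^3. exp (- (norm x)\<^sup>2 / 2))"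
    using integrable_Re[of lborel "\<lambda>x::real^3. complex_of_real (exp (- (norm x)\<^sup>2 / 2))"] by simp
  from integrableD(2)[OF this] show ?thesis by (simp add: wide_def less_top)
qed

text \<open>On the event the total squared distance is at least 3 \<alpha>^2 |\<theta>|^2. One half
  of it becomes the decay rate (3/2) \<alpha>^2; the other half integrates, by translation
  invariance, to a constant independent of \<theta>.\<close>

lemma accept_upper:
  shows "\<exists>K\<ge>0. \<forall>\<theta>. accept \<alpha> \<theta> \<le> ennreal (K * exp (- (3 / 2) * \<alpha>\<^sup>2 * (cmod \<theta>)\<^sup>2))"
proof -
  let ?W = "\<integral>\<^sup>+x. wide x \<partial>lborel"
  define K where "K = enn2real (?W * ?W)"
  have K: "ennreal K = ?W * ?W" "K \<ge> 0"
    using nn_integral_wide_finite by (simp_all add: K_def ennreal_mult_less_top)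
  have "accept \<alpha> \<theta> \<le> ennreal (K * exp (- (3 / 2) * \<alpha>\<^sup>2 * (cmod \<theta>)\<^sup>2))" for \<theta>
  proof -
    let ?r = "Re \<theta>" and ?s = "Im \<theta>"
    define e where "e = exp (- (3 / 2) * \<alpha>\<^sup>2 * (cmod \<theta>)\<^sup>2)"
    let ?T = "\<lambda>p. wide (fst p - ?r *\<^sub>R ones) * wide (snd p - ?s *\<^sub>R ones)"
    have shift: "(\<integral>\<^sup>+x. wide (x - c) \<partial>lborel) = ?W" for c
    proof -
      have "(\<integral>\<^sup>+x. wide x \<partial>distr lborel borel ((+) (- c))) = (\<integral>\<^sup>+x. wide (- c + x) \<partial>lborel)"
        using wide_measurable by (subst nn_integral_distr) auto
      then show ?thesis by (simp add: lborel_distr_plus)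
    qed
    have wm: "(\<lambda>x. wide (x - c)) \<in> borel_measurable borel" for c
      by (rule measurable_compose[OF borel_measurable_continuous_onI wide_measurable]) (intro continuous_intros)
    have Tm: "?T \<in> borel_measurable borel"
      by (intro borel_measurable_times_ennreal measurable_compose[OF borel_measurable_continuous_onI wm] continuous_intros)
    have "accept \<alpha> \<theta> \<le> (\<integral>\<^sup>+p. ennreal e * ?T p \<partial>lborel)"
      unfolding accept_def
    proof (rule nn_integral_mono_AE, rule AE_mp[OF AE_cross3_inner_neq_0[OF ones_neq_0]], rule AE_I2, rule impI)
      fix p :: "(real^3) \<times> (real^3)" assume n: "cross3 (fst p) (snd p) \<bullet> ones \<noteq> 0"
      show "indicator (cone_set \<alpha> ones) p * gauss6 (fst p - ?r *\<^sub>R ones, snd p - ?s *\<^sub>R ones) \<le> ennreal e * ?T p"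
      proof (cases "p \<in> cone_set \<alpha> ones")
        case False then show ?thesis by simp
      next
        case True
        let ?A = "(norm (fst p - ?r *\<^sub>R ones))\<^sup>2" and ?B = "(norm (snd p - ?s *\<^sub>R ones))\<^sup>2"
        have "3 * \<alpha>\<^sup>2 * ?r\<^sup>2 \<le> ?A" by (rule cone_distance[OF True n]) (simp add: inner_commute dot_cross_self)
        moreover have "3 * \<alpha>\<^sup>2 * ?s\<^sup>2 \<le> ?B" by (rule cone_distance[OF True n]) (simp add: dot_cross_self)
        ultimately have "3 * \<alpha>\<^sup>2 * (cmod \<theta>)\<^sup>2 \<le> ?A + ?B" unfolding cmod_power2 by (simp add: distrib_left)
        then have "- ?A + - ?B \<le> - (3 / 2) * \<alpha>\<^sup>2 * (cmod \<theta>)\<^sup>2 + (- ?A / 2 + - ?B / 2)" by simp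
        then have "exp (- ?A + - ?B) \<le> exp (- (3 / 2) * \<alpha>\<^sup>2 * (cmod \<theta>)\<^sup>2 + (- ?A / 2 + - ?B / 2))" by simp
        then have "exp (- ?A) * exp (- ?B) \<le> e * (exp (- ?A / 2) * exp (- ?B / 2))" by (simp only: exp_add e_def)
        then have "ennreal (exp (- ?A) * exp (- ?B)) \<le> ennreal (e * (exp (- ?A / 2) * exp (- ?B / 2)))" by (rule ennreal_leI)
        then show ?thesis using True
          by (simp add: gauss6_def gauss3_def wide_def ennreal_mult e_def)
      qed
    qed
    also have "\<dots> = ennreal e * (\<integral>\<^sup>+p. ?T p \<partial>lborel)" using Tm by (intro nn_integral_cmult) simp
    also have "(\<integral>\<^sup>+p. ?T p \<partial>lborel) = (\<integral>\<^sup>+a. wide (a - ?r *\<^sub>R ones) * (\<integral>\<^sup>+b. wide (b - ?s *\<^sub>R ones) \<partial>lborel) \<partial>lborel)"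
      unfolding nn_integral_lborel_pair[OF Tm] fst_conv snd_conv using wm by (simp add: nn_integral_cmult)
    also have "\<dots> = ?W * ?W" unfolding shift using wm by (simp add: nn_integral_multc shift)
    also have "ennreal e * (?W * ?W) = ennreal (K * e)"
      unfolding K(1)[symmetric] using K(2) by (simp add: ennreal_mult[symmetric] e_def mult.commute)
    finally show ?thesis by (simp only: e_def)
  qed
  then show ?thesis using K(2) by blast
qed

section \<open>The critical value and the comparison\<close>

text \<open>The normalising constant 1/Beta(1, 1/2) = 1/2 cancels the factor d1/d2 = 2, and x enters
  with exponent 0.\<close>

lemma Fdens_2_1: "x > 0 \<Longrightarrow> Fdens 2 1 x = (1 + 2 * x) powr (- 3 / 2)"
proof -
  assume x: "x > 0"
  have "Beta 1 (1/2 :: real) = 2"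
  proof -
    have "(1/2::real) \<notin> \<int>\<^sub>\<le>\<^sub>0"
    proof
      assume "(1/2::real) \<in> \<int>\<^sub>\<le>\<^sub>0"
      then have "1/2 \<le> (0::real)" by (rule nonpos_Ints_nonpos)
      then show False by simp
    qed
    from Gamma_plus1[OF this] have G: "Gamma (3/2 :: real) = sqrt pi / 2" by (simp add: Gamma_one_half_real)
    have "1 + 1/2 = (3/2 :: real)" by simp
    then show ?thesis by (simp only: Beta_def G Gamma_one_half_real) simp
  qed
  then show ?thesis using x by (simp add: Fdens_def)
qed

text \<open>The antiderivative is -(1 + 2x)^(-1/2), so level and critical value determine each other
  in closed form.\<close>

lemma Fdens_tail: "c \<ge> 0 \<Longrightarrow> (Fdens 2 1 has_integral (1 + 2 * c) powr (- 1 / 2)) {c..}"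
proof -
  assume c: "c \<ge> 0"
  have "((\<lambda>x. (1 + 2 * x) powr (- 3 / 2)) has_integral (1 + 2 * c) powr (- 1 / 2)) {c..}"
  proof -
    have "set_integrable lborel (einterval (ereal c) \<infinity>) (\<lambda>x. (1 + 2 * x) powr (- 3 / 2)) \<and>
        (LBINT x=ereal c..\<infinity>. (1 + 2 * x) powr (- 3 / 2)) = 0 - (- ((1 + 2 * c) powr (- 1 / 2)))"
    proof (intro conjI)
      note f = interval_integral_FTC_nonneg[where F = "\<lambda>x. - ((1 + 2 * x) powr (- 1 / 2))" and f = "\<lambda>x. (1 + 2 * x) powr (- 3 / 2)"
          and a = "ereal c" and b = \<infinity> and A = "- ((1 + 2 * c) powr (- 1 / 2))" and B = 0]
      have D: "DERIV (\<lambda>x. - ((1 + 2 * x) powr (- 1 / 2))) x :> (1 + 2 * x) powr (- 3 / 2)" if "ereal c < ereal x" for x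
        using that c by (auto intro!: derivative_eq_intros)
      have C: "isCont (\<lambda>x. (1 + 2 * x) powr (- 3 / 2)) x" if "ereal c < ereal x" for x
        using that c by (intro continuous_intros) auto
      have A: "(((\<lambda>x. - ((1 + 2 * x) powr (- 1 / 2))) \<circ> real_of_ereal) \<longlongrightarrow> - ((1 + 2 * c) powr (- 1 / 2))) (at_right (ereal c))"
        unfolding ereal_tendsto_simps using c by (intro tendsto_intros) auto
      have B: "(((\<lambda>x. - ((1 + 2 * x) powr (- 1 / 2))) \<circ> real_of_ereal) \<longlongrightarrow> 0) (at_left \<infinity>)"
        unfolding ereal_tendsto_simps by real_asymp
      show "set_integrable lborel (einterval (ereal c) \<infinity>) (\<lambda>x. (1 + 2 * x) powr (- 3 / 2))"
        by (rule f(1)) (use D C A B in auto)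
      show "(LBINT x=ereal c..\<infinity>. (1 + 2 * x) powr (- 3 / 2)) = 0 - (- ((1 + 2 * c) powr (- 1 / 2)))"
        by (rule f(2)) (use D C A B in auto)
    qed
    then have si: "set_integrable lborel {c<..} (\<lambda>x. (1 + 2 * x) powr (- 3 / 2))"
      and v: "(LBINT x:{c<..}. (1 + 2 * x) powr (- 3 / 2)) = (1 + 2 * c) powr (- 1 / 2)"
      by (auto simp: interval_lebesgue_integral_def)
    have "((\<lambda>x. (1 + 2 * x) powr (- 3 / 2)) has_integral (1 + 2 * c) powr (- 1 / 2)) {c<..}"
      using set_borel_integral_eq_integral[OF si] v by (simp add: has_integral_iff)
    moreover have "((\<lambda>x. (1 + 2 * x) powr (- 3 / 2)) has_integral (1 + 2 * c) powr (- 1 / 2)) {c..}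
       \<longleftrightarrow> ((\<lambda>x. (1 + 2 * x) powr (- 3 / 2)) has_integral (1 + 2 * c) powr (- 1 / 2)) {c<..}"
    proof (rule has_integral_spike_set_eq)
      show "negligible {x \<in> {c..} - {c<..}. (1 + 2 * x) powr (- 3 / 2) \<noteq> 0}"
        by (rule negligible_subset[of "{c}"]) auto
      show "negligible {x \<in> {c<..} - {c..}. (1 + 2 * x) powr (- 3 / 2) \<noteq> 0}"
        by (rule negligible_subset[of "{}"]) auto
    qed
    ultimately show ?thesis by blast
  qed
  then show ?thesis
  \<comment> \<open>At 0 the density has its default value 0 while the closed form gives 1; this
    point matters when c = 0.\<close>
  proof (rule has_integral_spike[of "{0}", rotated 2])
    fix x assume "x \<in> {c..} - {0}"
    then show "Fdens 2 1 x = (1 + 2 * x) powr (- 3 / 2)" using c by (intro Fdens_2_1) auto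
  qed simp
qed

text \<open>For c <= 0 the tail would have mass 1, the density being 0 on the negative axis, against
  \<alpha> < 1; for c > 0 the tail formula is squared.\<close>

lemma critical_value:
  assumes "\<alpha> < 1" and F: "(Fdens 2 1 has_integral \<alpha>) {c..}"
  shows "c > 0" "\<alpha>\<^sup>2 = 1 / (1 + 2 * c)"
proof -
  show c: "c > 0"
  proof (rule ccontr)
    assume "\<not> c > 0"
    have "(Fdens 2 1 has_integral 1) {c..}"
    proof -
      have "(Fdens 2 1 has_integral 1) {0..}" using Fdens_tail[of 0] by simp
      then have "((\<lambda>x. if x \<in> {0..} then Fdens 2 1 x else 0) has_integral 1) {c..}"
        using \<open>\<not> c > 0\<close> by (subst has_integral_restrict) auto
      moreover have "(\<lambda>x. if x \<in> {0..} then Fdens 2 1 x else 0) = Fdens 2 1" by (auto simp: Fdens_def fun_eq_iff)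
      ultimately show ?thesis by (simp only:)
    qed
    from has_integral_unique[OF F this] have "\<alpha> = 1" .
    then show False using assms(1) by simp
  qed
  have "\<alpha> = (1 + 2 * c) powr (- 1 / 2)" using has_integral_unique[OF F Fdens_tail] c by simp
  then have "\<alpha>\<^sup>2 = (1 + 2 * c) powr (- 1 / 2) * (1 + 2 * c) powr (- 1 / 2)" by (simp only: power2_eq_square)
  also have "\<dots> = (1 + 2 * c) powr (-1)" by (simp only: powr_add[symmetric]) simp
  finally show "\<alpha>\<^sup>2 = 1 / (1 + 2 * c)" using c by (simp add: powr_minus_divide)
qed

text \<open>Monotonicity is used twice, the derivative of each remainder being the remainder of one
  order less. The expansion goes to third order because \<open>beta_inv\<close> divides by
  6|\<theta>|^2 and has to be known up to an error of order |\<theta>|^4.\<close>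

lemma exp_taylor3_lower: "x \<ge> 0 \<Longrightarrow> 1 - exp (- x) \<le> x - x\<^sup>2 / 2 + x ^ 3 / (6::real)"
proof -
  assume x: "x \<ge> 0"
  let ?f = "\<lambda>x. x - x\<^sup>2 / 2 + x ^ 3 / 6 - 1 + exp (- x)"
  let ?g = "\<lambda>x. 1 - x + x\<^sup>2 / 2 - exp (- x)"
  have "?g 0 \<le> ?g y" if "y \<ge> 0" for y :: real
  proof (rule DERIV_nonneg_imp_nondecreasing[OF that])
    fix z :: real assume "0 \<le> z"
    have "DERIV ?g z :> - 1 + z + exp (- z)" by (auto intro!: derivative_eq_intros)
    moreover have "- 1 + z + exp (- z) \<ge> 0" using exp_ge_add_one_self[of "- z"] by simp
    ultimately show "\<exists>y. DERIV ?g z :> y \<and> 0 \<le> y" by blast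
  qed
  then have g: "0 \<le> ?g y" if "y \<ge> 0" for y :: real using that by fastforce
  have "?f 0 \<le> ?f x"
  proof (rule DERIV_nonneg_imp_nondecreasing[OF x])
    fix z :: real assume "0 \<le> z"
    have "DERIV ?f z :> 1 - z + z\<^sup>2 / 2 - exp (- z)" by (auto intro!: derivative_eq_intros)
    then show "\<exists>y. DERIV ?f z :> y \<and> 0 \<le> y" using g[OF \<open>0 \<le> z\<close>] by blast
  qed
  then show ?thesis by simp
qed

lemma beta_inv_upper:
  assumes "\<theta> \<noteq> 0" "\<alpha> < 1"
  shows "beta_inv \<alpha> \<theta> \<le> (1 - \<alpha>) * (1 - 3 * (cmod \<theta>)\<^sup>2 + 6 * ((cmod \<theta>)\<^sup>2)\<^sup>2)"
proof -
  define t where "t = (cmod \<theta>)\<^sup>2"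
  have t: "t > 0" using assms by (simp add: t_def)
  have "1 - exp (- (6 * t)) \<le> 6 * t - (6 * t)\<^sup>2 / 2 + (6 * t) ^ 3 / 6" using t by (intro exp_taylor3_lower) simp
  also have "\<dots> = (6 * t) * (1 - 3 * t + 6 * t\<^sup>2)" by (simp add: power2_eq_square power3_eq_cube algebra_simps)
  finally have "(1 - exp (- (6 * t))) / (6 * t) \<le> 1 - 3 * t + 6 * t\<^sup>2" using t by (simp add: divide_le_eq mult.commute)
  then show ?thesis unfolding beta_inv_formula[OF assms(1)] t_def[symmetric] using assms(2) by (intro mult_left_mono) auto
qed

lemma beta_HH_bounds:
  assumes \<alpha>: "0 < \<alpha>" "\<alpha> < 1" and c: "1 + 2 * c > 0" "\<alpha>\<^sup>2 = 1 / (1 + 2 * c)"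
  obtains m K where "m > 0" "K \<ge> 0"
    "\<And>\<theta>. exp (- 3 * (cmod \<theta>)\<^sup>2) * ((1 - \<alpha>) + m * (cmod \<theta>)\<^sup>2) \<le> beta_HH c \<theta>"
    "\<And>\<theta>. beta_HH c \<theta> \<le> K * exp (- (3 / 2) * \<alpha>\<^sup>2 * (cmod \<theta>)\<^sup>2)"
proof -
  obtain m where m: "m > 0" and lower: "\<And>r s. ennreal ((1 - \<alpha>) * pi ^ 3 + 2 * m * (r\<^sup>2 + s\<^sup>2)) \<le> accept_exp \<alpha> r s"
    using accept_exp_lower[of \<alpha>] \<alpha> by auto
  obtain K where K: "K \<ge> 0" and upper: "\<And>\<theta>. accept \<alpha> \<theta> \<le> ennreal (K * exp (- (3 / 2) * \<alpha>\<^sup>2 * (cmod \<theta>)\<^sup>2))"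
    using accept_upper[of \<alpha>] by auto
  have "exp (- 3 * (cmod \<theta>)\<^sup>2) * ((1 - \<alpha>) + 2 * m / pi ^ 3 * (cmod \<theta>)\<^sup>2) \<le> beta_HH c \<theta>" for \<theta>
  proof -
    let ?L = "(1 - \<alpha>) * pi ^ 3 + 2 * m * (cmod \<theta>)\<^sup>2"
    have L0: "?L \<ge> 0" using \<alpha> m by (intro add_nonneg_nonneg mult_nonneg_nonneg) auto
    have "ennreal (exp (- 3 * (cmod \<theta>)\<^sup>2) * ?L) \<le> accept \<alpha> \<theta>"
      unfolding accept_eq using L0 lower[of "Re \<theta>" "Im \<theta>"]
      by (simp only: ennreal_mult exp_ge_zero cmod_power2[symmetric]) (intro mult_left_mono, auto)
    \<comment> \<open>\<open>enn2real\<close> sends infinity to 0, so the lower bound carries over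
      to the reals only because the value is finite.\<close>
    moreover have "accept \<alpha> \<theta> < top" using upper[of \<theta>] by (rule order.strict_trans1) simp
    ultimately have "exp (- 3 * (cmod \<theta>)\<^sup>2) * ?L \<le> enn2real (accept \<alpha> \<theta>)"
      using enn2real_mono[of "ennreal (exp (- 3 * (cmod \<theta>)\<^sup>2) * ?L)" "accept \<alpha> \<theta>"] L0 by simp
    then have "exp (- 3 * (cmod \<theta>)\<^sup>2) * ?L / pi ^ 3 \<le> beta_HH c \<theta>"
      unfolding beta_HH_eq[OF c] by (intro divide_right_mono) auto
    moreover have "exp (- 3 * (cmod \<theta>)\<^sup>2) * ?L / pi ^ 3 = exp (- 3 * (cmod \<theta>)\<^sup>2) * ((1 - \<alpha>) + 2 * m / pi ^ 3 * (cmod \<theta>)\<^sup>2)"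
      by (simp add: field_simps)
    ultimately show ?thesis by (simp only:)
  qed
  moreover have "beta_HH c \<theta> \<le> K / pi ^ 3 * exp (- (3 / 2) * \<alpha>\<^sup>2 * (cmod \<theta>)\<^sup>2)" for \<theta>
  proof -
    have "enn2real (accept \<alpha> \<theta>) \<le> K * exp (- (3 / 2) * \<alpha>\<^sup>2 * (cmod \<theta>)\<^sup>2)"
      using enn2real_mono[OF upper[of \<theta>]] K by simp
    then have "enn2real (accept \<alpha> \<theta>) / pi ^ 3 \<le> K * exp (- (3 / 2) * \<alpha>\<^sup>2 * (cmod \<theta>)\<^sup>2) / pi ^ 3" by (intro divide_right_mono) auto
    then show ?thesis unfolding beta_HH_eq[OF c] by simp
  qed
  moreover have "2 * m / pi ^ 3 > 0" "K / pi ^ 3 \<ge> 0" using m K by simp_all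
  ultimately show ?thesis using that by blast
qed

lemma frac_less_cross: "0 < x \<Longrightarrow> 0 < y \<Longrightarrow> a * y < b * x \<Longrightarrow> a / x < b / (y::real)"
  by (simp add: field_simps)

theorem theorem6:
  fixes \<alpha> c :: real
  assumes "0 < \<alpha>" and "\<alpha> < 1"
    and "(Fdens 2 1 has_integral \<alpha>) {c..}"
  shows "(\<exists>s>0. \<forall>\<theta>::complex. 0 < cmod \<theta> \<and> cmod \<theta> < s \<longrightarrow> beta_inv \<alpha> \<theta> < beta_HH c \<theta>)
       \<and> (\<exists>t>0. \<forall>\<theta>::complex. cmod \<theta> > t \<longrightarrow> beta_inv \<alpha> \<theta> > beta_HH c \<theta>)"
proof -
  have c: "1 + 2 * c > 0" "\<alpha>\<^sup>2 = 1 / (1 + 2 * c)" using critical_value[OF assms(2,3)] by auto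
  obtain m K where m: "m > 0" and K: "K \<ge> 0"
    and lower: "\<And>\<theta>. exp (- 3 * (cmod \<theta>)\<^sup>2) * ((1 - \<alpha>) + m * (cmod \<theta>)\<^sup>2) \<le> beta_HH c \<theta>"
    and upper: "\<And>\<theta>. beta_HH c \<theta> \<le> K * exp (- (3 / 2) * \<alpha>\<^sup>2 * (cmod \<theta>)\<^sup>2)"
    using beta_HH_bounds[OF assms(1,2) c] by metis
  \<comment> \<open>With t = |\<theta>|^2, the bound t < 1/6 keeps 1 - 3t above 1/2, and 12 t < m
    then makes the gain m t/2 exceed the quadratic error 6 t^2.\<close>
  have "beta_inv \<alpha> \<theta> < beta_HH c \<theta>" if \<theta>: "0 < cmod \<theta>" "cmod \<theta> < sqrt (min (1/6) (m / 12))" for \<theta>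
  proof -
    define t where "t = (cmod \<theta>)\<^sup>2"
    have t0: "t > 0" using \<theta> by (simp add: t_def)
    have "t < min (1/6) (m / 12)"
    proof -
      have "t < (sqrt (min (1/6) (m / 12)))\<^sup>2" unfolding t_def using \<theta> by (intro power_strict_mono) auto
      then show ?thesis using m by simp
    qed
    then have t: "t < 1/6" "12 * t < m" by auto
    have "beta_inv \<alpha> \<theta> \<le> (1 - \<alpha>) * (1 - 3 * t + 6 * t\<^sup>2)"
      unfolding t_def using \<theta> assms(2) by (intro beta_inv_upper) auto
    also have "\<dots> < (1 - 3 * t) * ((1 - \<alpha>) + m * t)"
    proof -
      have "(1 - \<alpha>) * (6 * t\<^sup>2) \<le> 1 * (6 * t\<^sup>2)" using assms(1) by (intro mult_right_mono) auto
      also have "\<dots> = (6 * t) * t" by (simp add: power2_eq_square)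
      also have "\<dots> < (m / 2) * t" using t t0 by (intro mult_strict_right_mono) auto
      also have "\<dots> \<le> (1 - 3 * t) * (m * t)"
      proof -
        have "(1/2) * (m * t) \<le> (1 - 3 * t) * (m * t)" using t t0 m by (intro mult_right_mono) auto
        then show ?thesis by simp
      qed
      finally show ?thesis by (simp add: algebra_simps)
    qed
    also have "\<dots> \<le> exp (- 3 * t) * ((1 - \<alpha>) + m * t)"
      using exp_ge_add_one_self[of "- 3 * t"] assms(2) m t0 by (intro mult_right_mono) auto
    also have "\<dots> \<le> beta_HH c \<theta>" using lower[of \<theta>] by (simp only: t_def)
    finally show ?thesis .
  qed
  moreover have "sqrt (min (1/6) (m / 12)) > 0" using m by simp
  moreover
  define k where "k = (3 / 2) * \<alpha>\<^sup>2"
  have k: "k > 0" using assms(1) by (simp add: k_def)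
  \<comment> \<open>24 = 2 * 12, with 2 from exp(x) >= x^2/2 and 12 from 1 - exp(-6t) >= 1/2 over
    the denominator 6t. The lower bound 1 on \<open>T\<close> secures the latter and makes
    |\<theta>|^2 exceed \<open>T\<close> as well.\<close>
  define T where "T = max 1 (24 * K / (k\<^sup>2 * (1 - \<alpha>)))"
  have T1: "T \<ge> 1" by (simp add: T_def)
  have "beta_HH c \<theta> < beta_inv \<alpha> \<theta>" if \<theta>: "cmod \<theta> > T" for \<theta>
  proof -
    define t where "t = (cmod \<theta>)\<^sup>2"
    have "T * 1 < cmod \<theta> * cmod \<theta>" using \<theta> T1 by (intro mult_strict_mono) auto
    then have tT: "t > T" by (simp add: t_def power2_eq_square)
    then have t: "t > 1" "t > 24 * K / (k\<^sup>2 * (1 - \<alpha>))" by (auto simp: T_def)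
    have kt: "k * t > 0" using k t by simp
    have e: "exp (k * t) \<ge> (k * t)\<^sup>2 / 2"
      using exp_lower_Taylor_quadratic[OF less_imp_le[OF kt]] kt by linarith
    have "beta_HH c \<theta> \<le> K * exp (- (k * t))" using upper[of \<theta>] by (simp add: k_def t_def)
    also have "\<dots> \<le> K * (2 / (k * t)\<^sup>2)"
    proof -
      have "exp (- (k * t)) = 1 / exp (k * t)" by (simp add: exp_minus divide_inverse)
      also have "\<dots> \<le> 1 / ((k * t)\<^sup>2 / 2)" using e k t(1) by (intro divide_left_mono mult_pos_pos) auto
      finally show ?thesis using K by (intro mult_left_mono) auto
    qed
    also have "\<dots> < (1 - \<alpha>) / (12 * t)"
    proof -
      have "24 * K < t * (k\<^sup>2 * (1 - \<alpha>))" using t(2) k assms(2) by (simp add: divide_less_eq)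
      then have "24 * K * t < (t * (k\<^sup>2 * (1 - \<alpha>))) * t" using t(1) by (intro mult_strict_right_mono) auto
      then have "(K * 2) * (12 * t) < (1 - \<alpha>) * (k * t)\<^sup>2" by (simp add: power2_eq_square mult_ac)
      then have "(K * 2) / (k * t)\<^sup>2 < (1 - \<alpha>) / (12 * t)" using kt t(1) by (intro frac_less_cross) auto
      then show ?thesis by simp
    qed
    also have "\<dots> \<le> beta_inv \<alpha> \<theta>"
    proof -
      have th: "\<theta> \<noteq> 0" using \<theta> T1 by auto
      have "exp (- (6 * t)) \<le> 1 / 2"
      proof -
        have "exp (6 * t) \<ge> 2" using exp_ge_add_one_self[of "6 * t"] t(1) by linarith
        then show ?thesis by (simp add: exp_minus inverse_eq_divide divide_le_eq)
      qed
      then have "(1/2) / (6 * t) \<le> (1 - exp (- (6 * t))) / (6 * t)" using t(1) by (intro divide_right_mono) auto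
      then have "(1 - \<alpha>) * ((1/2) / (6 * t)) \<le> (1 - \<alpha>) * ((1 - exp (- (6 * t))) / (6 * t))"
        using assms(2) by (intro mult_left_mono) auto
      then show ?thesis unfolding beta_inv_formula[OF th] by (simp add: t_def)
    qed
    finally show ?thesis .
  qed
  then have "\<exists>t>0. \<forall>\<theta>::complex. cmod \<theta> > t \<longrightarrow> beta_inv \<alpha> \<theta> > beta_HH c \<theta>"
    using T1 by (intro exI[of _ T]) auto
  ultimately show ?thesis by blast
qed

end
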